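(* Let $p\neq q$ be positive integers. For $n\ge 1$ let $f_n\in L^2_s(\mu^p)$ and $g_n\in L^2_s(\mu^q)$, and set $$X_n=I_p^\eta(f_n),\qquad Y_n=I_q^\eta(g_n),\qquad Z_n=X_n+Y_n,$$ where $I_m^\eta$ denotes the $m$-th multiple Poisson integral. Assume that $E[Z_n^2]=1$ for all $n$ and that $$E[X_n^3Y_n]\to 0,\qquad E[X_nY_n^3]\to 0\qquad (n\to\infty),$$ (in particular, these expectations are well defined and finite). If $E[Z_n^4]\to 3$ as $n\to\infty$, then $Z_n$ converges in distribution to $\mathcal N(0,1)$.
   Context: $\eta$ is a Poisson random measure on a measurable space $(E,\mathcal E)$ with $\sigma$-finite control (intensity) measure $\mu$, and $\hat\eta=\eta-\mu$ is the compensated Poisson measure. For $m\ge 1$, $L^2_s(\mu^m)$ is the space of real functions in $L^2(E^m,\mu^m)$ that are symmetric in their $m$ arguments ($\mu^m$-a.e.). For $f\in L^2_s(\mu^m)$, $I_m^\eta(f)$ denotes the $m$-th multiple Wiener--Itô (Poisson) integral of $f$ with respect to $\hat\eta$, $$I_m^\eta(f)=\int_{E^m}f(x_1,\dots,x_m)\,\hat\eta(dx_1)\cdots\hat\eta(dx_m),$$ understood in the usual sense (diagonals excluded). It satisfies $E[I_m^\eta(f)I_m^\eta(g)]=m!\,\langle f,g\rangle_{L^2(\mu^m)}$, and $E[I_p^\eta(f)I_q^\eta(g)]=0$ for $p\neq q$. $\mathcal N(0,1)$ is the standard normal law. *)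

theory Defs
  imports "HOL-Probability.Probability"
begin

text \<open>
  The probability mass function is written out, because the library's \<open>poisson_pmf\<close> is
  only meaningful for positive rates; here \<open>0 ^ 0 = 1\<close>, so for \<open>emeasure \<mu> A = 0\<close> the
  formula says that the mass of \<open>A\<close> is almost surely \<open>0\<close>.
\<close>

locale poisson_random_measure =
  prob_space P + control: sigma_finite_measure \<mu>
  for P :: "'w measure" and \<mu> :: "'e measure" +
  fixes \<eta> :: "'w \<Rightarrow> 'e measure"
  assumes sets_eta: "\<And>\<omega>. \<omega> \<in> space P \<Longrightarrow> sets (\<eta> \<omega>) = sets \<mu>"
    and measurable_eta:
      "\<And>A. A \<in> sets \<mu> \<Longrightarrow> (\<lambda>\<omega>. emeasure (\<eta> \<omega>) A) \<in> borel_measurable P"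
    and poisson_finite:
      "\<And>A k. A \<in> sets \<mu> \<Longrightarrow> emeasure \<mu> A < \<infinity> \<Longrightarrow>
        prob {\<omega> \<in> space P. emeasure (\<eta> \<omega>) A = of_nat k} =
          measure \<mu> A ^ k / fact k * exp (- measure \<mu> A)"
    and poisson_infinite:
      "\<And>A. A \<in> sets \<mu> \<Longrightarrow> emeasure \<mu> A = \<infinity> \<Longrightarrow> AE \<omega> in P. emeasure (\<eta> \<omega>) A = \<infinity>"
    and independent_scattering:
      "\<And>(n :: nat) A. A ` {..<n} \<subseteq> sets \<mu> \<Longrightarrow> disjoint_family_on A {..<n} \<Longrightarrow>
        indep_vars (\<lambda>_. borel) (\<lambda>i \<omega>. emeasure (\<eta> \<omega>) (A i)) {..<n}"

definition square_integrable :: "'a measure \<Rightarrow> ('a \<Rightarrow> real) \<Rightarrow> bool" where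
  "square_integrable M f \<longleftrightarrow> f \<in> borel_measurable M \<and> integrable M (\<lambda>x. (f x)\<^sup>2)"

definition L2_converges :: "'a measure \<Rightarrow> (nat \<Rightarrow> 'a \<Rightarrow> real) \<Rightarrow> ('a \<Rightarrow> real) \<Rightarrow> bool" where
  "L2_converges M F f \<longleftrightarrow>
    (\<lambda>k. \<integral>\<^sup>+ x. ennreal ((F k x - f x)\<^sup>2) \<partial>M) \<longlonglongrightarrow> 0"

text \<open>Points of \<open>E\<^sup>m\<close> are extensional functions on \<open>{..<m}\<close>.\<close>

abbreviation power_measure :: "'e measure \<Rightarrow> nat \<Rightarrow> (nat \<Rightarrow> 'e) measure" where
  "power_measure \<mu> m \<equiv> Pi\<^sub>M {..<m} (\<lambda>_. \<mu>)"

definition L2_sym :: "'e measure \<Rightarrow> nat \<Rightarrow> ((nat \<Rightarrow> 'e) \<Rightarrow> real) set" where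
  "L2_sym \<mu> m = {f. square_integrable (power_measure \<mu> m) f \<and>
     (\<forall>\<pi>. \<pi> permutes {..<m} \<longrightarrow> (AE x in power_measure \<mu> m. f (x \<circ> \<pi>) = f x))}"

text \<open>
  An elementary kernel is a linear combination of indicators of boxes
  \<open>A (i 0) \<times> \<dots> \<times> A (i (m - 1))\<close>, where the \<open>A j\<close> with \<open>j < N\<close> are pairwise disjoint sets of
  finite control measure.  Boxes with repeated sides are allowed: if \<open>\<mu>\<close> has atoms, kernels
  without such boxes are not dense.
\<close>

definition kernel_cells :: "'e measure \<Rightarrow> nat \<Rightarrow> (nat \<Rightarrow> 'e set) \<Rightarrow> bool" where
  "kernel_cells \<mu> N A \<longleftrightarrow>
    disjoint_family_on A {..<N} \<and> (\<forall>j<N. A j \<in> sets \<mu> \<and> emeasure \<mu> (A j) < \<infinity>)"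

definition elementary_kernel ::
    "nat \<Rightarrow> nat \<Rightarrow> (nat \<Rightarrow> 'e set) \<Rightarrow> ((nat \<Rightarrow> nat) \<Rightarrow> real) \<Rightarrow> (nat \<Rightarrow> 'e) \<Rightarrow> real" where
  "elementary_kernel m N A a x =
    (\<Sum>i \<in> {..<m} \<rightarrow>\<^sub>E {..<N}. a i * (\<Prod>l<m. indicator (A (i l)) (x l)))"

text \<open>
  The \<open>card J\<close>-th factorial measure of \<open>\<nu>\<close> (all tuples of points of \<open>\<nu>\<close> with no point used
  twice, that is, the product measure with the diagonals excluded), evaluated at the box with
  sides \<open>A (i l)\<close>, \<open>l \<in> J\<close>.  Since the \<open>A j\<close> are pairwise disjoint, it is a product over \<open>j\<close> of
  the number of ways to choose an ordered tuple of distinct points in \<open>A j\<close>, one for each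
  \<open>l \<in> J\<close> with \<open>i l = j\<close>.  Points are counted with multiplicity; several points of \<open>\<nu>\<close> at the
  same location count as distinct.
\<close>

definition factorial_box ::
    "'e measure \<Rightarrow> nat \<Rightarrow> (nat \<Rightarrow> 'e set) \<Rightarrow> (nat \<Rightarrow> nat) \<Rightarrow> nat set \<Rightarrow> real" where
  "factorial_box \<nu> N A i J =
    (\<Prod>j<N. \<Prod>r<card {l \<in> J. i l = j}. measure \<nu> (A j) - real r)"

text \<open>
  The integral of the indicator of a box against \<open>(\<nu> - \<mu>)(dx\<^sub>1) \<dots> (\<nu> - \<mu>)(dx\<^sub>m)\<close> with the
  diagonals excluded: expand the product and replace powers of \<open>\<nu>\<close> by factorial measures.
\<close>

definition compensated_box ::
    "'e measure \<Rightarrow> 'e measure \<Rightarrow> nat \<Rightarrow> nat \<Rightarrow> (nat \<Rightarrow> 'e set) \<Rightarrow> (nat \<Rightarrow> nat) \<Rightarrow> real" where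
  "compensated_box \<mu> \<nu> m N A i =
    (\<Sum>J \<in> Pow {..<m}. (-1) ^ (m - card J) *
       factorial_box \<nu> N A i J * (\<Prod>l \<in> {..<m} - J. measure \<mu> (A (i l))))"

definition elementary_integral ::
    "'e measure \<Rightarrow> 'e measure \<Rightarrow> nat \<Rightarrow> nat \<Rightarrow> (nat \<Rightarrow> 'e set) \<Rightarrow> ((nat \<Rightarrow> nat) \<Rightarrow> real) \<Rightarrow> real"
  where
  "elementary_integral \<mu> \<nu> m N A a =
    (\<Sum>i \<in> {..<m} \<rightarrow>\<^sub>E {..<N}. a i * compensated_box \<mu> \<nu> m N A i)"

text \<open>
  \<open>X\<close> is a version of the multiple integral \<open>I\<^sub>m(f)\<close>, the extension of the elementary integral
  by continuity from \<open>L\<^sup>2(\<mu>\<^sup>m)\<close> to \<open>L\<^sup>2(P)\<close>; as an element of \<open>L\<^sup>2(P)\<close> it is determined up to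
  almost sure equality.
\<close>

definition has_multiple_poisson_integral ::
    "'w measure \<Rightarrow> 'e measure \<Rightarrow> ('w \<Rightarrow> 'e measure) \<Rightarrow> nat \<Rightarrow>
      ((nat \<Rightarrow> 'e) \<Rightarrow> real) \<Rightarrow> ('w \<Rightarrow> real) \<Rightarrow> bool" where
  "has_multiple_poisson_integral P \<mu> \<eta> m f X \<longleftrightarrow>
    square_integrable P X \<and>
    (\<exists>N A a. (\<forall>k. kernel_cells \<mu> (N k) (A k)) \<and>
       L2_converges (power_measure \<mu> m) (\<lambda>k. elementary_kernel m (N k) (A k) (a k)) f \<and>
       L2_converges P (\<lambda>k \<omega>. elementary_integral \<mu> (\<eta> \<omega>) m (N k) (A k) (a k)) X)"

text \<open>On a box with pairwise different sides this is the classical product of compensated masses.\<close>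

lemma compensated_box_off_diagonal:
  assumes "i \<in> {..<m} \<rightarrow>\<^sub>E {..<N}" and "inj_on i {..<m}"
  shows "compensated_box \<mu> \<nu> m N A i = (\<Prod>l<m. measure \<nu> (A (i l)) - measure \<mu> (A (i l)))"
proof -
  have fb: "factorial_box \<nu> N A i J = (\<Prod>l\<in>J. measure \<nu> (A (i l)))" if J: "J \<subseteq> {..<m}" for J
  proof -
    have inj: "inj_on i J" using assms(2) J by (rule inj_on_subset)
    have iJ: "i ` J \<subseteq> {..<N}" using assms(1) J by (auto simp: PiE_def Pi_def)
    have *: "(\<Prod>r<card {l \<in> J. i l = j}. measure \<nu> (A j) - real r) =
        (if j \<in> i ` J then measure \<nu> (A j) else 1)" for j
    proof (cases "j \<in> i ` J")
      case True
      then obtain l where "l \<in> J" "i l = j" by auto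
      then have "{l \<in> J. i l = j} = {l}" using inj by (auto simp: inj_on_def)
      then show ?thesis using True by simp
    next
      case False
      then have "card {l \<in> J. i l = j} = 0"
        by (metis (mono_tags, lifting) card.empty empty_Collect_eq image_eqI)
      then show ?thesis using False by (simp only: lessThan_0 prod.empty if_False)
    qed
    have "factorial_box \<nu> N A i J = (\<Prod>j<N. if j \<in> i ` J then measure \<nu> (A j) else 1)"
      unfolding factorial_box_def by (simp only: *)
    also have "\<dots> = (\<Prod>j\<in>i ` J. measure \<nu> (A j))"
      using iJ by (simp add: prod.If_cases Int_absorb1)
    also have "\<dots> = (\<Prod>l\<in>J. measure \<nu> (A (i l)))"
      using inj by (simp add: prod.reindex)
    finally show ?thesis .
  qed
  have "(\<Prod>l<m. measure \<nu> (A (i l)) - measure \<mu> (A (i l))) =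
      (\<Prod>l<m. measure \<nu> (A (i l)) + (- measure \<mu> (A (i l))))"
    by simp
  also have "\<dots> = (\<Sum>J\<in>Pow {..<m}. (\<Prod>l\<in>J. measure \<nu> (A (i l))) *
      (\<Prod>l\<in>{..<m} - J. - measure \<mu> (A (i l))))"
    by (rule prod_add) simp
  also have "\<dots> = compensated_box \<mu> \<nu> m N A i"
    unfolding compensated_box_def
  proof (rule sum.cong [OF refl])
    fix J assume "J \<in> Pow {..<m}"
    then have J: "J \<subseteq> {..<m}" by simp
    then have "card ({..<m} - J) = m - card J"
      by (simp add: card_Diff_subset finite_subset)
    then show "(\<Prod>l\<in>J. measure \<nu> (A (i l))) * (\<Prod>l\<in>{..<m} - J. - measure \<mu> (A (i l))) =
      (-1) ^ (m - card J) * factorial_box \<nu> N A i J * (\<Prod>l \<in> {..<m} - J. measure \<mu> (A (i l)))"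
      by (simp add: prod_uminus fb [OF J])
  qed
  finally show ?thesis by simp
qed

end

theory Submission
  imports Defs
begin

text \<open>
  Expanding \<open>E Z\<^sup>4\<close> with \<open>E Z\<^sup>2 = E X\<^sup>2 + E Y\<^sup>2\<close> gives
  \<open>E Z\<^sup>4 - 3 (E Z\<^sup>2)\<^sup>2 - 4 E X\<^sup>3Y - 4 E XY\<^sup>3 = \<kappa>(X) + \<kappa>(Y) + 6 (E X\<^sup>2Y\<^sup>2 - E X\<^sup>2 E Y\<^sup>2)\<close> with
  \<open>\<kappa>(X) = E X\<^sup>4 - 3 (E X\<^sup>2)\<^sup>2\<close>.  All three terms on the right are nonnegative, so each of them
  tends to \<open>0\<close>, and they control the variance of the carre du champ operators and the fourth
  moments of the jumps of \<open>X\<close> and \<open>Y\<close>.  This bounds the error in Stein's equation for \<open>Z\<close>;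
  with sines and cosines as test functions, the characteristic function of \<open>Z\<close> nearly solves
  \<open>\<phi>'(t) + t \<phi>(t) = 0\<close>.

  The nonnegativity comes from the component of highest order of a product, the Wick product:
  \<open>E (u \<diamond> v)\<^sup>2 \<ge> E u\<^sup>2 E v\<^sup>2\<close>, and \<open>E (u \<diamond> u)\<^sup>2 \<ge> 2 (E u\<^sup>2)\<^sup>2\<close>.  This is proved on finite
  partitions, where multiple integrals are Charlier polynomials in independent Poisson counts,
  generated by creation operators that satisfy the canonical commutation relations with the
  difference operators.  The general case follows because projecting \<open>X\<close> onto the functions of
  the counts of a finite partition preserves the chaos and approximates \<open>X\<close> in \<open>L\<^sup>4\<close>, although the
  elementary integrals in the definition of \<open>X\<close> converge only in \<open>L\<^sup>2\<close>.
\<close>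

section \<open>Creation and difference operators, and chaoses of functions of counts\<close>

text \<open>Classical proofs expand a product of two integrals in contractions of the kernels, and
  on Poisson space square integrable kernels need not have square integrable contractions. On a
  finite partition this obstacle vanishes: every function that occurs has polynomial growth, so all
  moments exist, and creation and difference operators stand in for kernels. In Stein's equation the
  test function enters through the carre du champ, which for a jump process is not a derivation. The
  Taylor remainder at each jump is what brings in fourth moments of jumps, besides the fluctuation
  of the carre du champ. For the sum there is also a mixed term; \<open>p \<noteq> q\<close> makes
  its mean zero, and the covariance of the squares bounds its second moment. The passage to fourth
  moments rests on two facts: truncation is Lipschitz and bounded, so \<open>L2\<close> convergence
  of elementary integrals yields fourth mean convergence of their truncations, and conditional
  expectation given the counts does not increase fourth moments.\<close>

definition diff_op :: "'i \<Rightarrow> (('i \<Rightarrow> nat) \<Rightarrow> real) \<Rightarrow> ('i \<Rightarrow> nat) \<Rightarrow> real" where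
  "diff_op i \<phi> = (\<lambda>k. \<phi> (k(i := Suc (k i))) - \<phi> k)"

text \<open>Applied to the constant 1 this is the compensated count of cell \<open>i\<close>. Under
  the Poisson law it is the adjoint of \<open>lam i\<close> times \<open>diff_op i\<close>. The
  truncated predecessor at \<open>k i = 0\<close> is harmless because of the factor
  \<open>real (k i)\<close>.\<close>

definition create_op :: "('i \<Rightarrow> real) \<Rightarrow> 'i \<Rightarrow> (('i \<Rightarrow> nat) \<Rightarrow> real) \<Rightarrow> ('i \<Rightarrow> nat) \<Rightarrow> real" where
  "create_op lam i \<phi> = (\<lambda>k. real (k i) * \<phi> (k(i := k i - 1)) - lam i * \<phi> k)"

text \<open>Iterated creation applied to constants produces the Charlier polynomials of total degree
  \<open>n\<close>. An inductive predicate, rather than their span, gives an induction rule in which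
  each argument has to treat only one creation at a time. \<open>chaos_zero\<close> makes every
  order a subspace even when \<open>I\<close> is empty.\<close>

inductive chaos :: "'i set \<Rightarrow> ('i \<Rightarrow> real) \<Rightarrow> nat \<Rightarrow> (('i \<Rightarrow> nat) \<Rightarrow> real) \<Rightarrow> bool"
  for I :: "'i set" and lam :: "'i \<Rightarrow> real" where
  chaos_const: "chaos I lam 0 (\<lambda>_. c)"
| chaos_create: "chaos I lam n \<phi> \<Longrightarrow> i \<in> I \<Longrightarrow> chaos I lam (Suc n) (create_op lam i \<phi>)"
| chaos_add: "chaos I lam n \<phi> \<Longrightarrow> chaos I lam n \<psi> \<Longrightarrow> chaos I lam n (\<lambda>k. \<phi> k + \<psi> k)"
| chaos_scale: "chaos I lam n \<phi> \<Longrightarrow> chaos I lam n (\<lambda>k. c * \<phi> k)"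
| chaos_zero: "chaos I lam n (\<lambda>_. 0)"

lemma diff_op_zero [simp]: "diff_op i (\<lambda>_. c) = (\<lambda>_. 0)"
  by (simp add: diff_op_def)

lemma diff_op_add: "diff_op i (\<lambda>k. \<phi> k + \<psi> k) = (\<lambda>k. diff_op i \<phi> k + diff_op i \<psi> k)"
  by (simp add: diff_op_def fun_eq_iff)

lemma diff_op_diff: "diff_op i (\<lambda>k. \<phi> k - \<psi> k) = (\<lambda>k. diff_op i \<phi> k - diff_op i \<psi> k)"
  by (simp add: diff_op_def fun_eq_iff)

lemma diff_op_scale: "diff_op i (\<lambda>k. c * \<phi> k) = (\<lambda>k. c * diff_op i \<phi> k)"
  by (simp add: diff_op_def fun_eq_iff algebra_simps)

lemma diff_op_sum: "diff_op i (\<lambda>k. \<Sum>a\<in>S. \<phi> a k) = (\<lambda>k. \<Sum>a\<in>S. diff_op i (\<phi> a) k)"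
  by (simp add: diff_op_def fun_eq_iff sum_subtractf)

lemma diff_op_mult:
  "diff_op i (\<lambda>k. \<phi> k * \<psi> k) =
    (\<lambda>k. diff_op i \<phi> k * \<psi> k + \<phi> k * diff_op i \<psi> k + diff_op i \<phi> k * diff_op i \<psi> k)"
  by (simp add: diff_op_def fun_eq_iff algebra_simps)

lemma diff_op_commute: "diff_op i (diff_op j \<phi>) = diff_op j (diff_op i \<phi>)"
  by (cases "i = j") (auto simp: diff_op_def fun_eq_iff fun_upd_twist)

lemma create_op_zero [simp]: "create_op lam i (\<lambda>_. 0) = (\<lambda>_. 0)"
  by (simp add: create_op_def)

lemma create_op_add:
  "create_op lam i (\<lambda>k. \<phi> k + \<psi> k) = (\<lambda>k. create_op lam i \<phi> k + create_op lam i \<psi> k)"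
  by (simp add: create_op_def fun_eq_iff algebra_simps)

lemma create_op_diff:
  "create_op lam i (\<lambda>k. \<phi> k - \<psi> k) = (\<lambda>k. create_op lam i \<phi> k - create_op lam i \<psi> k)"
  by (simp add: create_op_def fun_eq_iff algebra_simps)

lemma create_op_scale: "create_op lam i (\<lambda>k. c * \<phi> k) = (\<lambda>k. c * create_op lam i \<phi> k)"
  by (simp add: create_op_def fun_eq_iff algebra_simps)

lemma create_op_sum:
  "create_op lam i (\<lambda>k. \<Sum>a\<in>S. \<phi> a k) = (\<lambda>k. \<Sum>a\<in>S. create_op lam i (\<phi> a) k)"
  by (simp add: create_op_def fun_eq_iff sum_subtractf sum_distrib_left)

lemma create_op_commute: "create_op lam i (create_op lam j \<phi>) = create_op lam j (create_op lam i \<phi>)"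
  by (cases "i = j") (auto simp: create_op_def fun_eq_iff fun_upd_twist algebra_simps)

text \<open>The canonical commutation relation. For \<open>i = j\<close> the extra term appears
  because adding a point and then deleting one returns to \<open>k\<close>, with weight
  \<open>k j + 1\<close> instead of \<open>k j\<close>.\<close>

lemma diff_create:
  "diff_op i (create_op lam j \<phi>) =
    (\<lambda>k. create_op lam j (diff_op i \<phi>) k + (if i = j then \<phi> k else 0))"
proof (cases "i = j")
  case True
  have "diff_op i (create_op lam j \<phi>) k = create_op lam j (diff_op i \<phi>) k + \<phi> k" for k
  proof -
    have "k j > 0 \<Longrightarrow> k(j := Suc (k j - Suc 0)) = k"
      by (auto simp: fun_eq_iff)
    then show ?thesis using True
      by (cases "k j = 0") (auto simp: diff_op_def create_op_def algebra_simps)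
  qed
  with True show ?thesis by auto
next
  case False
  then show ?thesis
    by (auto simp: diff_op_def create_op_def fun_eq_iff algebra_simps fun_upd_twist)
qed

text \<open>A Leibniz rule that pulls creation out of a product. Only the first term can reach the
  full order; the other two contain a difference of \<open>\<psi>\<close> and have lower order,
  which is what drives the inductions on products.\<close>

lemma create_op_mult:
  "(\<lambda>k. create_op lam i \<phi> k * \<psi> k) =
    (\<lambda>k. create_op lam i (\<lambda>k. \<phi> k * \<psi> k) k + create_op lam i (\<lambda>k. \<phi> k * diff_op i \<psi> k) k
      + lam i * (\<phi> k * diff_op i \<psi> k))"
proof
  fix k :: "'a \<Rightarrow> nat"
  have "k i > 0 \<Longrightarrow> k(i := Suc (k i - Suc 0)) = k"
    by (auto simp: fun_eq_iff)
  then show "create_op lam i \<phi> k * \<psi> k =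
    create_op lam i (\<lambda>k. \<phi> k * \<psi> k) k + create_op lam i (\<lambda>k. \<phi> k * diff_op i \<psi> k) k
      + lam i * (\<phi> k * diff_op i \<psi> k)"
    by (cases "k i = 0") (auto simp: diff_op_def create_op_def algebra_simps)
qed

lemma chaos_sum:
  assumes "\<And>a. a \<in> S \<Longrightarrow> chaos I lam n (\<phi> a)"
  shows "chaos I lam n (\<lambda>k. \<Sum>a\<in>S. \<phi> a k)"
  using assms
proof (induction S rule: infinite_finite_induct)
  case (insert x F)
  then have "chaos I lam n (\<lambda>k. \<phi> x k + (\<Sum>a\<in>F. \<phi> a k))"
    by (intro chaos_add) auto
  then show ?case using insert by simp
qed (simp_all add: chaos_zero)

lemma chaos_diff:
  assumes "chaos I lam n \<phi>" "chaos I lam n \<psi>"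
  shows "chaos I lam n (\<lambda>k. \<phi> k - \<psi> k)"
  using chaos_add [OF assms(1) chaos_scale [OF assms(2), of "-1"]] by simp

lemma chaos_0D: "chaos I lam n \<phi> \<Longrightarrow> n = 0 \<Longrightarrow> \<exists>c. \<phi> = (\<lambda>_. c)"
  by (induction rule: chaos.induct) auto

text \<open>The truncated \<open>n - 1\<close> is correct at \<open>n = 0\<close> as well, since
  constants have difference zero.\<close>

lemma chaos_diff_op:
  assumes "chaos I lam n \<phi>" and "i \<in> I"
  shows "chaos I lam (n - 1) (diff_op i \<phi>)"
  using assms
proof (induction rule: chaos.induct)
  case (chaos_create n \<phi> j)
  show ?case
  proof (cases n)
    case 0
    then obtain c where "\<phi> = (\<lambda>_. c)" using chaos_0D chaos_create by blast
    then show ?thesis using 0 by (auto simp: diff_create intro: chaos_const)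
  next
    case (Suc m)
    then have 1: "chaos I lam (Suc m) (create_op lam j (diff_op i \<phi>))"
      using chaos_create by (auto intro: chaos.chaos_create)
    have 2: "chaos I lam (Suc m) (\<lambda>k. if i = j then \<phi> k else 0)"
      using chaos_create Suc by (cases "i = j") (auto intro: chaos_zero)
    from chaos_add [OF 1 2] Suc show ?thesis by (simp add: diff_create)
  qed
qed (auto simp: diff_op_add diff_op_scale intro: chaos.intros)

lemma chaos_Suc_diff_op: "chaos I lam (Suc n) \<phi> \<Longrightarrow> i \<in> I \<Longrightarrow> chaos I lam n (diff_op i \<phi>)"
  using chaos_diff_op by fastforce

lemma chaos_0_diff_op: "chaos I lam 0 \<phi> \<Longrightarrow> diff_op i \<phi> = (\<lambda>_. 0)"
  using chaos_0D by fastforce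

definition number_op :: "'i set \<Rightarrow> ('i \<Rightarrow> real) \<Rightarrow> (('i \<Rightarrow> nat) \<Rightarrow> real) \<Rightarrow> ('i \<Rightarrow> nat) \<Rightarrow> real" where
  "number_op I lam \<phi> = (\<lambda>k. \<Sum>i\<in>I. create_op lam i (diff_op i \<phi>) k)"

text \<open>By the commutation relation, moving \<open>create_op lam j\<close> out of the number
  operator adds one copy of it, so each creation raises the eigenvalue by one.\<close>

lemma number_op_chaos:
  assumes "chaos I lam n \<phi>" and "finite I"
  shows "number_op I lam \<phi> = (\<lambda>k. real n * \<phi> k)"
  using assms
proof (induction rule: chaos.induct)
  case (chaos_create n \<phi> j)
  have "number_op I lam (create_op lam j \<phi>) k = real (Suc n) * create_op lam j \<phi> k" for k
  proof -
    have "number_op I lam (create_op lam j \<phi>) k =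
      (\<Sum>i\<in>I. create_op lam j (create_op lam i (diff_op i \<phi>)) k + (if i = j then create_op lam j \<phi> k else 0))"
      unfolding number_op_def diff_create create_op_add
      by (intro sum.cong refl) (auto simp: create_op_commute)
    also have "\<dots> = create_op lam j (number_op I lam \<phi>) k + create_op lam j \<phi> k"
      using chaos_create.hyps chaos_create.prems
      unfolding number_op_def create_op_sum by (simp add: sum.distrib)
    also have "\<dots> = real (Suc n) * create_op lam j \<phi> k"
      using chaos_create by (simp add: create_op_scale algebra_simps)
    finally show ?thesis .
  qed
  then show ?case by auto
next
  case (chaos_add n \<phi> \<psi>)
  have "number_op I lam (\<lambda>k. \<phi> k + \<psi> k) = (\<lambda>k. number_op I lam \<phi> k + number_op I lam \<psi> k)"
    by (simp add: number_op_def diff_op_add create_op_add sum.distrib)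
  with chaos_add show ?case by (simp add: algebra_simps)
next
  case (chaos_scale n \<phi> c)
  have "number_op I lam (\<lambda>k. c * \<phi> k) = (\<lambda>k. c * number_op I lam \<phi> k)"
    by (simp add: number_op_def diff_op_scale create_op_scale sum_distrib_left)
  with chaos_scale show ?case by (simp add: algebra_simps)
qed (simp_all add: number_op_def)

section \<open>Sums of chaoses of order strictly below a bound\<close>

definition chaos_below :: "'i set \<Rightarrow> ('i \<Rightarrow> real) \<Rightarrow> nat \<Rightarrow> (('i \<Rightarrow> nat) \<Rightarrow> real) \<Rightarrow> bool" where
  "chaos_below I lam m \<phi> \<longleftrightarrow> (\<exists>w. (\<forall>n. chaos I lam n (w n)) \<and> \<phi> = (\<lambda>k. \<Sum>n<m. w n k))"

lemma chaos_belowI: "(\<And>n. chaos I lam n (w n)) \<Longrightarrow> \<phi> = (\<lambda>k. \<Sum>n<m. w n k) \<Longrightarrow> chaos_below I lam m \<phi>"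
  unfolding chaos_below_def by blast

lemma chaos_below_0: "chaos_below I lam 0 \<phi> \<Longrightarrow> \<phi> = (\<lambda>_. 0)"
  by (simp add: chaos_below_def)

lemma chaos_below_zero: "chaos_below I lam m (\<lambda>_. 0)"
  by (rule chaos_belowI [where w = "\<lambda>_ _. 0"]) (simp_all add: chaos_zero)

lemma chaos_below_add:
  assumes "chaos_below I lam m \<phi>" "chaos_below I lam m \<psi>"
  shows "chaos_below I lam m (\<lambda>k. \<phi> k + \<psi> k)"
proof -
  obtain w w' where "\<And>n. chaos I lam n (w n)" "\<And>n. chaos I lam n (w' n)"
    "\<phi> = (\<lambda>k. \<Sum>n<m. w n k)" "\<psi> = (\<lambda>k. \<Sum>n<m. w' n k)"
    using assms unfolding chaos_below_def by blast
  then show ?thesis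
    by (intro chaos_belowI [where w = "\<lambda>n k. w n k + w' n k"]) (auto intro: chaos_add simp: sum.distrib)
qed

lemma chaos_below_scale:
  assumes "chaos_below I lam m \<phi>"
  shows "chaos_below I lam m (\<lambda>k. c * \<phi> k)"
proof -
  obtain w where "\<And>n. chaos I lam n (w n)" "\<phi> = (\<lambda>k. \<Sum>n<m. w n k)"
    using assms unfolding chaos_below_def by blast
  then show ?thesis
    by (intro chaos_belowI [where w = "\<lambda>n k. c * w n k"]) (auto intro: chaos_scale simp: sum_distrib_left)
qed

lemma chaos_below_diff:
  assumes "chaos_below I lam m \<phi>" "chaos_below I lam m \<psi>"
  shows "chaos_below I lam m (\<lambda>k. \<phi> k - \<psi> k)"
  using chaos_below_add [OF assms(1) chaos_below_scale [OF assms(2), of "-1"]] by simp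

lemma chaos_below_sum:
  assumes "\<And>a. a \<in> S \<Longrightarrow> chaos_below I lam n (\<phi> a)"
  shows "chaos_below I lam n (\<lambda>k. \<Sum>a\<in>S. \<phi> a k)"
  using assms
proof (induction S rule: infinite_finite_induct)
  case (insert x F)
  then have "chaos_below I lam n (\<lambda>k. \<phi> x k + (\<Sum>a\<in>F. \<phi> a k))"
    by (intro chaos_below_add) auto
  then show ?case using insert by simp
qed (simp_all add: chaos_below_zero)

lemma chaos_below_chaos:
  assumes "chaos I lam n \<phi>" "n < m"
  shows "chaos_below I lam m \<phi>"
proof (rule chaos_belowI [where w = "\<lambda>l k. if l = n then \<phi> k else 0"])
  show "chaos I lam l (\<lambda>k. if l = n then \<phi> k else 0)" for l
    using assms by (cases "l = n") (auto intro: chaos_zero)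
  show "\<phi> = (\<lambda>k. \<Sum>l<m. if l = n then \<phi> k else 0)"
    using assms by simp
qed

lemma chaos_below_mono:
  assumes "chaos_below I lam m \<phi>" "m \<le> m'"
  shows "chaos_below I lam m' \<phi>"
proof -
  obtain w where w: "\<And>n. chaos I lam n (w n)" "\<phi> = (\<lambda>k. \<Sum>n<m. w n k)"
    using assms(1) unfolding chaos_below_def by blast
  have "chaos_below I lam m' (\<lambda>k. \<Sum>n<m. w n k)"
  proof (rule chaos_below_sum)
    show "chaos_below I lam m' (w n)" if "n \<in> {..<m}" for n
      using chaos_below_chaos [OF w(1) [of n], of m'] that assms(2) by simp
  qed
  with w show ?thesis by simp
qed

lemma chaos_below_create_op:
  assumes "chaos_below I lam m \<phi>" "i \<in> I"
  shows "chaos_below I lam (Suc m) (create_op lam i \<phi>)"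
proof -
  obtain w where w: "\<And>n. chaos I lam n (w n)" "\<phi> = (\<lambda>k. \<Sum>n<m. w n k)"
    using assms(1) unfolding chaos_below_def by blast
  show ?thesis unfolding w(2) create_op_sum
    by (rule chaos_below_sum) (use w assms in \<open>auto intro: chaos_below_chaos chaos_create\<close>)
qed

lemma chaos_below_diff_op:
  assumes "chaos_below I lam (Suc m) \<phi>" "i \<in> I"
  shows "chaos_below I lam m (diff_op i \<phi>)"
proof -
  obtain w where w: "\<And>n. chaos I lam n (w n)" "\<phi> = (\<lambda>k. \<Sum>n<Suc m. w n k)"
    using assms(1) unfolding chaos_below_def by blast
  have "chaos_below I lam m (diff_op i (w n))" if "n < Suc m" for n
  proof (cases n)
    case 0
    then show ?thesis using w(1)[of n] by (simp add: chaos_0_diff_op chaos_below_zero)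
  next
    case (Suc l)
    then show ?thesis
      using that w(1)[of n] assms(2) by (auto intro!: chaos_below_chaos[of _ _ l] chaos_Suc_diff_op)
  qed
  then show ?thesis unfolding w(2) diff_op_sum
    by (intro chaos_below_sum) auto
qed

text \<open>Differences lower both orders, so by induction all differences vanish; the number
  operator then gives zero, while its eigenvalue on \<open>\<phi>\<close> is positive. The argument
  is algebraic because orthogonality would identify \<open>\<phi>\<close> only up to null sets of
  the Poisson law, and configurations with points in a cell of zero mass are null.\<close>

lemma chaos_and_below_imp_zero:
  assumes "finite I" "chaos I lam n \<phi>" "chaos_below I lam n \<phi>"
  shows "\<phi> = (\<lambda>_. 0)"
  using assms(2,3)
proof (induction n arbitrary: \<phi>)
  case 0
  then show ?case by (simp add: chaos_below_0)
next
  case (Suc n)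
  have "diff_op i \<phi> = (\<lambda>_. 0)" if "i \<in> I" for i
    using Suc that by (intro Suc.IH chaos_Suc_diff_op chaos_below_diff_op)
  then have "number_op I lam \<phi> = (\<lambda>_. 0)" by (simp add: number_op_def)
  with number_op_chaos [OF Suc.prems(1) assms(1)] show ?case by (auto simp: fun_eq_iff)
qed

text \<open>Induction on the first factor alone: \<open>create_op_mult\<close> moves each creation
  outside, and the second factor only ever loses order.\<close>

lemma chaos_mult:
  assumes "chaos I lam p u" "chaos I lam q v"
  shows "chaos_below I lam (Suc (p + q)) (\<lambda>k. u k * v k)"
  using assms
proof (induction arbitrary: q v rule: chaos.induct)
  case (chaos_const c)
  then show ?case by (intro chaos_below_scale chaos_below_chaos[of _ _ q]) auto
next
  case (chaos_create n \<phi> i)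
  \<comment> \<open>The induction hypothesis is used at order \<open>q - 1\<close>; enlarging the
    bound to \<open>n + q\<close> also covers the truncation at \<open>q = 0\<close>.\<close>
  have d: "chaos_below I lam (Suc (n + q)) (\<lambda>k. \<phi> k * diff_op i v k)"
    using chaos_create.IH[OF chaos_diff_op[OF chaos_create.prems \<open>i \<in> I\<close>]]
    by (rule chaos_below_mono) simp
  have "chaos_below I lam (Suc (Suc (n + q))) (\<lambda>k. create_op lam i \<phi> k * v k)"
    unfolding create_op_mult
    by (intro chaos_below_add chaos_below_create_op chaos_below_scale chaos_create d
        chaos_below_mono[OF d]) auto
  then show ?case by simp
next
  case (chaos_add n \<phi> \<psi>)
  then have "chaos_below I lam (Suc (n + q)) (\<lambda>k. \<phi> k * v k + \<psi> k * v k)"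
    by (intro chaos_below_add) auto
  then show ?case by (simp add: algebra_simps)
next
  case (chaos_scale n \<phi> c)
  then have "chaos_below I lam (Suc (n + q)) (\<lambda>k. c * (\<phi> k * v k))"
    by (intro chaos_below_scale) auto
  then show ?case by (simp add: algebra_simps)
qed (simp add: chaos_below_zero)

section \<open>The component of highest order, and Wick products\<close>

definition chaos_top :: "'i set \<Rightarrow> ('i \<Rightarrow> real) \<Rightarrow> nat \<Rightarrow> (('i \<Rightarrow> nat) \<Rightarrow> real) \<Rightarrow> ('i \<Rightarrow> nat) \<Rightarrow> real" where
  "chaos_top I lam n \<phi> = (SOME t. chaos I lam n t \<and> chaos_below I lam n (\<lambda>k. \<phi> k - t k))"

lemma chaos_top_unique:
  assumes "finite I" "chaos I lam n t" "chaos_below I lam n (\<lambda>k. \<phi> k - t k)"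
  shows "chaos_top I lam n \<phi> = t"
  unfolding chaos_top_def
proof (rule some_equality)
  fix s assume s: "chaos I lam n s \<and> chaos_below I lam n (\<lambda>k. \<phi> k - s k)"
  have "(\<lambda>k. s k - t k) = (\<lambda>_. 0)"
  proof (rule chaos_and_below_imp_zero [OF assms(1)])
    show "chaos I lam n (\<lambda>k. s k - t k)" using s assms by (intro chaos_diff) auto
    have "chaos_below I lam n (\<lambda>k. (\<phi> k - t k) - (\<phi> k - s k))"
      using chaos_below_diff [OF assms(3) conjunct2 [OF s]] .
    then show "chaos_below I lam n (\<lambda>k. s k - t k)" by simp
  qed
  then show "s = t" by (auto simp: fun_eq_iff)
qed (use assms in auto)

lemma chaos_top_spec:
  assumes "chaos_below I lam (Suc n) \<phi>"
  shows "chaos I lam n (chaos_top I lam n \<phi>) \<and> chaos_below I lam n (\<lambda>k. \<phi> k - chaos_top I lam n \<phi> k)"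
proof -
  obtain w where w: "\<And>n. chaos I lam n (w n)" "\<phi> = (\<lambda>k. \<Sum>m<Suc n. w m k)"
    using assms unfolding chaos_below_def by blast
  have "chaos_below I lam n (\<lambda>k. \<phi> k - w n k)"
    by (rule chaos_belowI [where w = w]) (use w in auto)
  with w(1) show ?thesis unfolding chaos_top_def
    by (intro someI_ex [of "\<lambda>t. chaos I lam n t \<and> chaos_below I lam n (\<lambda>k. \<phi> k - t k)"]) auto
qed

lemma chaos_top_zero: "finite I \<Longrightarrow> chaos_top I lam n (\<lambda>_. 0) = (\<lambda>_. 0)"
  by (rule chaos_top_unique) (auto intro: chaos_zero chaos_below_zero)

lemma chaos_top_chaos: "finite I \<Longrightarrow> chaos I lam n \<phi> \<Longrightarrow> chaos_top I lam n \<phi> = \<phi>"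
  by (rule chaos_top_unique) (auto intro: chaos_below_zero)

lemma chaos_top_mult:
  assumes "chaos I lam p u" "chaos I lam q v"
  shows "chaos I lam (p + q) (chaos_top I lam (p + q) (\<lambda>k. u k * v k))"
    and "chaos_below I lam (p + q) (\<lambda>k. u k * v k - chaos_top I lam (p + q) (\<lambda>k. u k * v k) k)"
  using chaos_top_spec [OF chaos_mult [OF assms]] by auto

lemma chaos_diff_op_mult:
  assumes "chaos I lam p u" "chaos I lam q v" "p + q = Suc n" "i \<in> I"
  shows "chaos_below I lam (Suc n) (\<lambda>k. diff_op i u k * v k)"
    and "chaos_below I lam (Suc n) (\<lambda>k. u k * diff_op i v k)"
    and "chaos_below I lam n (\<lambda>k. diff_op i u k * diff_op i v k)"
proof -
  show "chaos_below I lam (Suc n) (\<lambda>k. diff_op i u k * v k)"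
  proof (cases p)
    case 0
    then show ?thesis using assms by (simp add: chaos_0_diff_op chaos_below_zero)
  next
    case (Suc m)
    then show ?thesis
      using chaos_mult [OF chaos_diff_op [OF assms(1,4)] assms(2)] assms(3) by simp
  qed
  show "chaos_below I lam (Suc n) (\<lambda>k. u k * diff_op i v k)"
  proof (cases q)
    case 0
    then show ?thesis using assms by (simp add: chaos_0_diff_op chaos_below_zero)
  next
    case (Suc m)
    then show ?thesis
      using chaos_mult [OF assms(1) chaos_diff_op [OF assms(2,4)]] assms(3) by simp
  qed
  show "chaos_below I lam n (\<lambda>k. diff_op i u k * diff_op i v k)"
  \<comment> \<open>For positive \<open>p\<close> and \<open>q\<close> both orders drop and the
    total drops by two; otherwise the subtraction would truncate, but then one of the differences is
    zero.\<close>
  proof (cases "p = 0 \<or> q = 0")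
    case True
    then show ?thesis using assms by (auto simp add: chaos_0_diff_op chaos_below_zero)
  next
    case False
    then have "Suc (p - 1 + (q - 1)) = n" using assms(3) by auto
    then show ?thesis
      using chaos_mult [OF chaos_diff_op [OF assms(1,4)] chaos_diff_op [OF assms(2,4)]] by simp
  qed
qed

text \<open>Differences are derivations for the Wick product although not for the pointwise one: the
  correction \<open>diff_op i u k * diff_op i v k\<close> in \<open>diff_op_mult\<close> has two
  orders less than the product and is invisible at order \<open>n\<close>.\<close>

lemma diff_op_chaos_top:
  assumes "finite I" "chaos I lam p u" "chaos I lam q v" "p + q = Suc n" "i \<in> I"
  shows "diff_op i (chaos_top I lam (Suc n) (\<lambda>k. u k * v k)) =
    (\<lambda>k. chaos_top I lam n (\<lambda>k. diff_op i u k * v k) k + chaos_top I lam n (\<lambda>k. u k * diff_op i v k) k)"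
proof -
  note b = chaos_diff_op_mult [OF assms(2-5)]
  note t1 = chaos_top_spec [OF b(1)] and t2 = chaos_top_spec [OF b(2)]
  note t = chaos_top_mult [OF assms(2,3), unfolded assms(4)]
  let ?t = "chaos_top I lam (Suc n) (\<lambda>k. u k * v k)"
  let ?t1 = "chaos_top I lam n (\<lambda>k. diff_op i u k * v k)"
  let ?t2 = "chaos_top I lam n (\<lambda>k. u k * diff_op i v k)"
  have "(\<lambda>k. diff_op i ?t k - (?t1 k + ?t2 k)) = (\<lambda>_. 0)"
  proof (rule chaos_and_below_imp_zero [OF assms(1)])
    show "chaos I lam n (\<lambda>k. diff_op i ?t k - (?t1 k + ?t2 k))"
      using t(1) t1 t2 assms(5) by (intro chaos_diff chaos_add chaos_Suc_diff_op) auto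
    have "chaos_below I lam n (\<lambda>k. (diff_op i u k * v k - ?t1 k) + (u k * diff_op i v k - ?t2 k)
       + diff_op i u k * diff_op i v k - diff_op i (\<lambda>k. u k * v k - ?t k) k)"
      using chaos_below_diff [OF chaos_below_add [OF chaos_below_add
          [OF conjunct2 [OF t1] conjunct2 [OF t2]] b(3)] chaos_below_diff_op [OF t(2) assms(5)]] .
    then show "chaos_below I lam n (\<lambda>k. diff_op i ?t k - (?t1 k + ?t2 k))"
      by (simp add: diff_op_diff diff_op_mult algebra_simps)
  qed
  then show ?thesis by (auto simp: fun_eq_iff)
qed

text \<open>Write \<open>p\<close> times \<open>u\<close> as the number operator applied to
  \<open>u\<close> and pull each creation out of the product with \<open>v\<close>. All corrections
  stay below the top order. This allows a Wick product to be taken apart one argument of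
  \<open>u\<close> at a time.\<close>

lemma create_op_chaos_top:
  assumes "finite I" "chaos I lam p u" "chaos I lam q v" "p + q = Suc n"
  shows "(\<lambda>k. \<Sum>i\<in>I. create_op lam i (chaos_top I lam n (\<lambda>k. diff_op i u k * v k)) k) =
    (\<lambda>k. real p * chaos_top I lam (Suc n) (\<lambda>k. u k * v k) k)" (is "?L = ?R")
proof -
  note b = chaos_diff_op_mult [OF assms(2-4)]
  note t = chaos_top_mult [OF assms(2,3), unfolded assms(4)]
  let ?t = "chaos_top I lam (Suc n) (\<lambda>k. u k * v k)"
  let ?t1 = "\<lambda>i. chaos_top I lam n (\<lambda>k. diff_op i u k * v k)"
  have t1: "chaos I lam n (?t1 i)" "chaos_below I lam n (\<lambda>k. diff_op i u k * v k - ?t1 i k)"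
    if "i \<in> I" for i using chaos_top_spec [OF b(1) [OF that]] by auto
  have pu: "real p * (u k * v k) = (\<Sum>i\<in>I. create_op lam i (diff_op i u) k * v k)" for k
    using fun_cong [OF number_op_chaos [OF assms(2,1)], of k]
    by (simp add: number_op_def flip: mult.assoc sum_distrib_right)
  have "(\<lambda>k. ?L k - ?R k) = (\<lambda>_. 0)"
  proof (rule chaos_and_below_imp_zero [OF assms(1)])
    show "chaos I lam (Suc n) (\<lambda>k. ?L k - ?R k)"
      using t(1) t1 by (intro chaos_diff chaos_sum chaos_scale chaos_create) auto
    have c: "chaos_below I lam (Suc n) (\<lambda>k. create_op lam i (diff_op i u) k * v k - create_op lam i (?t1 i) k)"
      if "i \<in> I" for i
    proof -
      have "chaos_below I lam (Suc n) (\<lambda>k. create_op lam i (\<lambda>k. diff_op i u k * v k - ?t1 i k) k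
         + create_op lam i (\<lambda>k. diff_op i u k * diff_op i v k) k + lam i * (diff_op i u k * diff_op i v k))"
        using chaos_below_add [OF chaos_below_add
            [OF chaos_below_create_op [OF t1(2) [OF that] that] chaos_below_create_op [OF b(3) [OF that] that]]
            chaos_below_scale [OF chaos_below_mono [OF b(3) [OF that] le_SucI [OF order_refl]]]] .
      then show ?thesis
        unfolding create_op_diff using create_op_mult[of lam i "diff_op i u" v, unfolded fun_eq_iff]
        by (simp add: algebra_simps)
    qed
    have "chaos_below I lam (Suc n) (\<lambda>k. real p * (u k * v k - ?t k) -
        (\<Sum>i\<in>I. create_op lam i (diff_op i u) k * v k - create_op lam i (?t1 i) k))"
      using chaos_below_diff [OF chaos_below_scale [OF t(2)] chaos_below_sum [of I, OF c]] .
    then show "chaos_below I lam (Suc n) (\<lambda>k. ?L k - ?R k)"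
      by (simp add: sum_subtractf pu right_diff_distrib)
  qed
  then show ?thesis by (auto simp: fun_eq_iff)
qed

section \<open>Functions of independent Poisson counts\<close>

text \<open>\<open>pmf_Suc\<close> is detailed balance between births at rate \<open>lam i\<close>
  and deaths at rate \<open>k i\<close>. It encodes the Poisson law of each count and the
  independence of the counts together, in the form that summation by parts uses.\<close>

locale poisson_counts =
  fixes I :: "'i set" and lam :: "'i \<Rightarrow> real" and Q :: "('i \<Rightarrow> nat) pmf"
  assumes finite_I: "finite I"
    and lam_nonneg: "i \<in> I \<Longrightarrow> 0 \<le> lam i"
    and pmf_Suc: "i \<in> I \<Longrightarrow> pmf Q (k(i := Suc (k i))) * real (Suc (k i)) = lam i * pmf Q k"
begin

abbreviation E :: "(('i \<Rightarrow> nat) \<Rightarrow> real) \<Rightarrow> real" where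
  "E \<phi> \<equiv> measure_pmf.expectation Q \<phi>"

definition total :: "('i \<Rightarrow> nat) \<Rightarrow> nat" where
  "total k = (\<Sum>i\<in>I. k i)"

text \<open>A class closed under products and all operators used here, on which every expectation
  exists; integrability conditions thereby become syntactic.\<close>

definition poly_bounded :: "(('i \<Rightarrow> nat) \<Rightarrow> real) \<Rightarrow> bool" where
  "poly_bounded \<phi> \<longleftrightarrow> (\<exists>C d. C \<ge> 0 \<and> (\<forall>k. \<bar>\<phi> k\<bar> \<le> C * (1 + real (total k)) ^ d))"

lemma poly_boundedI: "C \<ge> 0 \<Longrightarrow> (\<And>k. \<bar>\<phi> k\<bar> \<le> C * (1 + real (total k)) ^ d) \<Longrightarrow> poly_bounded \<phi>"
  unfolding poly_bounded_def by blast

lemma total_Suc_le: "total (k(i := Suc (k i))) \<le> Suc (total k)"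
proof (cases "i \<in> I")
  case True
  have "(\<Sum>j\<in>I. (k(i := Suc (k i))) j) = (\<Sum>j\<in>I. k j + (if j = i then 1 else 0))"
    by (intro sum.cong) auto
  with True show ?thesis by (simp add: total_def sum.distrib finite_I)
next
  case False
  then have "(\<Sum>j\<in>I. (k(i := Suc (k i))) j) = (\<Sum>j\<in>I. k j)"
    by (intro sum.cong) auto
  then show ?thesis by (simp add: total_def)
qed

lemma total_pred_le: "total (k(i := k i - 1)) \<le> total k"
  unfolding total_def by (intro sum_mono) auto

lemma total_pred: "i \<in> I \<Longrightarrow> k i > 0 \<Longrightarrow> Suc (total (k(i := k i - 1))) = total k"
proof -
  assume i: "i \<in> I" "k i > 0"
  have "(\<Sum>j\<in>I. k j) = (\<Sum>j\<in>I. (k(i := k i - 1)) j + (if j = i then 1 else 0))"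
    using i by (intro sum.cong) auto
  with i show ?thesis by (simp add: total_def sum.distrib finite_I)
qed

lemma le_total: "i \<in> I \<Longrightarrow> k i \<le> total k"
  unfolding total_def by (rule member_le_sum) (auto simp: finite_I)

lemma poly_bounded_const: "poly_bounded (\<lambda>_. c)"
  by (rule poly_boundedI [of "\<bar>c\<bar>" _ 0]) auto

lemma poly_bounded_add:
  assumes "poly_bounded \<phi>" "poly_bounded \<psi>"
  shows "poly_bounded (\<lambda>k. \<phi> k + \<psi> k)"
proof -
  obtain C d C' d' where c: "C \<ge> 0" "\<And>k. \<bar>\<phi> k\<bar> \<le> C * (1 + real (total k)) ^ d"
    "C' \<ge> 0" "\<And>k. \<bar>\<psi> k\<bar> \<le> C' * (1 + real (total k)) ^ d'"
    using assms unfolding poly_bounded_def by blast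
  show ?thesis
  proof (rule poly_boundedI)
    show "0 \<le> C + C'" using c by simp
    fix k
    have "C * (1 + real (total k)) ^ d \<le> C * (1 + real (total k)) ^ (d + d')"
      using c by (intro mult_left_mono power_increasing) auto
    moreover have "C' * (1 + real (total k)) ^ d' \<le> C' * (1 + real (total k)) ^ (d + d')"
      using c by (intro mult_left_mono power_increasing) auto
    ultimately show "\<bar>\<phi> k + \<psi> k\<bar> \<le> (C + C') * (1 + real (total k)) ^ (d + d')"
      using c(2)[of k] c(4)[of k] by (simp add: algebra_simps)
  qed
qed

lemma poly_bounded_mult:
  assumes "poly_bounded \<phi>" "poly_bounded \<psi>"
  shows "poly_bounded (\<lambda>k. \<phi> k * \<psi> k)"
proof -
  obtain C d C' d' where c: "C \<ge> 0" "\<And>k. \<bar>\<phi> k\<bar> \<le> C * (1 + real (total k)) ^ d"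
    "C' \<ge> 0" "\<And>k. \<bar>\<psi> k\<bar> \<le> C' * (1 + real (total k)) ^ d'"
    using assms unfolding poly_bounded_def by blast
  show ?thesis
  proof (rule poly_boundedI)
    show "0 \<le> C * C'" using c by simp
    fix k
    have "\<bar>\<phi> k\<bar> * \<bar>\<psi> k\<bar> \<le> (C * (1 + real (total k)) ^ d) * (C' * (1 + real (total k)) ^ d')"
      using c by (intro mult_mono) auto
    then show "\<bar>\<phi> k * \<psi> k\<bar> \<le> (C * C') * (1 + real (total k)) ^ (d + d')"
      by (simp add: abs_mult power_add algebra_simps)
  qed
qed

lemma poly_bounded_scale: "poly_bounded \<phi> \<Longrightarrow> poly_bounded (\<lambda>k. c * \<phi> k)"
  by (intro poly_bounded_mult poly_bounded_const)

lemma poly_bounded_uminus: "poly_bounded \<phi> \<Longrightarrow> poly_bounded (\<lambda>k. - \<phi> k)"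
  using poly_bounded_scale [of \<phi> "-1"] by simp

lemma poly_bounded_diff:
  "poly_bounded \<phi> \<Longrightarrow> poly_bounded \<psi> \<Longrightarrow> poly_bounded (\<lambda>k. \<phi> k - \<psi> k)"
  using poly_bounded_add [OF _ poly_bounded_uminus] by simp

lemma poly_bounded_power: "poly_bounded \<phi> \<Longrightarrow> poly_bounded (\<lambda>k. \<phi> k ^ n)"
  by (induction n) (auto intro: poly_bounded_mult poly_bounded_const)

lemma poly_bounded_sum:
  "(\<And>a. a \<in> S \<Longrightarrow> poly_bounded (\<phi> a)) \<Longrightarrow> poly_bounded (\<lambda>k. \<Sum>a\<in>S. \<phi> a k)"
  by (induction S rule: infinite_finite_induct) (auto intro: poly_bounded_const poly_bounded_add)

lemma poly_bounded_le:
  assumes "poly_bounded \<psi>" "\<And>k. \<bar>\<phi> k\<bar> \<le> \<bar>\<psi> k\<bar>"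
  shows "poly_bounded \<phi>"
  using assms unfolding poly_bounded_def by (meson order_trans)

lemma poly_bounded_shift:
  assumes "poly_bounded \<phi>"
  shows "poly_bounded (\<lambda>k. \<phi> (k(i := Suc (k i))))"
proof -
  obtain C d where c: "C \<ge> 0" "\<And>k. \<bar>\<phi> k\<bar> \<le> C * (1 + real (total k)) ^ d"
    using assms unfolding poly_bounded_def by blast
  show ?thesis
  proof (rule poly_boundedI)
    show "0 \<le> C * 2 ^ d" using c by simp
    fix k
    have "C * (1 + real (total (k(i := Suc (k i))))) ^ d \<le> C * (2 * (1 + real (total k))) ^ d"
      using c total_Suc_le[of k i] by (intro mult_left_mono power_mono) auto
    with c(2) [of "k(i := Suc (k i))"]
    have "\<bar>\<phi> (k(i := Suc (k i)))\<bar> \<le> C * (2 * (1 + real (total k))) ^ d"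
      by (rule order_trans)
    then show
      "\<bar>\<phi> (k(i := Suc (k i)))\<bar> \<le> C * 2 ^ d * (1 + real (total k)) ^ d"
      by (simp only: power_mult_distrib mult.assoc)
  qed
qed

lemma poly_bounded_unshift:
  assumes "poly_bounded \<phi>"
  shows "poly_bounded (\<lambda>k. \<phi> (k(i := k i - 1)))"
proof -
  obtain C d where c: "C \<ge> 0" "\<And>k. \<bar>\<phi> k\<bar> \<le> C * (1 + real (total k)) ^ d"
    using assms unfolding poly_bounded_def by blast
  show ?thesis
  proof (rule poly_boundedI [OF c(1)])
    fix k
    have "C * (1 + real (total (k(i := k i - 1)))) ^ d \<le> C * (1 + real (total k)) ^ d"
      using c total_pred_le[of k i] by (intro mult_left_mono power_mono) auto
    with c(2) [of "k(i := k i - 1)"] show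
      "\<bar>\<phi> (k(i := k i - 1))\<bar> \<le> C * (1 + real (total k)) ^ d" by simp
  qed
qed

lemma poly_bounded_diff_op: "poly_bounded \<phi> \<Longrightarrow> poly_bounded (diff_op i \<phi>)"
  unfolding diff_op_def by (rule poly_bounded_diff [OF poly_bounded_shift])

lemma poly_bounded_coord: "i \<in> I \<Longrightarrow> poly_bounded (\<lambda>k. real (k i))"
proof (rule poly_boundedI [of 1 _ 1])
  fix k assume "i \<in> I"
  then have "k i \<le> total k" by (rule le_total)
  then show "\<bar>real (k i)\<bar> \<le> 1 * (1 + real (total k)) ^ 1" by simp
qed simp

lemma poly_bounded_create_op: "poly_bounded \<phi> \<Longrightarrow> i \<in> I \<Longrightarrow> poly_bounded (create_op lam i \<phi>)"
  unfolding create_op_def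
  by (rule poly_bounded_diff [OF poly_bounded_mult [OF poly_bounded_coord poly_bounded_unshift]
      poly_bounded_scale])

lemma poly_bounded_chaos: "chaos I lam n \<phi> \<Longrightarrow> poly_bounded \<phi>"
  by (induction rule: chaos.induct)
    (auto intro: poly_bounded_const poly_bounded_add poly_bounded_scale poly_bounded_create_op)

lemma poly_bounded_number_op: "poly_bounded \<phi> \<Longrightarrow> poly_bounded (number_op I lam \<phi>)"
  unfolding number_op_def by (intro poly_bounded_sum poly_bounded_create_op poly_bounded_diff_op)

lemmas poly_bounded_intros = poly_bounded_const poly_bounded_add poly_bounded_mult
  poly_bounded_uminus poly_bounded_diff poly_bounded_power poly_bounded_sum poly_bounded_diff_op
  poly_bounded_create_op poly_bounded_number_op

text \<open>The Mecke formula. Adding a point to cell \<open>i\<close> is a bijection onto the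
  configurations with \<open>k i > 0\<close>, and detailed balance converts the weights. It is
  stated for nonnegative integrals because it is needed before any moment is known to be
  finite.\<close>

lemma nn_integral_mecke:
  assumes i: "i \<in> I"
  shows "(\<integral>\<^sup>+ k. of_nat (k i) * f (k(i := k i - 1)) \<partial>measure_pmf Q) = ennreal (lam i) * (\<integral>\<^sup>+ k. f k \<partial>measure_pmf Q)"
proof -
  let ?g = "\<lambda>k. ennreal (pmf Q k) * (of_nat (k i) * f (k(i := k i - 1)))"
  have "(\<integral>\<^sup>+ k. of_nat (k i) * f (k(i := k i - 1)) \<partial>measure_pmf Q) = (\<integral>\<^sup>+ k. ?g k \<partial>count_space UNIV)"
    by (simp add: nn_integral_measure_pmf)
  also have "\<dots> = (\<integral>\<^sup>+ k. ?g k * indicator {k. k i > 0} k \<partial>count_space UNIV)"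
    by (intro nn_integral_cong) (auto simp: indicator_def)
  also have "\<dots> = (\<integral>\<^sup>+ k. ?g k \<partial>count_space {k. k i > 0})"
    by (simp add: nn_integral_count_space_indicator)
  also have "\<dots> = (\<integral>\<^sup>+ k. ?g (k(i := Suc (k i))) \<partial>count_space UNIV)"
  proof (rule nn_integral_bij_count_space [symmetric])
    show "bij_betw (\<lambda>k. k(i := Suc (k i))) UNIV {k. k i > 0}"
      by (rule bij_betw_byWitness [where f' = "\<lambda>k. k(i := k i - 1)"]) auto
  qed
  also have "\<dots> = (\<integral>\<^sup>+ k. ennreal (lam i) * (ennreal (pmf Q k) * f k) \<partial>count_space UNIV)"
  proof (intro nn_integral_cong)
    fix k
    have "?g (k(i := Suc (k i))) = ennreal (pmf Q (k(i := Suc (k i))) * real (Suc (k i))) * f k"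
      by (simp add: ennreal_mult ennreal_of_nat_eq_real_of_nat mult.assoc del: of_nat_Suc)
    then show "?g (k(i := Suc (k i))) = ennreal (lam i) * (ennreal (pmf Q k) * f k)"
      unfolding pmf_Suc [OF i] using lam_nonneg [OF i] by (simp add: ennreal_mult mult.assoc)
  qed
  also have "\<dots> = ennreal (lam i) * (\<integral>\<^sup>+ k. f k \<partial>measure_pmf Q)"
    by (simp add: nn_integral_cmult nn_integral_measure_pmf)
  finally show ?thesis .
qed

text \<open>One factor \<open>1 + total k\<close> is split into 1 and the counts \<open>k i\<close>,
  and the Mecke formula trades each count for \<open>lam i\<close> and a shift of the total by one.
  The bound \<open>2 + x \<le> 2 * (1 + x)\<close> returns the shifted power to the induction
  hypothesis.\<close>

lemma nn_integral_total_power_finite: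
  "(\<integral>\<^sup>+ k. ennreal ((1 + real (total k)) ^ d) \<partial>measure_pmf Q) < \<infinity>"
proof (induction d)
  case 0
  then show ?case by simp
next
  case (Suc d)
  let ?M = "\<integral>\<^sup>+ k. ennreal ((1 + real (total k)) ^ d) \<partial>measure_pmf Q"
  have "(\<integral>\<^sup>+ k. ennreal ((1 + real (total k)) ^ Suc d) \<partial>measure_pmf Q) =
     (\<integral>\<^sup>+ k. ennreal ((1 + real (total k)) ^ d) +
        (\<Sum>i\<in>I. of_nat (k i) * ennreal ((2 + real (total (k(i := k i - 1)))) ^ d)) \<partial>measure_pmf Q)"
  proof (intro nn_integral_cong)
    fix k
    have "(1 + real (total k)) ^ Suc d = (1 + real (total k)) ^ d + (\<Sum>i\<in>I. real (k i) * (1 + real (total k)) ^ d)"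
      by (simp add: total_def algebra_simps flip: sum_distrib_right)
    also have "(\<Sum>i\<in>I. real (k i) * (1 + real (total k)) ^ d) =
        (\<Sum>i\<in>I. real (k i) * (2 + real (total (k(i := k i - 1)))) ^ d)"
    proof (intro sum.cong refl)
      fix i assume "i \<in> I"
      then have "1 + real (total k) = 2 + real (total (k(i := k i - 1)))" if "k i > 0"
        using total_pred [of i k] that by linarith
      then show "real (k i) * (1 + real (total k)) ^ d = real (k i) * (2 + real (total (k(i := k i - 1)))) ^ d"
        by (cases "k i = 0") auto
    qed
    finally have eq: "(1 + real (total k)) ^ Suc d = (1 + real (total k)) ^ d +
        (\<Sum>i\<in>I. real (k i) * (2 + real (total (k(i := k i - 1)))) ^ d)" .
    have "ennreal (\<Sum>i\<in>I. real (k i) * (2 + real (total (k(i := k i - 1)))) ^ d) =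
        (\<Sum>i\<in>I. of_nat (k i) * ennreal ((2 + real (total (k(i := k i - 1)))) ^ d))"
      by (subst sum_ennreal [symmetric]) (auto simp: ennreal_mult ennreal_of_nat_eq_real_of_nat)
    then show "ennreal ((1 + real (total k)) ^ Suc d) = ennreal ((1 + real (total k)) ^ d) +
        (\<Sum>i\<in>I. of_nat (k i) * ennreal ((2 + real (total (k(i := k i - 1)))) ^ d))"
      unfolding eq by (subst ennreal_plus) (auto intro!: sum_nonneg)
  qed
  also have "\<dots> = ?M + (\<Sum>i\<in>I. ennreal (lam i) * (\<integral>\<^sup>+ k. ennreal ((2 + real (total k)) ^ d) \<partial>measure_pmf Q))"
    by (simp add: nn_integral_add nn_integral_sum nn_integral_mecke
        [of _ "\<lambda>k. ennreal ((2 + real (total k)) ^ d)", unfolded One_nat_def] cong: sum.cong)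
  also have "\<dots> \<le> ?M + (\<Sum>i\<in>I. ennreal (lam i) * (ennreal (2 ^ d) * ?M))"
  proof (intro add_left_mono sum_mono mult_left_mono)
    have "(\<integral>\<^sup>+ k. ennreal ((2 + real (total k)) ^ d) \<partial>measure_pmf Q) \<le>
        (\<integral>\<^sup>+ k. ennreal (2 ^ d) * ennreal ((1 + real (total k)) ^ d) \<partial>measure_pmf Q)"
    proof (intro nn_integral_mono)
      fix k
      have "(2 + real (total k)) ^ d \<le> (2 * (1 + real (total k))) ^ d"
        by (intro power_mono) auto
      then show "ennreal ((2 + real (total k)) ^ d) \<le> ennreal (2 ^ d) * ennreal ((1 + real (total k)) ^ d)"
        unfolding power_mult_distrib by (simp flip: ennreal_mult')
    qed
    then show "(\<integral>\<^sup>+ k. ennreal ((2 + real (total k)) ^ d) \<partial>measure_pmf Q) \<le> ennreal (2 ^ d) * ?M"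
      by (simp add: nn_integral_cmult)
  qed auto
  also have "\<dots> < \<infinity>"
    using Suc by (simp add: ennreal_mult_less_top finite_I)
  finally show ?case .
qed

lemma integrable_poly_bounded:
  assumes "poly_bounded \<phi>"
  shows "integrable (measure_pmf Q) \<phi>"
proof -
  obtain C d where c: "C \<ge> 0" "\<And>k. \<bar>\<phi> k\<bar> \<le> C * (1 + real (total k)) ^ d"
    using assms unfolding poly_bounded_def by blast
  have "integrable (measure_pmf Q) (\<lambda>k. (1 + real (total k)) ^ d)"
    using nn_integral_total_power_finite [of d] by (intro integrableI_nonneg) auto
  then have "integrable (measure_pmf Q) (\<lambda>k. C * (1 + real (total k)) ^ d)"
    by simp
  then show ?thesis
    by (rule Bochner_Integration.integrable_bound) (use c in \<open>auto intro!: AE_I2 order_trans [OF _ abs_ge_self]\<close>)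
qed

lemma E_add: "poly_bounded \<phi> \<Longrightarrow> poly_bounded \<psi> \<Longrightarrow> E (\<lambda>k. \<phi> k + \<psi> k) = E \<phi> + E \<psi>"
  by (intro Bochner_Integration.integral_add integrable_poly_bounded)

lemma E_diff: "poly_bounded \<phi> \<Longrightarrow> poly_bounded \<psi> \<Longrightarrow> E (\<lambda>k. \<phi> k - \<psi> k) = E \<phi> - E \<psi>"
  by (intro Bochner_Integration.integral_diff integrable_poly_bounded)

lemma E_sum: "(\<And>a. a \<in> S \<Longrightarrow> poly_bounded (\<phi> a)) \<Longrightarrow> E (\<lambda>k. \<Sum>a\<in>S. \<phi> a k) = (\<Sum>a\<in>S. E (\<phi> a))"
  by (intro Bochner_Integration.integral_sum integrable_poly_bounded)

lemma E_mono: "poly_bounded \<phi> \<Longrightarrow> poly_bounded \<psi> \<Longrightarrow> (\<And>k. \<phi> k \<le> \<psi> k) \<Longrightarrow> E \<phi> \<le> E \<psi>"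
  by (intro Bochner_Integration.integral_mono integrable_poly_bounded) auto

lemma E_mecke:
  assumes "i \<in> I" "poly_bounded \<phi>"
  shows "E (\<lambda>k. real (k i) * \<phi> (k(i := k i - 1))) = lam i * E \<phi>"
proof -
  have 1: "(\<integral>\<^sup>+ k. ennreal (real (k i) * \<psi> (k(i := k i - 1))) \<partial>measure_pmf Q) =
    ennreal (lam i) * (\<integral>\<^sup>+ k. ennreal (\<psi> k) \<partial>measure_pmf Q)" for \<psi>
    using nn_integral_mecke [OF assms(1), of "\<lambda>k. ennreal (\<psi> k)"]
    by (simp add: ennreal_mult' ennreal_of_nat_eq_real_of_nat)
  have "integrable (measure_pmf Q) (\<lambda>k. real (k i) * \<phi> (k(i := k i - 1)))"
    by (rule integrable_poly_bounded [OF poly_bounded_mult [OF poly_bounded_coord [OF assms(1)]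
        poly_bounded_unshift [OF assms(2)]]])
  then show ?thesis
    using 1 [of \<phi>] 1 [of "\<lambda>k. - \<phi> k"] integrable_poly_bounded [OF assms(2)] lam_nonneg [OF assms(1)]
    by (simp add: real_lebesgue_integral_def enn2real_mult algebra_simps)
qed

text \<open>Integration by parts. The first term of the creation operator is prepared for the Mecke
  formula by writing \<open>k\<close> as the predecessor with the point put back, so that the
  formula yields \<psi> at the configuration with one more point; the compensator subtracts \<psi>
  itself.\<close>

lemma E_create_op:
  assumes "i \<in> I" "poly_bounded \<phi>" "poly_bounded \<psi>"
  shows "E (\<lambda>k. create_op lam i \<phi> k * \<psi> k) = lam i * E (\<lambda>k. \<phi> k * diff_op i \<psi> k)"
proof -
  have "E (\<lambda>k. create_op lam i \<phi> k * \<psi> k) =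
    E (\<lambda>k. real (k i) * (\<phi> (k(i := k i - 1)) * \<psi> ((k(i := k i - 1))(i := Suc ((k(i := k i - 1)) i))))
       - lam i * (\<phi> k * \<psi> k))"
  proof (intro arg_cong [where f = E] ext)
    fix k :: "'i \<Rightarrow> nat"
    have "k i > 0 \<Longrightarrow> k(i := Suc (k i - Suc 0)) = k" by (auto simp: fun_eq_iff)
    then show "create_op lam i \<phi> k * \<psi> k = real (k i) * (\<phi> (k(i := k i - 1)) *
      \<psi> ((k(i := k i - 1))(i := Suc ((k(i := k i - 1)) i)))) - lam i * (\<phi> k * \<psi> k)"
      by (cases "k i = 0") (auto simp: create_op_def algebra_simps)
  qed
  also have "\<dots> = lam i * E (\<lambda>k. \<phi> k * \<psi> (k(i := Suc (k i)))) - lam i * E (\<lambda>k. \<phi> k * \<psi> k)"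
  proof (subst E_diff)
    have s: "poly_bounded (\<lambda>k. \<phi> k * \<psi> (k(i := Suc (k i))))"
      by (rule poly_bounded_mult [OF assms(2) poly_bounded_shift [OF assms(3)]])
    show "poly_bounded (\<lambda>k. real (k i) * (\<phi> (k(i := k i - 1)) *
      \<psi> ((k(i := k i - 1))(i := Suc ((k(i := k i - 1)) i)))))"
      by (rule poly_bounded_mult [OF poly_bounded_coord [OF assms(1)] poly_bounded_unshift [OF s]])
    show "poly_bounded (\<lambda>k. lam i * (\<phi> k * \<psi> k))"
      by (intro poly_bounded_scale poly_bounded_mult assms)
    show "E (\<lambda>k. real (k i) * (\<phi> (k(i := k i - 1)) * \<psi> ((k(i := k i - 1))(i := Suc ((k(i := k i - 1)) i)))))
      - E (\<lambda>k. lam i * (\<phi> k * \<psi> k)) =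
      lam i * E (\<lambda>k. \<phi> k * \<psi> (k(i := Suc (k i)))) - lam i * E (\<lambda>k. \<phi> k * \<psi> k)"
      using E_mecke [OF assms(1) s] by simp
  qed
  also have "\<dots> = lam i * E (\<lambda>k. \<phi> k * diff_op i \<psi> k)"
    unfolding diff_op_def right_diff_distrib
    by (subst E_diff) (simp_all add: right_diff_distrib poly_bounded_mult
        assms(2,3) poly_bounded_shift [OF assms(3)])
  finally show ?thesis .
qed

lemma E_number_op:
  assumes "poly_bounded \<phi>" "poly_bounded \<psi>"
  shows "E (\<lambda>k. number_op I lam \<phi> k * \<psi> k) = (\<Sum>i\<in>I. lam i * E (\<lambda>k. diff_op i \<phi> k * diff_op i \<psi> k))"
  unfolding number_op_def sum_distrib_right
  by (subst E_sum) (auto intro!: poly_bounded_intros sum.cong E_create_op assms)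

text \<open>The energy identity on a chaos, where the number operator is multiplication by
  \<open>p\<close>. It is the source of all later inductions that pass from a function to its
  differences.\<close>

lemma E_chaos_number:
  assumes "chaos I lam p u" "poly_bounded \<psi>"
  shows "real p * E (\<lambda>k. u k * \<psi> k) = (\<Sum>i\<in>I. lam i * E (\<lambda>k. diff_op i u k * diff_op i \<psi> k))"
  using E_number_op [OF poly_bounded_chaos [OF assms(1)] assms(2)]
  by (simp add: number_op_chaos [OF assms(1) finite_I] mult.assoc)

text \<open>A symmetric operator with two different eigenvalues.\<close>

lemma chaos_orthogonal:
  assumes "chaos I lam p u" "chaos I lam q v" "p \<noteq> q"
  shows "E (\<lambda>k. u k * v k) = 0"
proof -
  have "real p * E (\<lambda>k. u k * v k) = real q * E (\<lambda>k. u k * v k)"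
    using E_chaos_number [OF assms(1) poly_bounded_chaos [OF assms(2)]]
      E_chaos_number [OF assms(2) poly_bounded_chaos [OF assms(1)]]
    by (simp add: mult.commute)
  with assms(3) show ?thesis by simp
qed

section \<open>The norm of a Wick product\<close>

abbreviation wick :: "nat \<Rightarrow> (('i \<Rightarrow> nat) \<Rightarrow> real) \<Rightarrow> (('i \<Rightarrow> nat) \<Rightarrow> real) \<Rightarrow> ('i \<Rightarrow> nat) \<Rightarrow> real" where
  "wick n u v \<equiv> chaos_top I lam n (\<lambda>k. u k * v k)"

lemma chaos_wick:
  "chaos I lam p u \<Longrightarrow> chaos I lam q v \<Longrightarrow> p + q = n \<Longrightarrow> chaos I lam n (wick n u v)"
  using chaos_top_mult(1) by blast

lemma chaos_wick_diff_op:
  assumes "chaos I lam p u" "chaos I lam q v" "p + q = Suc n" "i \<in> I"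
  shows "chaos I lam n (wick n (diff_op i u) v)" and "chaos I lam n (wick n u (diff_op i v))"
  using chaos_top_spec [OF chaos_diff_op_mult(1) [OF assms]]
    chaos_top_spec [OF chaos_diff_op_mult(2) [OF assms]] by auto

lemma poly_bounded_wick:
  "chaos I lam p u \<Longrightarrow> chaos I lam q v \<Longrightarrow> p + q = n \<Longrightarrow> poly_bounded (wick n u v)"
  by (rule poly_bounded_chaos [OF chaos_wick])

lemma poly_bounded_wick_diff_op:
  assumes "chaos I lam p u" "chaos I lam q v" "p + q = Suc n" "i \<in> I"
  shows "poly_bounded (wick n (diff_op i u) v)" and "poly_bounded (wick n u (diff_op i v))"
  using chaos_wick_diff_op [OF assms] by (auto intro: poly_bounded_chaos)

lemma E_wick_number:
  assumes "chaos I lam p u" "chaos I lam q v" "p + q = Suc n" "poly_bounded \<psi>"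
  shows "real p * E (\<lambda>k. wick (Suc n) u v k * \<psi> k) =
    (\<Sum>i\<in>I. lam i * E (\<lambda>k. wick n (diff_op i u) v k * diff_op i \<psi> k))"
proof -
  have pb: "poly_bounded (wick n (diff_op i u) v)" if "i \<in> I" for i
    using chaos_wick_diff_op(1) [OF assms(1-3) that] by (rule poly_bounded_chaos)
  have "real p * E (\<lambda>k. wick (Suc n) u v k * \<psi> k) = E (\<lambda>k. (real p * wick (Suc n) u v k) * \<psi> k)"
    by (simp add: mult.assoc)
  also have "\<dots> = E (\<lambda>k. \<Sum>i\<in>I. create_op lam i (wick n (diff_op i u) v) k * \<psi> k)"
    by (simp add: sum_distrib_right fun_cong [OF create_op_chaos_top [OF finite_I assms(1-3)], symmetric])
  also have "\<dots> = (\<Sum>i\<in>I. lam i * E (\<lambda>k. wick n (diff_op i u) v k * diff_op i \<psi> k))"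
    using assms(4) by (subst E_sum) (auto intro!: poly_bounded_intros sum.cong E_create_op pb)
  finally show ?thesis .
qed

text \<open>For a single pair \<open>(u, v)\<close> with \<open>c = 1\<close> this is \<open>E (u \<diamond> v)\<^sup>2\<close>.  Crossing \<open>u\<close> and \<open>v\<close> between
  the two factors is what makes the recursions for \<open>wick_form\<close> and \<open>wick_form_diff\<close> close up; the
  index type of lists allows an index \<open>a\<close> to be extended to \<open>i # a\<close>.\<close>

definition wick_form :: "('a \<Rightarrow> real) \<Rightarrow> nat \<Rightarrow> 'a set \<Rightarrow>
    ('a \<Rightarrow> ('i \<Rightarrow> nat) \<Rightarrow> real) \<Rightarrow> ('a \<Rightarrow> ('i \<Rightarrow> nat) \<Rightarrow> real) \<Rightarrow> real" where
  "wick_form c n S u v =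
    (\<Sum>a\<in>S. \<Sum>b\<in>S. c a * c b * E (\<lambda>k. wick n (u a) (v b) k * wick n (u b) (v a) k))"

definition wick_form_diff :: "('a \<Rightarrow> real) \<Rightarrow> nat \<Rightarrow> 'a set \<Rightarrow>
    ('a \<Rightarrow> ('i \<Rightarrow> nat) \<Rightarrow> real) \<Rightarrow> ('a \<Rightarrow> ('i \<Rightarrow> nat) \<Rightarrow> real) \<Rightarrow> real" where
  "wick_form_diff c n S u v =
    (\<Sum>a\<in>S. \<Sum>b\<in>S. \<Sum>i\<in>I. c a * c b * lam i *
      E (\<lambda>k. wick n (diff_op i (u a)) (v b) k * wick n (u b) (diff_op i (v a)) k))"

text \<open>One argument of \<open>u a\<close> is removed from the first factor and appears as a
  difference of the second factor. The derivation rule then makes it hit either \<open>u b\<close>,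
  giving the same form with differentiated \<open>u\<close>, or \<open>v a\<close>, giving the mixed
  form.\<close>

lemma wick_form_Suc:
  assumes "\<And>a. a \<in> S \<Longrightarrow> chaos I lam p (u a)" "\<And>a. a \<in> S \<Longrightarrow> chaos I lam q (v a)" "p + q = Suc n"
  shows "real p * wick_form c (Suc n) S u v =
    (\<Sum>i\<in>I. lam i * wick_form c n S (\<lambda>a. diff_op i (u a)) v) + wick_form_diff c n S u v"
proof -
  let ?e = "\<lambda>a b i. E (\<lambda>k. wick n (diff_op i (u a)) (v b) k * wick n (diff_op i (u b)) (v a) k)"
  let ?e' = "\<lambda>a b i. E (\<lambda>k. wick n (diff_op i (u a)) (v b) k * wick n (u b) (diff_op i (v a)) k)"
  have "real p * E (\<lambda>k. wick (Suc n) (u a) (v b) k * wick (Suc n) (u b) (v a) k) =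
     (\<Sum>i\<in>I. lam i * ?e a b i) +
     (\<Sum>i\<in>I. lam i * ?e' a b i)"
    if ab: "a \<in> S" "b \<in> S" for a b
  proof -
    note u = assms(1) [OF ab(1)] assms(1) [OF ab(2)] and v = assms(2) [OF ab(1)] assms(2) [OF ab(2)]
    have "real p * E (\<lambda>k. wick (Suc n) (u a) (v b) k * wick (Suc n) (u b) (v a) k) =
      (\<Sum>i\<in>I. lam i * E (\<lambda>k. wick n (diff_op i (u a)) (v b) k *
        (wick n (diff_op i (u b)) (v a) k + wick n (u b) (diff_op i (v a)) k)))"
      using E_wick_number [OF u(1) v(2) assms(3) poly_bounded_chaos [OF chaos_wick [OF u(2) v(1) assms(3)]]]
      by (simp add: diff_op_chaos_top [OF finite_I u(2) v(1) assms(3)])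
    also have "\<dots> = (\<Sum>i\<in>I. lam i * (?e a b i +
       ?e' a b i))"
      unfolding distrib_left [of "wick _ _ _ _"]
      by (intro sum.cong refl arg_cong [where f = "\<lambda>x. _ * x"] E_add)
        (auto intro!: poly_bounded_mult poly_bounded_wick_diff_op [OF u(1) v(2) assms(3)]
          poly_bounded_wick_diff_op [OF u(2) v(1) assms(3)])
    finally show ?thesis by (simp add: distrib_left sum.distrib)
  qed
  then have "real p * wick_form c (Suc n) S u v =
    (\<Sum>a\<in>S. \<Sum>b\<in>S. c a * c b * (
     (\<Sum>i\<in>I. lam i * ?e a b i) +
     (\<Sum>i\<in>I. lam i * ?e' a b i)))"
    by (simp add: wick_form_def sum_distrib_left mult.left_commute [of "real p"])
  also have "\<dots> = (\<Sum>a\<in>S. \<Sum>b\<in>S. \<Sum>i\<in>I. lam i * (c a * c b * ?e a b i))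
    + wick_form_diff c n S u v"
    unfolding wick_form_diff_def sum.distrib [symmetric]
    by (intro sum.cong refl) (simp add: distrib_left sum_distrib_left mult_ac)
  also have "(\<Sum>a\<in>S. \<Sum>b\<in>S. \<Sum>i\<in>I. lam i * (c a * c b * ?e a b i))
    = (\<Sum>i\<in>I. \<Sum>a\<in>S. \<Sum>b\<in>S. lam i * (c a * c b * ?e a b i))"
    (is "(\<Sum>a\<in>S. \<Sum>b\<in>S. \<Sum>i\<in>I. ?F a b i) = _")
  proof -
    have "(\<Sum>a\<in>S. \<Sum>b\<in>S. \<Sum>i\<in>I. ?F a b i) = (\<Sum>a\<in>S. \<Sum>i\<in>I. \<Sum>b\<in>S. ?F a b i)"
      by (intro sum.cong refl sum.swap)
    also have "\<dots> = (\<Sum>i\<in>I. \<Sum>a\<in>S. \<Sum>b\<in>S. ?F a b i)"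
      by (rule sum.swap)
    finally show ?thesis .
  qed
  also have "\<dots> = (\<Sum>i\<in>I. lam i * wick_form c n S (\<lambda>a. diff_op i (u a)) v)"
    by (simp add: wick_form_def sum_distrib_left)
  finally show ?thesis .
qed

text \<open>The same step applied to the other factor. When the new difference, in cell
  \<open>l\<close>, hits \<open>v b\<close>, the expression again has the crossed shape of
  \<open>wick_form\<close>, with \<open>i # a\<close> and \<open>l # b\<close> as indices and both
  orders lowered by one.\<close>

lemma wick_form_diff_Suc:
  fixes c :: "'i list \<Rightarrow> real"
  assumes "\<And>a. a \<in> S \<Longrightarrow> chaos I lam (Suc p) (u a)" "\<And>a. a \<in> S \<Longrightarrow> chaos I lam (Suc q) (v a)"
  shows "real (Suc p) * wick_form_diff c (Suc (p + q)) S u v =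
    (\<Sum>i\<in>I. lam i * wick_form_diff c (p + q) S (\<lambda>a. diff_op i (u a)) v) +
    wick_form (\<lambda>x. lam (hd x) * c (tl x)) (p + q) ((\<lambda>(i, a). i # a) ` (I \<times> S))
      (\<lambda>x. diff_op (hd x) (u (tl x))) (\<lambda>x. diff_op (hd x) (v (tl x)))"
proof -
  let ?n = "p + q"
  let ?e = "\<lambda>a b i l. E (\<lambda>k. wick ?n (diff_op i (diff_op l (u a))) (v b) k * wick ?n (diff_op l (u b)) (diff_op i (v a)) k)"
  let ?e' = "\<lambda>a b i l. E (\<lambda>k. wick ?n (diff_op i (u a)) (diff_op l (v b)) k * wick ?n (diff_op l (u b)) (diff_op i (v a)) k)"
  have step: "real (Suc p) * E (\<lambda>k. wick (Suc ?n) (diff_op i (u a)) (v b) k * wick (Suc ?n) (u b) (diff_op i (v a)) k) =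
     (\<Sum>l\<in>I. lam l * ?e a b i l) +
     (\<Sum>l\<in>I. lam l * ?e' a b i l)"
    if ab: "a \<in> S" "b \<in> S" and i: "i \<in> I" for a b i
  proof -
    note u = assms(1) [OF ab(1)] assms(1) [OF ab(2)] and v = assms(2) [OF ab(1)] assms(2) [OF ab(2)]
    have du: "chaos I lam p (diff_op j (u a))" "chaos I lam p (diff_op j (u b))" if "j \<in> I" for j
      using chaos_Suc_diff_op [OF u(1) that] chaos_Suc_diff_op [OF u(2) that] by this+
    have dv: "chaos I lam q (diff_op j (v a))" "chaos I lam q (diff_op j (v b))" if "j \<in> I" for j
      using chaos_Suc_diff_op [OF v(1) that] chaos_Suc_diff_op [OF v(2) that] by this+
    have n: "p + Suc q = Suc ?n" "Suc p + q = Suc ?n" by auto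
    \<comment> \<open>The factors are exchanged so that the argument is taken from
      \<open>u b\<close>, which still has full order \<open>Suc p\<close>; \<open>u a\<close> has
      already been differentiated.\<close>
    have "real (Suc p) * E (\<lambda>k. wick (Suc ?n) (u b) (diff_op i (v a)) k * wick (Suc ?n) (diff_op i (u a)) (v b) k) =
      (\<Sum>l\<in>I. lam l * E (\<lambda>k. wick ?n (diff_op l (u b)) (diff_op i (v a)) k *
        (wick ?n (diff_op l (diff_op i (u a))) (v b) k + wick ?n (diff_op i (u a)) (diff_op l (v b)) k)))"
      using E_wick_number [OF u(2) dv(1) [OF i] n(2)
          poly_bounded_chaos [OF chaos_wick [OF du(1) [OF i] v(2) n(1)]]]
      by (simp add: diff_op_chaos_top [OF finite_I du(1) [OF i] v(2) n(1)])
    also have "\<dots> = (\<Sum>l\<in>I. lam l * (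
       E (\<lambda>k. wick ?n (diff_op l (u b)) (diff_op i (v a)) k * wick ?n (diff_op l (diff_op i (u a))) (v b) k) +
       E (\<lambda>k. wick ?n (diff_op l (u b)) (diff_op i (v a)) k * wick ?n (diff_op i (u a)) (diff_op l (v b)) k)))"
      unfolding distrib_left [of "wick _ _ _ _"]
      by (intro sum.cong refl arg_cong [where f = "\<lambda>x. _ * x"] E_add)
        (auto intro!: poly_bounded_mult poly_bounded_wick_diff_op [OF du(1) [OF i] v(2) n(1)]
          poly_bounded_wick [OF du(2) dv(1) refl] i)
    finally show ?thesis
      by (simp add: distrib_left sum.distrib diff_op_commute mult.commute)
  qed
  have inj: "inj_on (\<lambda>(i, a). i # a) (I \<times> S)" by (auto simp: inj_on_def)
  have reindex: "(\<Sum>x\<in>(\<lambda>(i, a). i # a) ` (I \<times> S). F x) = (\<Sum>a\<in>S. \<Sum>i\<in>I. F (i # a))" for F :: "'i list \<Rightarrow> real"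
  proof -
    have "(\<Sum>x\<in>(\<lambda>(i, a). i # a) ` (I \<times> S). F x) = (\<Sum>i\<in>I. \<Sum>a\<in>S. F (i # a))"
      by (subst sum.reindex [OF inj]) (simp add: sum.cartesian_product case_prod_unfold)
    also have "\<dots> = (\<Sum>a\<in>S. \<Sum>i\<in>I. F (i # a))" by (rule sum.swap)
    finally show ?thesis .
  qed
  have "real (Suc p) * wick_form_diff c (Suc ?n) S u v =
    (\<Sum>a\<in>S. \<Sum>b\<in>S. \<Sum>i\<in>I. c a * c b * lam i * (
     (\<Sum>l\<in>I. lam l * ?e a b i l) +
     (\<Sum>l\<in>I. lam l * ?e' a b i l)))"
    unfolding wick_form_diff_def sum_distrib_left
    by (intro sum.cong refl) (subst step [symmetric], assumption+, rule mult.left_commute)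
  also have "\<dots> = (\<Sum>a\<in>S. \<Sum>b\<in>S. \<Sum>i\<in>I. \<Sum>l\<in>I. lam l * (c a * c b * lam i *
        ?e a b i l))
    + (\<Sum>a\<in>S. \<Sum>b\<in>S. \<Sum>i\<in>I. \<Sum>l\<in>I. (lam i * c a) * (lam l * c b) *
        ?e' a b i l)"
    unfolding sum.distrib [symmetric]
    by (intro sum.cong refl) (simp add: distrib_left sum_distrib_left mult_ac sum.distrib)
  also have "(\<Sum>a\<in>S. \<Sum>b\<in>S. \<Sum>i\<in>I. \<Sum>l\<in>I. (lam i * c a) * (lam l * c b) *
        ?e' a b i l)
    = wick_form (\<lambda>x. lam (hd x) * c (tl x)) ?n ((\<lambda>(i, a). i # a) ` (I \<times> S))
      (\<lambda>x. diff_op (hd x) (u (tl x))) (\<lambda>x. diff_op (hd x) (v (tl x)))"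
    unfolding wick_form_def reindex list.sel by (intro sum.cong refl sum.swap)
  also have "(\<Sum>a\<in>S. \<Sum>b\<in>S. \<Sum>i\<in>I. \<Sum>l\<in>I. lam l * (c a * c b * lam i *
        ?e a b i l))
    = (\<Sum>l\<in>I. \<Sum>a\<in>S. \<Sum>b\<in>S. \<Sum>i\<in>I. lam l * (c a * c b * lam i *
        ?e a b i l))"
    (is "(\<Sum>a\<in>S. \<Sum>b\<in>S. \<Sum>i\<in>I. \<Sum>l\<in>I. ?F a b i l) = _")
  proof -
    have "(\<Sum>a\<in>S. \<Sum>b\<in>S. \<Sum>i\<in>I. \<Sum>l\<in>I. ?F a b i l) = (\<Sum>a\<in>S. \<Sum>b\<in>S. \<Sum>l\<in>I. \<Sum>i\<in>I. ?F a b i l)"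
      by (intro sum.cong refl sum.swap)
    also have "\<dots> = (\<Sum>a\<in>S. \<Sum>l\<in>I. \<Sum>b\<in>S. \<Sum>i\<in>I. ?F a b i l)"
      by (intro sum.cong refl sum.swap)
    also have "\<dots> = (\<Sum>l\<in>I. \<Sum>a\<in>S. \<Sum>b\<in>S. \<Sum>i\<in>I. ?F a b i l)"
      by (rule sum.swap)
    finally show ?thesis .
  qed
  also have "\<dots> = (\<Sum>i\<in>I. lam i * wick_form_diff c ?n S (\<lambda>a. diff_op i (u a)) v)"
    by (simp add: wick_form_diff_def sum_distrib_left)
  finally show ?thesis .
qed

lemma E_square_le: "poly_bounded \<phi> \<Longrightarrow> (E \<phi>)\<^sup>2 \<le> E (\<lambda>k. (\<phi> k)\<^sup>2)"
proof -
  assume p: "poly_bounded \<phi>"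
  have "0 \<le> E (\<lambda>k. (\<phi> k - E \<phi>)\<^sup>2)" by simp
  also have "E (\<lambda>k. (\<phi> k - E \<phi>)\<^sup>2) = E (\<lambda>k. ((\<phi> k)\<^sup>2 + (E \<phi>)\<^sup>2) - 2 * E \<phi> * \<phi> k)"
    by (simp add: power2_diff mult_ac)
  also have "\<dots> = E (\<lambda>k. (\<phi> k)\<^sup>2) + (E \<phi>)\<^sup>2 - 2 * E \<phi> * E \<phi>"
    by (subst E_diff, intro poly_bounded_intros p, intro poly_bounded_intros p,
        subst E_add) (auto intro!: poly_bounded_intros p)
  finally show ?thesis by (simp add: power2_eq_square)
qed

text \<open>In terms of kernels the form is a positive combination of squared norms of the
  contractions of \<open>u a\<close> with \<open>v a\<close>, summed over \<open>a\<close> with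
  weights \<open>c a\<close>. The induction reaches positivity without kernels: both recursions have
  nonnegative weights and lower the order of \<open>u\<close>, and at order 0 the form is the second
  moment of a single sum. The claims are proved together for all \<open>c\<close>, \<open>S\<close>
  and \<open>q\<close>, since the recursion for the mixed form changes the index set and the
  weights. The last claim retains the full contraction, which is a number when
  \<open>p = q\<close>.\<close>

lemma wick_form_nonneg:
  fixes c :: "'i list \<Rightarrow> real"
  assumes "finite S" "\<And>a. a \<in> S \<Longrightarrow> chaos I lam p (u a)" "\<And>a. a \<in> S \<Longrightarrow> chaos I lam q (v a)"
  shows "0 \<le> wick_form c (p + q) S u v \<and> 0 \<le> wick_form_diff c (p + q - 1) S u v \<and>
    (p = q \<longrightarrow> (\<Sum>a\<in>S. c a * E (\<lambda>k. u a k * v a k))\<^sup>2 \<le> wick_form c (p + q) S u v)"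
  using assms
proof (induction p arbitrary: q S u v c)
  case 0
  define d where "d a = u a (\<lambda>_. 0)" for a
  have d: "u a = (\<lambda>_. d a)" if "a \<in> S" for a
    using chaos_0D [OF 0(2) [OF that] refl] by (auto simp: d_def)
  have w: "wick q (u a) (v b) = (\<lambda>k. d a * v b k)" if "a \<in> S" "b \<in> S" for a b
    using 0 d that by (simp add: chaos_top_chaos [OF finite_I] chaos_scale)
  have pv: "poly_bounded (v a)" if "a \<in> S" for a
    using 0 that by (auto intro: poly_bounded_chaos)
  let ?s = "\<lambda>k. \<Sum>a\<in>S. c a * (d a * v a k)"
  have "wick_form c q S u v = (\<Sum>a\<in>S. \<Sum>b\<in>S. E (\<lambda>k. (c a * (d a * v a k)) * (c b * (d b * v b k))))"
    unfolding wick_form_def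
    by (intro sum.cong refl) (simp add: w mult_ac)
  also have "\<dots> = E (\<lambda>k. (?s k)\<^sup>2)"
    unfolding power2_eq_square sum_product
    by (subst E_sum, intro poly_bounded_intros pv, assumption+)
      (intro sum.cong refl E_sum [symmetric] poly_bounded_intros pv)
  finally have eq: "wick_form c q S u v = E (\<lambda>k. (?s k)\<^sup>2)" .
  have "(\<Sum>a\<in>S. c a * E (\<lambda>k. u a k * v a k)) = E ?s"
    by (subst E_sum) (auto intro!: poly_bounded_intros pv sum.cong simp: d)
  moreover have "(E ?s)\<^sup>2 \<le> E (\<lambda>k. (?s k)\<^sup>2)"
    by (intro E_square_le poly_bounded_intros pv)
  \<comment> \<open>At order 0 the differences of \<open>u\<close> vanish, so the value of the
    truncated order \<open>q - 1\<close> does not matter.\<close>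
  moreover have "wick_form_diff c (q - 1) S u v = 0"
    unfolding wick_form_diff_def
    by (intro sum.neutral ballI) (simp add: chaos_0_diff_op [OF 0(2)] chaos_top_zero [OF finite_I])
  ultimately show ?case using eq by auto
next
  case (Suc p)
  have du: "chaos I lam p (diff_op i (u a))" if "i \<in> I" "a \<in> S" for i a
    using chaos_Suc_diff_op [OF Suc.prems(2) [OF that(2)] that(1)] .
  have IH1: "0 \<le> wick_form c (p + q) S (\<lambda>a. diff_op i (u a)) v"
    and IH2: "0 \<le> wick_form_diff c (p + q - 1) S (\<lambda>a. diff_op i (u a)) v" if "i \<in> I" for i
    using Suc.IH [OF Suc.prems(1), of "\<lambda>a. diff_op i (u a)" q v c] du [OF that] Suc.prems(3) by auto
  have s1: "real (Suc p) * wick_form c (Suc (p + q)) S u v =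
    (\<Sum>i\<in>I. lam i * wick_form c (p + q) S (\<lambda>a. diff_op i (u a)) v) + wick_form_diff c (p + q) S u v"
    by (rule wick_form_Suc [OF Suc.prems(2,3)]) auto
  have ge1: "wick_form_diff c (p + q) S u v \<le> real (Suc p) * wick_form c (Suc (p + q)) S u v"
    unfolding s1 using IH1 lam_nonneg by (simp add: sum_nonneg)
  have d: "0 \<le> wick_form_diff c (p + q) S u v \<and>
    (Suc p = q \<longrightarrow> (real (Suc p) * (\<Sum>a\<in>S. c a * E (\<lambda>k. u a k * v a k)))\<^sup>2 \<le> real (Suc p) * wick_form_diff c (p + q) S u v)"
  proof (cases q)
    case 0
    have "wick_form_diff c (p + q) S u v = 0"
      unfolding wick_form_diff_def
      by (intro sum.neutral ballI)
        (simp add: chaos_0_diff_op [OF Suc.prems(3) [unfolded 0]] chaos_top_zero [OF finite_I])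
    then show ?thesis using 0 by simp
  next
    case q: (Suc q')
    have dv: "chaos I lam q' (diff_op i (v a))" if "i \<in> I" "a \<in> S" for i a
      using chaos_Suc_diff_op [OF Suc.prems(3) [OF that(2), unfolded q] that(1)] .
    let ?c = "\<lambda>x. lam (hd x) * c (tl x)" and ?S = "(\<lambda>(i, a). i # a) ` (I \<times> S)"
    let ?u = "\<lambda>x. diff_op (hd x) (u (tl x))" and ?v = "\<lambda>x. diff_op (hd x) (v (tl x))"
    have IH3: "0 \<le> wick_form ?c (p + q') ?S ?u ?v"
      "p = q' \<Longrightarrow> (\<Sum>x\<in>?S. ?c x * E (\<lambda>k. ?u x k * ?v x k))\<^sup>2 \<le> wick_form ?c (p + q') ?S ?u ?v"
    proof -
      have "chaos I lam p (?u x)" "chaos I lam q' (?v x)" if "x \<in> ?S" for x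
        using that du dv by auto
      then show "0 \<le> wick_form ?c (p + q') ?S ?u ?v"
        "p = q' \<Longrightarrow> (\<Sum>x\<in>?S. ?c x * E (\<lambda>k. ?u x k * ?v x k))\<^sup>2 \<le> wick_form ?c (p + q') ?S ?u ?v"
        using Suc.IH [of ?S ?u q' ?v ?c] Suc.prems(1) finite_I by blast+
    qed
    have s2: "real (Suc p) * wick_form_diff c (Suc (p + q')) S u v =
      (\<Sum>i\<in>I. lam i * wick_form_diff c (p + q') S (\<lambda>a. diff_op i (u a)) v) + wick_form ?c (p + q') ?S ?u ?v"
      using Suc.prems q by (intro wick_form_diff_Suc) auto
    have ge2: "wick_form ?c (p + q') ?S ?u ?v \<le> real (Suc p) * wick_form_diff c (p + q) S u v"
      using IH2 lam_nonneg s2 q by (simp add: sum_nonneg)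
    have inj: "inj_on (\<lambda>(i, a). i # a) (I \<times> S)" by (auto simp: inj_on_def)
    have "(\<Sum>x\<in>?S. ?c x * E (\<lambda>k. ?u x k * ?v x k)) =
      (\<Sum>i\<in>I. \<Sum>a\<in>S. lam i * c a * E (\<lambda>k. diff_op i (u a) k * diff_op i (v a) k))"
      by (subst sum.reindex [OF inj]) (simp add: sum.cartesian_product case_prod_unfold)
    also have "\<dots> = (\<Sum>a\<in>S. c a * (\<Sum>i\<in>I. lam i * E (\<lambda>k. diff_op i (u a) k * diff_op i (v a) k)))"
      by (subst sum.swap) (simp add: sum_distrib_left mult_ac)
    also have "\<dots> = (\<Sum>a\<in>S. c a * (real (Suc p) * E (\<lambda>k. u a k * v a k)))"
      using Suc.prems by (intro sum.cong refl arg_cong [where f = "\<lambda>x. _ * x"]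
          E_chaos_number [symmetric]) (auto intro: poly_bounded_chaos)
    also have "\<dots> = real (Suc p) * (\<Sum>a\<in>S. c a * E (\<lambda>k. u a k * v a k))"
      by (simp only: sum_distrib_left mult.left_commute)
    finally have eq: "(\<Sum>x\<in>?S. ?c x * E (\<lambda>k. ?u x k * ?v x k)) =
      real (Suc p) * (\<Sum>a\<in>S. c a * E (\<lambda>k. u a k * v a k))" .
    have "0 \<le> real (Suc p) * wick_form_diff c (p + q) S u v"
      using IH3(1) ge2 by linarith
    then have "0 \<le> wick_form_diff c (p + q) S u v"
      by (simp add: zero_le_mult_iff)
    moreover have "Suc p = q \<Longrightarrow> (real (Suc p) * (\<Sum>a\<in>S. c a * E (\<lambda>k. u a k * v a k)))\<^sup>2 \<le> real (Suc p) * wick_form_diff c (p + q) S u v"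
      using IH3(2) ge2 q eq by simp
    ultimately show ?thesis by blast
  qed
  have n1: "0 \<le> wick_form c (Suc (p + q)) S u v"
    using order_trans [OF conjunct1 [OF d] ge1] by (simp add: zero_le_mult_iff)
  moreover have "(\<Sum>a\<in>S. c a * E (\<lambda>k. u a k * v a k))\<^sup>2 \<le> wick_form c (Suc (p + q)) S u v" if "Suc p = q"
  proof -
    have "(real (Suc p))\<^sup>2 * (\<Sum>a\<in>S. c a * E (\<lambda>k. u a k * v a k))\<^sup>2 \<le> real (Suc p) * wick_form_diff c (p + q) S u v"
      using d that by (simp only: power_mult_distrib)
    also have "\<dots> \<le> real (Suc p) * (real (Suc p) * wick_form c (Suc (p + q)) S u v)"
      using ge1 by (intro mult_left_mono) auto
    finally show ?thesis by (simp add: power2_eq_square mult.assoc del: of_nat_Suc)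
  qed
  ultimately show ?case using d by auto
qed

text \<open>Take the arguments of \<open>u\<close> off one by one. The mixed form produced at each
  step is nonnegative and is dropped; the form over a single index is a second moment, and
  \<open>[]\<close> serves as that index.\<close>

lemma E_wick_square_ge:
  assumes "chaos I lam p u" "chaos I lam q v"
  shows "E (\<lambda>k. (u k)\<^sup>2) * E (\<lambda>k. (v k)\<^sup>2) \<le> E (\<lambda>k. (wick (p + q) u v k)\<^sup>2)"
  using assms
proof (induction p arbitrary: u)
  case 0
  then obtain d where d: "u = (\<lambda>_. d)" using chaos_0D by blast
  then have "wick q u v = (\<lambda>k. d * v k)"
    using 0 by (simp add: chaos_top_chaos [OF finite_I] chaos_scale)
  with d show ?case by (simp add: power_mult_distrib)
next
  case (Suc p)
  let ?n = "p + q"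
  have nn: "0 \<le> wick_form_diff (\<lambda>_. 1) ?n {[] :: 'i list} (\<lambda>_. u) (\<lambda>_. v)"
    using wick_form_nonneg [of "{[] :: 'i list}" "Suc p" "\<lambda>_. u" q "\<lambda>_. v" "\<lambda>_. 1"] Suc.prems by simp
  have "real (Suc p) * (E (\<lambda>k. (u k)\<^sup>2) * E (\<lambda>k. (v k)\<^sup>2)) =
    (\<Sum>i\<in>I. lam i * (E (\<lambda>k. (diff_op i u k)\<^sup>2) * E (\<lambda>k. (v k)\<^sup>2)))"
    using E_chaos_number [OF Suc.prems(1) poly_bounded_chaos [OF Suc.prems(1)]]
    by (simp add: power2_eq_square sum_distrib_right flip: mult.assoc)
  also have "\<dots> \<le> (\<Sum>i\<in>I. lam i * E (\<lambda>k. (wick ?n (diff_op i u) v k)\<^sup>2))"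
    using Suc.prems lam_nonneg
    by (intro sum_mono mult_left_mono Suc.IH) (auto intro: chaos_Suc_diff_op)
  also have "\<dots> = (\<Sum>i\<in>I. lam i * wick_form (\<lambda>_. 1) ?n {[] :: 'i list} (\<lambda>_. diff_op i u) (\<lambda>_. v))"
    by (simp add: wick_form_def power2_eq_square)
  also have "\<dots> \<le> real (Suc p) * wick_form (\<lambda>_. 1) (Suc ?n) {[] :: 'i list} (\<lambda>_. u) (\<lambda>_. v)"
    using wick_form_Suc [of "{[] :: 'i list}" "Suc p" "\<lambda>_. u" q "\<lambda>_. v" ?n "\<lambda>_. 1"] Suc.prems nn by simp
  also have "\<dots> = real (Suc p) * E (\<lambda>k. (wick (Suc p + q) u v k)\<^sup>2)"
    by (simp add: wick_form_def power2_eq_square)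
  finally show ?case by (simp del: of_nat_Suc)
qed

text \<open>The factor 2 comes from keeping the mixed form. When both factors are \<open>u\<close>,
  it contains the full contraction, and this contributes a second copy of the squared
  variance.\<close>

lemma E_wick_self_square_ge:
  assumes "chaos I lam p u" "p > 0"
  shows "2 * (E (\<lambda>k. (u k)\<^sup>2))\<^sup>2 \<le> E (\<lambda>k. (wick (p + p) u u k)\<^sup>2)"
proof -
  obtain r where r: "p = Suc r" using assms(2) by (cases p) auto
  let ?n = "r + p" and ?a = "E (\<lambda>k. (u k)\<^sup>2)"
  note u = assms(1) [unfolded r]
  have "real p * ?a\<^sup>2 = (\<Sum>i\<in>I. lam i * (E (\<lambda>k. (diff_op i u k)\<^sup>2) * ?a))"
    using E_chaos_number [OF assms(1) poly_bounded_chaos [OF assms(1)]]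
    by (simp add: power2_eq_square sum_distrib_right flip: mult.assoc)
  also have "\<dots> \<le> (\<Sum>i\<in>I. lam i * E (\<lambda>k. (wick ?n (diff_op i u) u k)\<^sup>2))"
    using assms(1) u lam_nonneg
    by (intro sum_mono mult_left_mono E_wick_square_ge) (auto intro: chaos_Suc_diff_op)
  also have "\<dots> = (\<Sum>i\<in>I. lam i * wick_form (\<lambda>_. 1) ?n {[] :: 'i list} (\<lambda>_. diff_op i u) (\<lambda>_. u))"
    by (simp add: wick_form_def power2_eq_square)
  finally have 1: "real p * ?a\<^sup>2 + wick_form_diff (\<lambda>_. 1) ?n {[] :: 'i list} (\<lambda>_. u) (\<lambda>_. u) \<le>
      real p * E (\<lambda>k. (wick (p + p) u u k)\<^sup>2)"
    using wick_form_Suc [of "{[] :: 'i list}" p "\<lambda>_. u" p "\<lambda>_. u" ?n "\<lambda>_. 1"] assms(1) r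
    by (simp add: wick_form_def power2_eq_square)
  \<comment> \<open>The indices are the lists \<open>[i]\<close>, one for each cell; by the energy
    identity their weighted pairings add up to \<open>p\<close> times the variance.\<close>
  let ?S = "(\<lambda>(i, a). i # a) ` (I \<times> {[] :: 'i list})" and ?c = "\<lambda>x. lam (hd x) * 1" and ?u = "\<lambda>x. diff_op (hd x) u"
  have inj: "inj_on (\<lambda>(i, a). i # a) (I \<times> {[] :: 'i list})" by (auto simp: inj_on_def)
  have "(\<Sum>x\<in>?S. ?c x * E (\<lambda>k. ?u x k * ?u x k)) = real p * ?a"
    using E_chaos_number [OF assms(1) poly_bounded_chaos [OF assms(1)]]
    by (subst sum.reindex [OF inj]) (simp add: power2_eq_square sum.cartesian_product')
  moreover have "(\<Sum>x\<in>?S. ?c x * E (\<lambda>k. ?u x k * ?u x k))\<^sup>2 \<le> wick_form ?c (r + r) ?S ?u ?u"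
  proof -
    have "chaos I lam r (?u x)" if "x \<in> ?S" for x
      using that chaos_Suc_diff_op [OF u] by auto
    then show ?thesis
      using wick_form_nonneg [of ?S r ?u r ?u ?c] finite_I by blast
  qed
  moreover have "wick_form ?c (r + r) ?S ?u ?u \<le> real p * wick_form_diff (\<lambda>_. 1) ?n {[] :: 'i list} (\<lambda>_. u) (\<lambda>_. u)"
  proof -
    have "0 \<le> wick_form_diff (\<lambda>_. 1) (r + r) {[] :: 'i list} (\<lambda>_. diff_op i u) (\<lambda>_. u)" if "i \<in> I" for i
      using wick_form_nonneg [of "{[] :: 'i list}" r "\<lambda>_. diff_op i u" p "\<lambda>_. u" "\<lambda>_. 1"] assms(1) u that r
      by (auto intro: chaos_Suc_diff_op)
    then have "0 \<le> (\<Sum>i\<in>I. lam i * wick_form_diff (\<lambda>_. 1) (r + r) {[] :: 'i list} (\<lambda>_. diff_op i u) (\<lambda>_. u))"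
      using lam_nonneg by (intro sum_nonneg mult_nonneg_nonneg) auto
    then show ?thesis
      using wick_form_diff_Suc [of "{[] :: 'i list}" r "\<lambda>_. u" r "\<lambda>_. u" "\<lambda>_. 1"] u r by simp
  qed
  ultimately have "real p * (real p * ?a\<^sup>2) \<le> real p * wick_form_diff (\<lambda>_. 1) ?n {[] :: 'i list} (\<lambda>_. u) (\<lambda>_. u)"
    by (simp add: power_mult_distrib power2_eq_square mult_ac)
  then have "real p * ?a\<^sup>2 \<le> wick_form_diff (\<lambda>_. 1) ?n {[] :: 'i list} (\<lambda>_. u) (\<lambda>_. u)"
    using assms(2) by simp
  with 1 have "real p * (2 * ?a\<^sup>2) \<le> real p * E (\<lambda>k. (wick (p + p) u u k)\<^sup>2)"
    by simp
  then show ?thesis using assms(2) by simp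
qed

section \<open>The carre du champ operator and fourth cumulants\<close>

abbreviation back_diff :: "'i \<Rightarrow> (('i \<Rightarrow> nat) \<Rightarrow> real) \<Rightarrow> ('i \<Rightarrow> nat) \<Rightarrow> real" where
  "back_diff i \<phi> k \<equiv> \<phi> k - \<phi> (k(i := k i - 1))"

text \<open>This identifies the number operator as minus the generator of a chain in which cell
  \<open>i\<close> gains a point at rate \<open>lam i\<close> and every point dies at rate
  1.\<close>

lemma number_op_eq:
  "number_op I lam \<phi> k = (\<Sum>i\<in>I. real (k i) * back_diff i \<phi> k - lam i * diff_op i \<phi> k)"
  unfolding number_op_def
proof (intro sum.cong refl)
  fix i
  have "k i > 0 \<Longrightarrow> k(i := Suc (k i - Suc 0)) = k" by (auto simp: fun_eq_iff)
  then show "create_op lam i (diff_op i \<phi>) k = real (k i) * back_diff i \<phi> k - lam i * diff_op i \<phi> k"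
    by (cases "k i = 0") (auto simp: create_op_def diff_op_def)
qed

lemma E_number_op_zero: "poly_bounded \<phi> \<Longrightarrow> E (number_op I lam \<phi>) = 0"
  using E_number_op [of \<phi> "\<lambda>_. 1"] by (simp add: poly_bounded_const)

lemma E_number_op_commute:
  "poly_bounded \<phi> \<Longrightarrow> poly_bounded \<psi> \<Longrightarrow>
    E (\<lambda>k. number_op I lam \<phi> k * \<psi> k) = E (\<lambda>k. \<phi> k * number_op I lam \<psi> k)"
  using E_number_op [of \<phi> \<psi>] E_number_op [of \<psi> \<phi>] by (simp add: mult.commute)

definition carre_du_champ ::
    "(('i \<Rightarrow> nat) \<Rightarrow> real) \<Rightarrow> (('i \<Rightarrow> nat) \<Rightarrow> real) \<Rightarrow> ('i \<Rightarrow> nat) \<Rightarrow> real" where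
  "carre_du_champ \<phi> \<psi> = (\<lambda>k. (\<phi> k * number_op I lam \<psi> k + number_op I lam \<phi> k * \<psi> k
     - number_op I lam (\<lambda>k. \<phi> k * \<psi> k) k) / 2)"

lemma carre_du_champ_eq:
  "carre_du_champ \<phi> \<psi> k = (\<Sum>i\<in>I. lam i * (diff_op i \<phi> k * diff_op i \<psi> k)
     + real (k i) * (back_diff i \<phi> k * back_diff i \<psi> k)) / 2"
proof -
  have "\<phi> k * number_op I lam \<psi> k + number_op I lam \<phi> k * \<psi> k - number_op I lam (\<lambda>k. \<phi> k * \<psi> k) k =
    (\<Sum>i\<in>I. lam i * (diff_op i \<phi> k * diff_op i \<psi> k) + real (k i) * (back_diff i \<phi> k * back_diff i \<psi> k))"
    unfolding number_op_eq sum_distrib_left sum_distrib_right sum.distrib [symmetric] sum_subtractf [symmetric]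
    by (intro sum.cong refl) (simp add: diff_op_def algebra_simps)
  then show ?thesis by (simp add: carre_du_champ_def)
qed

lemma poly_bounded_carre_du_champ:
  "poly_bounded \<phi> \<Longrightarrow> poly_bounded \<psi> \<Longrightarrow> poly_bounded (carre_du_champ \<phi> \<psi>)"
  unfolding carre_du_champ_def divide_inverse
  by (intro poly_bounded_intros)

lemma carre_du_champ_add_right:
  "carre_du_champ \<phi> (\<lambda>k. \<psi> k + \<theta> k) k = carre_du_champ \<phi> \<psi> k + carre_du_champ \<phi> \<theta> k"
  by (simp add: carre_du_champ_eq diff_op_def add_divide_distrib [symmetric] sum.distrib [symmetric] algebra_simps)

lemma carre_du_champ_commute: "carre_du_champ \<phi> \<psi> k = carre_du_champ \<psi> \<phi> k"
  by (simp add: carre_du_champ_eq mult.commute)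

text \<open>The integration by parts used in Stein's method: with \<psi> a function of the sum of
  the two chaoses, it trades \<open>u\<close> for a quadratic expression in jumps. The number
  operator is symmetric and has mean zero, so two of the three terms cancel down to one.\<close>

lemma E_carre_du_champ:
  assumes "chaos I lam p u" "poly_bounded \<psi>"
  shows "E (carre_du_champ u \<psi>) = real p * E (\<lambda>k. u k * \<psi> k)"
proof -
  note pu = poly_bounded_chaos [OF assms(1)]
  have "E (carre_du_champ u \<psi>) = E (\<lambda>k. (u k * number_op I lam \<psi> k + number_op I lam u k * \<psi> k) -
      number_op I lam (\<lambda>k. u k * \<psi> k) k) / 2"
    by (simp add: carre_du_champ_def)
  also have "\<dots> = (E (\<lambda>k. u k * number_op I lam \<psi> k) + E (\<lambda>k. number_op I lam u k * \<psi> k)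
      - E (number_op I lam (\<lambda>k. u k * \<psi> k))) / 2"
    by (subst E_diff, intro poly_bounded_intros pu assms(2), intro poly_bounded_intros pu assms(2),
        subst E_add) (auto intro!: poly_bounded_intros pu assms(2))
  also have "\<dots> = E (\<lambda>k. number_op I lam u k * \<psi> k)"
    using E_number_op_commute [OF pu assms(2)] E_number_op_zero [OF poly_bounded_mult [OF pu assms(2)]]
    by simp
  also have "\<dots> = real p * E (\<lambda>k. u k * \<psi> k)"
    by (simp add: number_op_chaos [OF assms(1) finite_I] mult.assoc)
  finally show ?thesis .
qed

lemma E_chaos_sums:
  assumes "\<And>n. chaos I lam n (w n)"
  shows "E (\<lambda>k. (\<Sum>n<m. c n * w n k) * (\<Sum>n<m. d n * w n k)) = (\<Sum>n<m. c n * d n * E (\<lambda>k. (w n k)\<^sup>2))"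
proof -
  have pw: "poly_bounded (w n)" for n by (rule poly_bounded_chaos [OF assms])
  have "E (\<lambda>k. (\<Sum>n<m. c n * w n k) * (\<Sum>n<m. d n * w n k)) =
      E (\<lambda>k. \<Sum>n<m. \<Sum>l<m. c n * d l * (w n k * w l k))"
    by (simp add: sum_product mult_ac)
  also have "\<dots> = (\<Sum>n<m. \<Sum>l<m. c n * d l * E (\<lambda>k. w n k * w l k))"
    by (subst E_sum, intro poly_bounded_intros pw, subst E_sum, intro poly_bounded_intros pw) simp
  also have "\<dots> = (\<Sum>n<m. \<Sum>l<m. if l = n then c n * d n * E (\<lambda>k. (w n k)\<^sup>2) else 0)"
    by (intro sum.cong refl) (auto simp: chaos_orthogonal [OF assms assms] power2_eq_square)
  finally show ?thesis by simp
qed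

lemma number_op_sum: "number_op I lam (\<lambda>k. \<Sum>a\<in>S. \<phi> a k) k = (\<Sum>a\<in>S. number_op I lam (\<phi> a) k)"
  unfolding number_op_def diff_op_sum create_op_sum by (rule sum.swap)

text \<open>On the component of order \<open>n\<close> of the product, the carre du champ acts as
  the scalar \<open>(p + q - n) / 2\<close>. It annihilates the Wick product, so its second moment
  sees only the components that the lower bounds on Wick norms leave small.\<close>

lemma product_decomposition:
  assumes "chaos I lam p u" "chaos I lam q v"
  obtains w where "\<And>n. chaos I lam n (w n)" "\<And>k. u k * v k = (\<Sum>n<Suc (p + q). w n k)"
    "w (p + q) = wick (p + q) u v"
    "\<And>k. carre_du_champ u v k = (\<Sum>n<Suc (p + q). ((real (p + q) - real n) / 2) * w n k)"
    "\<And>k. number_op I lam (\<lambda>k. u k * v k) k = (\<Sum>n<Suc (p + q). real n * w n k)"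
proof -
  obtain w where w: "\<And>n. chaos I lam n (w n)" "(\<lambda>k. u k * v k) = (\<lambda>k. \<Sum>n<Suc (p + q). w n k)"
    using chaos_mult [OF assms] unfolding chaos_below_def by blast
  have top: "wick (p + q) u v = w (p + q)"
    by (rule chaos_top_unique [OF finite_I w(1)], rule chaos_belowI [OF w(1)])
      (use fun_cong [OF w(2)] in \<open>simp add: fun_eq_iff\<close>)
  have num: "number_op I lam (\<lambda>k. u k * v k) k = (\<Sum>n<Suc (p + q). real n * w n k)" for k
    unfolding w(2) number_op_sum by (simp only: number_op_chaos [OF w(1) finite_I])
  have "carre_du_champ u v k = (\<Sum>n<Suc (p + q). ((real (p + q) - real n) / 2) * w n k)" for k
  proof -
    have "carre_du_champ u v k = (real (p + q) * (u k * v k) - (\<Sum>n<Suc (p + q). real n * w n k)) / 2"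
      unfolding carre_du_champ_def num
      by (simp add: number_op_chaos [OF assms(1) finite_I] number_op_chaos [OF assms(2) finite_I] algebra_simps)
    also have "u k * v k = (\<Sum>n<Suc (p + q). w n k)" using fun_cong [OF w(2)] .
    finally show ?thesis
      unfolding sum_distrib_left sum_subtractf [symmetric] sum_divide_distrib
      by (simp only: left_diff_distrib diff_divide_distrib times_divide_eq_left)
  qed
  with w top num show ?thesis by (intro that) (auto simp: fun_eq_iff)
qed

text \<open>The Wick component already accounts for the product of the variances, so the remaining
  components together carry at most the covariance of the squares. Each of their coefficients is at
  most \<open>(p + q) / 2\<close>.\<close>

lemma E_carre_du_champ_square_le:
  assumes "chaos I lam p u" "chaos I lam q v"
  shows "E (\<lambda>k. (carre_du_champ u v k)\<^sup>2) \<le> (real (p + q) / 2)\<^sup>2 *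
    (E (\<lambda>k. (u k)\<^sup>2 * (v k)\<^sup>2) - E (\<lambda>k. (u k)\<^sup>2) * E (\<lambda>k. (v k)\<^sup>2))"
    and "E (\<lambda>k. (u k)\<^sup>2) * E (\<lambda>k. (v k)\<^sup>2) \<le> E (\<lambda>k. (u k)\<^sup>2 * (v k)\<^sup>2)"
proof -
  obtain w where w: "\<And>n. chaos I lam n (w n)" "\<And>k. u k * v k = (\<Sum>n<Suc (p + q). w n k)"
    "w (p + q) = wick (p + q) u v"
    "\<And>k. carre_du_champ u v k = (\<Sum>n<Suc (p + q). ((real (p + q) - real n) / 2) * w n k)"
    by (rule product_decomposition [OF assms]) blast
  let ?N = "\<lambda>n. E (\<lambda>k. (w n k)\<^sup>2)"
  have "E (\<lambda>k. (u k)\<^sup>2 * (v k)\<^sup>2) = E (\<lambda>k. (\<Sum>n<Suc (p + q). 1 * w n k) * (\<Sum>n<Suc (p + q). 1 * w n k))"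
  proof -
    have "(u k)\<^sup>2 * (v k)\<^sup>2 = (u k * v k) * (u k * v k)" for k by algebra
    then show ?thesis by (simp only: w(2) mult_1)
  qed
  also have "\<dots> = (\<Sum>n<Suc (p + q). 1 * 1 * ?N n)" by (rule E_chaos_sums [OF w(1)])
  finally have m: "E (\<lambda>k. (u k)\<^sup>2 * (v k)\<^sup>2) = (\<Sum>n<p + q. ?N n) + ?N (p + q)" by simp
  have top: "E (\<lambda>k. (u k)\<^sup>2) * E (\<lambda>k. (v k)\<^sup>2) \<le> ?N (p + q)"
    using E_wick_square_ge [OF assms] by (simp add: w(3))
  have "E (\<lambda>k. (carre_du_champ u v k)\<^sup>2) =
    (\<Sum>n<Suc (p + q). ((real (p + q) - real n) / 2) * ((real (p + q) - real n) / 2) * ?N n)"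
    unfolding w(4) power2_eq_square by (rule E_chaos_sums [OF w(1), unfolded power2_eq_square])
  also have "\<dots> = (\<Sum>n<p + q. ((real (p + q) - real n) / 2)\<^sup>2 * ?N n)"
    by (simp add: power2_eq_square)
  also have "\<dots> \<le> (\<Sum>n<p + q. (real (p + q) / 2)\<^sup>2 * ?N n)"
    by (intro sum_mono mult_right_mono power_mono) auto
  also have "\<dots> = (real (p + q) / 2)\<^sup>2 * (\<Sum>n<p + q. ?N n)"
    by (simp only: sum_distrib_left)
  also have "\<dots> \<le> (real (p + q) / 2)\<^sup>2 *
    (E (\<lambda>k. (u k)\<^sup>2 * (v k)\<^sup>2) - E (\<lambda>k. (u k)\<^sup>2) * E (\<lambda>k. (v k)\<^sup>2))"
    using m top by (intro mult_left_mono) auto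
  finally show "E (\<lambda>k. (carre_du_champ u v k)\<^sup>2) \<le> (real (p + q) / 2)\<^sup>2 *
    (E (\<lambda>k. (u k)\<^sup>2 * (v k)\<^sup>2) - E (\<lambda>k. (u k)\<^sup>2) * E (\<lambda>k. (v k)\<^sup>2))" .
  have "0 \<le> (\<Sum>n<p + q. ?N n)" by (intro sum_nonneg) auto
  with m top show "E (\<lambda>k. (u k)\<^sup>2) * E (\<lambda>k. (v k)\<^sup>2) \<le> E (\<lambda>k. (u k)\<^sup>2 * (v k)\<^sup>2)" by linarith
qed

text \<open>The infinitesimal fourth moment of the jumps of \<open>\<phi>\<close> along the birth and death chain with
  generator \<open>- number_op\<close>.\<close>

definition jump_moment :: "(('i \<Rightarrow> nat) \<Rightarrow> real) \<Rightarrow> ('i \<Rightarrow> nat) \<Rightarrow> real" where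
  "jump_moment \<phi> k = (\<Sum>i\<in>I. lam i * (diff_op i \<phi> k) ^ 4 + real (k i) * (back_diff i \<phi> k) ^ 4)"

text \<open>A fourth power of an increment, expanded around the current value of \<phi>, is a
  combination of increments of powers of \<phi>; summing over jumps turns these into generators. In
  expectation only moments of \<phi> and the energy of its square survive.\<close>

lemma jump_moment_eq:
  "jump_moment \<phi> k = 4 * (\<phi> k * number_op I lam (\<lambda>k. \<phi> k ^ 3) k) - 6 * ((\<phi> k)\<^sup>2 * number_op I lam (\<lambda>k. (\<phi> k)\<^sup>2) k)
    + 4 * (\<phi> k ^ 3 * number_op I lam \<phi> k) - number_op I lam (\<lambda>k. \<phi> k ^ 4) k"
  unfolding number_op_eq jump_moment_def sum_distrib_left sum.distrib [symmetric] sum_subtractf [symmetric]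
proof (intro sum.cong refl)
  fix i
  have d1: "(x - y) ^ 4 = 4 * (x * (x ^ 3 - y ^ 3)) - 6 * (x\<^sup>2 * (x\<^sup>2 - y\<^sup>2)) + 4 * (x ^ 3 * (x - y)) - (x ^ 4 - y ^ 4)"
    for x y :: real by algebra
  have d2: "(y - x) ^ 4 = - (4 * (x * (y ^ 3 - x ^ 3))) + 6 * (x\<^sup>2 * (y\<^sup>2 - x\<^sup>2)) - 4 * (x ^ 3 * (y - x)) + (y ^ 4 - x ^ 4)"
    for x y :: real by algebra
  show "lam i * (diff_op i \<phi> k) ^ 4 + real (k i) * (back_diff i \<phi> k) ^ 4 =
    4 * (\<phi> k * (real (k i) * back_diff i (\<lambda>k. \<phi> k ^ 3) k - lam i * diff_op i (\<lambda>k. \<phi> k ^ 3) k)) -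
    6 * ((\<phi> k)\<^sup>2 * (real (k i) * back_diff i (\<lambda>k. (\<phi> k)\<^sup>2) k - lam i * diff_op i (\<lambda>k. (\<phi> k)\<^sup>2) k)) +
    4 * (\<phi> k ^ 3 * (real (k i) * back_diff i \<phi> k - lam i * diff_op i \<phi> k)) -
    (real (k i) * back_diff i (\<lambda>k. \<phi> k ^ 4) k - lam i * diff_op i (\<lambda>k. \<phi> k ^ 4) k)"
    unfolding diff_op_def d1 [of "\<phi> k"] d2 [of _ "\<phi> k"] by algebra
qed

lemma poly_bounded_back_diff: "poly_bounded \<phi> \<Longrightarrow> poly_bounded (back_diff i \<phi>)"
  by (rule poly_bounded_diff [OF _ poly_bounded_unshift])

lemma poly_bounded_jump_moment: "poly_bounded \<phi> \<Longrightarrow> poly_bounded (jump_moment \<phi>)"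
  unfolding jump_moment_def [abs_def]
  by (intro poly_bounded_sum poly_bounded_add poly_bounded_mult poly_bounded_power
      poly_bounded_diff_op poly_bounded_back_diff poly_bounded_const poly_bounded_coord)

lemma E_jump_moment:
  assumes "chaos I lam p u"
  shows "E (jump_moment u) = 8 * real p * E (\<lambda>k. u k ^ 4) -
    6 * E (\<lambda>k. (u k)\<^sup>2 * number_op I lam (\<lambda>k. (u k)\<^sup>2) k)"
proof -
  note pu = poly_bounded_chaos [OF assms]
  have pb: "poly_bounded (\<lambda>k. u k * number_op I lam (\<lambda>k. u k ^ 3) k)"
    "poly_bounded (\<lambda>k. (u k)\<^sup>2 * number_op I lam (\<lambda>k. (u k)\<^sup>2) k)"
    "poly_bounded (\<lambda>k. u k ^ 3 * number_op I lam u k)"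
    "poly_bounded (number_op I lam (\<lambda>k. u k ^ 4))"
    by (intro poly_bounded_intros pu)+
  have "E (jump_moment u) = 4 * E (\<lambda>k. u k * number_op I lam (\<lambda>k. u k ^ 3) k)
    - 6 * E (\<lambda>k. (u k)\<^sup>2 * number_op I lam (\<lambda>k. (u k)\<^sup>2) k)
    + 4 * E (\<lambda>k. u k ^ 3 * number_op I lam u k) - E (number_op I lam (\<lambda>k. u k ^ 4))"
    unfolding jump_moment_eq
    using pb [THEN integrable_poly_bounded] by simp
  also have "E (number_op I lam (\<lambda>k. u k ^ 4)) = 0"
    by (intro E_number_op_zero poly_bounded_intros pu)
  also have "E (\<lambda>k. u k * number_op I lam (\<lambda>k. u k ^ 3) k) = E (\<lambda>k. number_op I lam u k * u k ^ 3)"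
    by (intro E_number_op_commute [symmetric] poly_bounded_intros pu)
  also have "\<dots> = real p * E (\<lambda>k. u k ^ 4)"
    by (simp add: number_op_chaos [OF assms finite_I] mult.assoc power_Suc [symmetric] flip: power_Suc)
  also have "E (\<lambda>k. u k ^ 3 * number_op I lam u k) = real p * E (\<lambda>k. u k ^ 4)"
  proof -
    have "u k ^ 3 * (real p * u k) = real p * u k ^ 4" for k by algebra
    then show ?thesis
      by (simp only: number_op_chaos [OF assms finite_I] integral_mult_right_zero)
  qed
  finally show ?thesis by simp
qed

text \<open>Split the square of \<open>u\<close> into its mean \<open>a\<close>, the Wick component
  of order \<open>2 * p\<close> and the rest. The cumulant is the squared norm of the rest plus the
  excess of the Wick norm over its lower bound \<open>2 * a\<^sup>2\<close>, and each estimate uses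
  one or both of these two nonnegative parts.\<close>

lemma fourth_cumulant_bounds:
  assumes "chaos I lam p u" "p > 0"
  defines "a \<equiv> E (\<lambda>k. (u k)\<^sup>2)"
  defines "\<kappa> \<equiv> E (\<lambda>k. u k ^ 4) - 3 * a\<^sup>2"
  shows "0 \<le> \<kappa>" and "E (\<lambda>k. (carre_du_champ u u k - real p * a)\<^sup>2) \<le> (real p)\<^sup>2 * \<kappa>"
    and "E (jump_moment u) \<le> 8 * real p * \<kappa>"
proof -
  note pu = poly_bounded_chaos [OF assms(1)]
  obtain w where w: "\<And>n. chaos I lam n (w n)" "\<And>k. u k * u k = (\<Sum>n<Suc (p + p). w n k)"
    "w (p + p) = wick (p + p) u u"
    "\<And>k. carre_du_champ u u k = (\<Sum>n<Suc (p + p). ((real (p + p) - real n) / 2) * w n k)"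
    "\<And>k. number_op I lam (\<lambda>k. u k * u k) k = (\<Sum>n<Suc (p + p). real n * w n k)"
    by (rule product_decomposition [OF assms(1) assms(1)]) blast
  let ?N = "\<lambda>n. E (\<lambda>k. (w n k)\<^sup>2)"
  obtain c where c: "w 0 = (\<lambda>_. c)" using chaos_0D [OF w(1) [of 0]] by blast
  have E_w: "E (w n) = 0" if "n > 0" for n
    using chaos_orthogonal [OF w(1) [of n] chaos_const [of I lam 1]] that by simp
  have "a = E (\<lambda>k. \<Sum>n<Suc (p + p). w n k)"
    by (simp add: a_def power2_eq_square w(2))
  also have "\<dots> = (\<Sum>n<Suc (p + p). E (w n))"
    by (intro E_sum poly_bounded_chaos [OF w(1)])
  also have "\<dots> = c"
    unfolding sum.lessThan_Suc_shift by (simp add: E_w c)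
  finally have ca: "c = a" by simp
  have N0: "?N 0 = a\<^sup>2" by (simp add: c ca)
  have Npos: "0 \<le> ?N n" for n by simp
  have split: "(\<Sum>n<Suc (p + p). F n) = F 0 + (\<Sum>n\<in>{0<..<p+p}. F n) + F (p + p)" for F :: "nat \<Rightarrow> real"
  proof -
    have "{..<Suc (p + p)} = insert 0 (insert (p + p) {0<..<p+p})" using assms(2) by auto
    then show ?thesis using assms(2) by simp
  qed
  define T where "T = (\<Sum>n\<in>{0<..<p+p}. ?N n)"
  have T0: "0 \<le> T" unfolding T_def by (intro sum_nonneg Npos)
  have "E (\<lambda>k. u k ^ 4) = E (\<lambda>k. (\<Sum>n<Suc (p + p). 1 * w n k) * (\<Sum>n<Suc (p + p). 1 * w n k))"
  proof -
    have "u k ^ 4 = (u k * u k) * (u k * u k)" for k by algebra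
    then show ?thesis by (simp only: w(2) mult_1)
  qed
  also have "\<dots> = (\<Sum>n<Suc (p + p). 1 * 1 * ?N n)" by (rule E_chaos_sums [OF w(1)])
  finally have m4: "E (\<lambda>k. u k ^ 4) = a\<^sup>2 + T + ?N (p + p)"
    by (simp only: split mult_1 N0 T_def)
  have top: "2 * a\<^sup>2 \<le> ?N (p + p)"
    using E_wick_self_square_ge [OF assms(1,2)] by (simp add: w(3) a_def)
  have T\<kappa>: "T \<le> \<kappa>" using m4 top by (simp add: \<kappa>_def)
  with T0 show "0 \<le> \<kappa>" by simp
  have g: "carre_du_champ u u k - real p * a =
    (\<Sum>n<Suc (p + p). (if n = 0 then 0 else (real (p + p) - real n) / 2) * w n k)" for k
    unfolding w(4) split by (simp add: c ca)
  have "E (\<lambda>k. (carre_du_champ u u k - real p * a)\<^sup>2) =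
    (\<Sum>n<Suc (p + p). (if n = 0 then 0 else (real (p + p) - real n) / 2) *
       (if n = 0 then 0 else (real (p + p) - real n) / 2) * ?N n)"
    unfolding g power2_eq_square by (rule E_chaos_sums [OF w(1), unfolded power2_eq_square])
  also have "\<dots> = (\<Sum>n\<in>{0<..<p+p}. ((real (p + p) - real n) / 2)\<^sup>2 * ?N n)"
    unfolding split by (simp add: power2_eq_square)
  also have "\<dots> \<le> (\<Sum>n\<in>{0<..<p+p}. (real p)\<^sup>2 * ?N n)"
    by (intro sum_mono mult_right_mono power_mono) auto
  also have "\<dots> = (real p)\<^sup>2 * T" by (simp only: T_def sum_distrib_left)
  also have "\<dots> \<le> (real p)\<^sup>2 * \<kappa>" using T\<kappa> by (intro mult_left_mono) auto
  finally show "E (\<lambda>k. (carre_du_champ u u k - real p * a)\<^sup>2) \<le> (real p)\<^sup>2 * \<kappa>" .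
  have "E (\<lambda>k. (u k)\<^sup>2 * number_op I lam (\<lambda>k. (u k)\<^sup>2) k) =
    E (\<lambda>k. (\<Sum>n<Suc (p + p). 1 * w n k) * (\<Sum>n<Suc (p + p). real n * w n k))"
    by (simp only: w(2) [symmetric] w(5) [symmetric] power2_eq_square mult_1)
  also have "\<dots> = (\<Sum>n<Suc (p + p). 1 * real n * ?N n)" by (rule E_chaos_sums [OF w(1)])
  \<comment> \<open>Only the Wick component is kept; its eigenvalue is \<open>2 * p\<close> and the
    other contributions are nonnegative.\<close>
  also have "\<dots> \<ge> 2 * real p * ?N (p + p)"
    unfolding split using sum_nonneg [of "{0<..<p+p}" "\<lambda>n. real n * ?N n"] by simp
  finally have "2 * real p * ?N (p + p) \<le> E (\<lambda>k. (u k)\<^sup>2 * number_op I lam (\<lambda>k. (u k)\<^sup>2) k)" .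
  then have "E (jump_moment u) \<le> 8 * real p * (a\<^sup>2 + T + ?N (p + p)) - 6 * (2 * real p * ?N (p + p))"
    unfolding E_jump_moment [OF assms(1)] m4 by simp
  also have "\<dots> = real p * (8 * a\<^sup>2 + 8 * T - 4 * ?N (p + p))"
    by (simp add: algebra_simps)
  \<comment> \<open>After \<kappa> is expanded the terms with \<open>T\<close> cancel, and what
    remains is 12 times the inequality \<open>top\<close>.\<close>
  also have "\<dots> \<le> real p * (8 * \<kappa>)"
    using top m4 by (intro mult_left_mono) (auto simp: \<kappa>_def)
  finally show "E (jump_moment u) \<le> 8 * real p * \<kappa>" by simp
qed

end

section \<open>Stein bound for a sum of two chaoses\<close>

lemma fourth_power_add_le: "(x + y) ^ 4 \<le> 8 * (x ^ 4 + y ^ 4)" for x y :: real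
proof -
  have "8 * (x ^ 4 + y ^ 4) - (x + y) ^ 4 = (x - y)\<^sup>2 * (2 * x\<^sup>2 + 2 * y\<^sup>2 + 5 * (x + y)\<^sup>2)"
    by algebra
  moreover have "0 \<le> (x - y)\<^sup>2 * (2 * x\<^sup>2 + 2 * y\<^sup>2 + 5 * (x + y)\<^sup>2)" by simp
  ultimately show ?thesis by linarith
qed

context poisson_counts
begin

lemma E_abs_le_sqrt:
  assumes "poly_bounded \<phi>"
  shows "E (\<lambda>k. \<bar>\<phi> k\<bar>) \<le> sqrt (E (\<lambda>k. (\<phi> k)\<^sup>2))"
proof (rule real_le_rsqrt)
  show "(E (\<lambda>k. \<bar>\<phi> k\<bar>))\<^sup>2 \<le> E (\<lambda>k. (\<phi> k)\<^sup>2)"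
    using E_square_le [of "\<lambda>k. \<bar>\<phi> k\<bar>"] poly_bounded_le [OF assms, of "\<lambda>k. \<bar>\<phi> k\<bar>"] by simp
qed

lemma jump_moment_add_le: "jump_moment (\<lambda>k. \<phi> k + \<psi> k) k \<le> 8 * (jump_moment \<phi> k + jump_moment \<psi> k)"
  unfolding jump_moment_def sum.distrib [symmetric] sum_distrib_left
proof (intro sum_mono)
  fix i assume i: "i \<in> I"
  have "lam i * diff_op i (\<lambda>k. \<phi> k + \<psi> k) k ^ 4 \<le> lam i * (8 * (diff_op i \<phi> k ^ 4 + diff_op i \<psi> k ^ 4))"
    unfolding diff_op_add using lam_nonneg [OF i] by (intro mult_left_mono fourth_power_add_le) auto
  moreover have "real (k i) * back_diff i (\<lambda>k. \<phi> k + \<psi> k) k ^ 4 \<le>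
      real (k i) * (8 * (back_diff i \<phi> k ^ 4 + back_diff i \<psi> k ^ 4))"
    using fourth_power_add_le [of "back_diff i \<phi> k" "back_diff i \<psi> k"]
    by (intro mult_left_mono) (auto simp: algebra_simps)
  ultimately show "lam i * diff_op i (\<lambda>k. \<phi> k + \<psi> k) k ^ 4 + real (k i) * back_diff i (\<lambda>k. \<phi> k + \<psi> k) k ^ 4
    \<le> 8 * (lam i * diff_op i \<phi> k ^ 4 + real (k i) * back_diff i \<phi> k ^ 4 +
        (lam i * diff_op i \<psi> k ^ 4 + real (k i) * back_diff i \<psi> k ^ 4))"
    by (simp add: algebra_simps)
qed

text \<open>At each jump the Taylor error is at most \<open>B\<close> times the jump of
  \<open>u\<close> times the squared jump of \<open>z\<close>. The inequality \<open>2 *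
  \<bar>d\<bar> * w\<^sup>2 \<le> \<theta> * w ^ 4 + d\<^sup>2 / \<theta>\<close> separates the two,
  and \<theta> stays free so that it can be balanced later. One half in \<open>B / 4\<close> comes
  from this inequality, the other from the definition of the carre du champ.\<close>

lemma carre_du_champ_chain_rule:
  assumes taylor: "\<And>x y. \<bar>h y - h x - h' x * (y - x)\<bar> \<le> B * (y - x)\<^sup>2"
    and "\<theta> > 0" "B \<ge> 0"
  shows "\<bar>carre_du_champ u (\<lambda>k. h (z k)) k - h' (z k) * carre_du_champ u z k\<bar> \<le>
    B / 4 * (\<theta> * jump_moment z k + 2 * carre_du_champ u u k / \<theta>)"
proof -
  have B: "\<bar>d * (h y - h x) - h' x * (d * (y - x))\<bar> \<le> B / 2 * (\<theta> * (y - x) ^ 4 + d * d / \<theta>)" for d x y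
  proof -
    have "\<bar>d * (h y - h x) - h' x * (d * (y - x))\<bar> = \<bar>d\<bar> * \<bar>h y - h x - h' x * (y - x)\<bar>"
      unfolding abs_mult [symmetric] by (simp add: algebra_simps)
    also have "\<dots> \<le> \<bar>d\<bar> * (B * (y - x)\<^sup>2)" by (intro mult_left_mono taylor) auto
    also have "\<dots> = B * (\<bar>d\<bar> * (y - x)\<^sup>2)" by simp
    also have "\<bar>d\<bar> * (y - x)\<^sup>2 \<le> (\<theta> * (y - x) ^ 4 + d * d / \<theta>) / 2"
    proof -
      have "0 \<le> (\<theta> * (y - x)\<^sup>2 - \<bar>d\<bar>)\<^sup>2" by simp
      also have "\<dots> = \<theta> * (\<theta> * (y - x) ^ 4) + d * d - 2 * (\<theta> * (\<bar>d\<bar> * (y - x)\<^sup>2))"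
        by (simp add: power2_eq_square power4_eq_xxxx algebra_simps)
      finally have "\<theta> * (2 * (\<bar>d\<bar> * (y - x)\<^sup>2)) \<le> \<theta> * (\<theta> * (y - x) ^ 4 + d * d / \<theta>)"
        using assms(2) by (simp add: distrib_left)
      with assms(2) show ?thesis by simp
    qed
    finally show ?thesis using assms(3) by (simp add: mult_left_mono)
  qed
  have "2 * \<bar>carre_du_champ u (\<lambda>k. h (z k)) k - h' (z k) * carre_du_champ u z k\<bar> =
    \<bar>\<Sum>i\<in>I. lam i * (diff_op i u k * diff_op i (\<lambda>k. h (z k)) k - h' (z k) * (diff_op i u k * diff_op i z k))
      + real (k i) * (back_diff i u k * back_diff i (\<lambda>k. h (z k)) k - h' (z k) * (back_diff i u k * back_diff i z k))\<bar>"
  proof -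
    have "2 * (carre_du_champ u (\<lambda>k. h (z k)) k - h' (z k) * carre_du_champ u z k) =
      (\<Sum>i\<in>I. lam i * (diff_op i u k * diff_op i (\<lambda>k. h (z k)) k - h' (z k) * (diff_op i u k * diff_op i z k))
      + real (k i) * (back_diff i u k * back_diff i (\<lambda>k. h (z k)) k - h' (z k) * (back_diff i u k * back_diff i z k)))"
    proof -
      have t: "2 * carre_du_champ \<phi> \<psi> k = (\<Sum>i\<in>I. lam i * (diff_op i \<phi> k * diff_op i \<psi> k)
        + real (k i) * (back_diff i \<phi> k * back_diff i \<psi> k))" for \<phi> \<psi>
        by (simp add: carre_du_champ_eq)
      have e: "2 * (x - y * w) = 2 * x - y * (2 * w)" for x y w :: real by algebra
      show ?thesis
        unfolding e t sum_distrib_left sum_subtractf [symmetric]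
        by (intro sum.cong refl) algebra
    qed
    then show ?thesis by (metis abs_mult abs_numeral)
  qed
  also have "\<dots> \<le> (\<Sum>i\<in>I. lam i * (B / 2 * (\<theta> * diff_op i z k ^ 4 + diff_op i u k * diff_op i u k / \<theta>))
      + real (k i) * (B / 2 * (\<theta> * back_diff i z k ^ 4 + back_diff i u k * back_diff i u k / \<theta>)))"
  proof (intro order_trans [OF sum_abs] sum_mono order_trans [OF abs_triangle_ineq] add_mono)
    fix i assume i: "i \<in> I"
    show "\<bar>lam i * (diff_op i u k * diff_op i (\<lambda>k. h (z k)) k - h' (z k) * (diff_op i u k * diff_op i z k))\<bar>
      \<le> lam i * (B / 2 * (\<theta> * diff_op i z k ^ 4 + diff_op i u k * diff_op i u k / \<theta>))"
      using B [of "diff_op i u k" "z (k(i := Suc (k i)))" "z k"] lam_nonneg [OF i]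
      unfolding diff_op_def abs_mult by (intro mult_mono) auto
    have e: "(z (k(i := k i - 1)) - z k) ^ 4 = back_diff i z k ^ 4" by algebra
    have "\<bar>- (back_diff i u k * (h (z (k(i := k i - 1))) - h (z k)) - h' (z k) * (back_diff i u k * (z (k(i := k i - 1)) - z k)))\<bar>
      \<le> B / 2 * (\<theta> * back_diff i z k ^ 4 + back_diff i u k * back_diff i u k / \<theta>)"
      unfolding abs_minus_cancel using B [of "back_diff i u k" "z (k(i := k i - 1))" "z k"] unfolding e .
    also have "- (back_diff i u k * (h (z (k(i := k i - 1))) - h (z k)) - h' (z k) * (back_diff i u k * (z (k(i := k i - 1)) - z k)))
      = back_diff i u k * back_diff i (\<lambda>k. h (z k)) k - h' (z k) * (back_diff i u k * back_diff i z k)"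
      by algebra
    finally show "\<bar>real (k i) * (back_diff i u k * back_diff i (\<lambda>k. h (z k)) k - h' (z k) * (back_diff i u k * back_diff i z k))\<bar>
      \<le> real (k i) * (B / 2 * (\<theta> * back_diff i z k ^ 4 + back_diff i u k * back_diff i u k / \<theta>))"
      unfolding abs_mult [of "real (k i)"] abs_of_nat by (rule mult_left_mono) simp
  qed
  also have "\<dots> = B / 2 * (\<theta> * jump_moment z k + 2 * carre_du_champ u u k / \<theta>)"
  proof -
    have "\<theta> * jump_moment z k + 2 * carre_du_champ u u k / \<theta> =
      (\<Sum>i\<in>I. lam i * (\<theta> * diff_op i z k ^ 4 + diff_op i u k * diff_op i u k / \<theta>)
       + real (k i) * (\<theta> * back_diff i z k ^ 4 + back_diff i u k * back_diff i u k / \<theta>))"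
    proof -
      have t: "2 * carre_du_champ u u k = (\<Sum>i\<in>I. lam i * (diff_op i u k * diff_op i u k)
        + real (k i) * (back_diff i u k * back_diff i u k))"
        by (simp add: carre_du_champ_eq)
      show ?thesis
        unfolding jump_moment_def t sum_distrib_left sum_divide_distrib sum.distrib [symmetric]
        using assms(2) by (intro sum.cong refl) (simp add: field_simps)
    qed
    then show ?thesis
      by (simp only: sum_distrib_left) (simp add: algebra_simps)
  qed
  finally show ?thesis by simp
qed

text \<open>Stein's equation fails for two reasons, estimated separately: the chain rule is only
  approximate, which gives the term with \<open>B2\<close>, and the quadratic expression
  \<open>?T\<close> that replaces \<open>s\<close> fluctuates, which gives the term with
  \<open>B1\<close>.\<close>

lemma stein_bound:
  fixes h h' :: "real \<Rightarrow> real"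
  assumes u: "chaos I lam p u" and v: "chaos I lam q v" and pq: "p > 0" "q > 0" "p \<noteq> q"
    and h0: "\<And>x. \<bar>h x\<bar> \<le> B0" and h1: "\<And>x. \<bar>h' x\<bar> \<le> B1"
    and taylor: "\<And>x y. \<bar>h y - h x - h' x * (y - x)\<bar> \<le> B2 * (y - x)\<^sup>2" and "B2 \<ge> 0"
    and \<theta>: "\<theta> > 0"
  defines "z \<equiv> \<lambda>k. u k + v k"
  defines "s \<equiv> E (\<lambda>k. (z k)\<^sup>2)"
  defines "\<kappa> \<equiv> E (\<lambda>k. z k ^ 4) - 3 * s\<^sup>2 - 4 * E (\<lambda>k. u k ^ 3 * v k) - 4 * E (\<lambda>k. u k * v k ^ 3)"
  shows "0 \<le> \<kappa>"
    and "\<bar>E (\<lambda>k. z k * h (z k)) - s * E (\<lambda>k. h' (z k))\<bar> \<le>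
      B1 * (2 + real (p + q)) * sqrt \<kappa> + B2 / 2 * (64 * real (p + q) * \<kappa> * \<theta> + s / \<theta>)"
proof -
  note pu = poly_bounded_chaos [OF u] and pv = poly_bounded_chaos [OF v]
  have pz: "poly_bounded z" unfolding z_def by (intro poly_bounded_intros pu pv)
  define a where "a = E (\<lambda>k. (u k)\<^sup>2)"
  define b where "b = E (\<lambda>k. (v k)\<^sup>2)"
  have ab: "0 \<le> a" "0 \<le> b" by (simp_all add: a_def b_def)
  have uv0: "E (\<lambda>k. u k * v k) = 0" by (rule chaos_orthogonal [OF u v pq(3)])
  have "s = E (\<lambda>k. (u k)\<^sup>2 + (v k)\<^sup>2 + 2 * (u k * v k))"
    by (simp add: s_def z_def power2_sum mult.assoc)
  also have "\<dots> = a + b + 2 * E (\<lambda>k. u k * v k)"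
    unfolding a_def b_def
    by (subst E_add, intro poly_bounded_intros pu pv, intro poly_bounded_intros pu pv,
        subst E_add) (auto intro!: poly_bounded_intros pu pv)
  finally have s: "s = a + b" using uv0 by simp
  define ku where "ku = E (\<lambda>k. u k ^ 4) - 3 * a\<^sup>2"
  define kv where "kv = E (\<lambda>k. v k ^ 4) - 3 * b\<^sup>2"
  define c where "c = E (\<lambda>k. (u k)\<^sup>2 * (v k)\<^sup>2) - a * b"
  note bu = fourth_cumulant_bounds [OF u pq(1), folded a_def, folded ku_def]
  note bv = fourth_cumulant_bounds [OF v pq(2), folded b_def, folded kv_def]
  note bc = E_carre_du_champ_square_le [OF u v, folded a_def b_def, folded c_def]
  have c0: "0 \<le> c" using bc(2) by (simp add: c_def)
  have "E (\<lambda>k. z k ^ 4) = E (\<lambda>k. u k ^ 4 + v k ^ 4 + 6 * ((u k)\<^sup>2 * (v k)\<^sup>2) + 4 * (u k ^ 3 * v k) + 4 * (u k * v k ^ 3))"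
  proof (intro arg_cong [where f = E] ext)
    show "z k ^ 4 = u k ^ 4 + v k ^ 4 + 6 * ((u k)\<^sup>2 * (v k)\<^sup>2) + 4 * (u k ^ 3 * v k) + 4 * (u k * v k ^ 3)" for k
      unfolding z_def by algebra
  qed
  also have "\<dots> = E (\<lambda>k. u k ^ 4) + E (\<lambda>k. v k ^ 4) + 6 * E (\<lambda>k. (u k)\<^sup>2 * (v k)\<^sup>2)
      + 4 * E (\<lambda>k. u k ^ 3 * v k) + 4 * E (\<lambda>k. u k * v k ^ 3)"
  proof -
    have i: "integrable (measure_pmf Q) (\<lambda>k. u k ^ 4)" "integrable (measure_pmf Q) (\<lambda>k. v k ^ 4)"
      "integrable (measure_pmf Q) (\<lambda>k. (u k)\<^sup>2 * (v k)\<^sup>2)" "integrable (measure_pmf Q) (\<lambda>k. u k ^ 3 * v k)"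
      "integrable (measure_pmf Q) (\<lambda>k. u k * v k ^ 3)"
      by (intro integrable_poly_bounded poly_bounded_intros pu pv)+
    then show ?thesis by simp
  qed
  \<comment> \<open>Since \<open>s = a + b\<close>, the square in \<open>3 * s\<^sup>2\<close>
    produces exactly the \<open>6 * a * b\<close> that turns the mixed moment into a
    covariance.\<close>
  finally have \<kappa>: "\<kappa> = ku + kv + 6 * c"
    by (simp add: \<kappa>_def ku_def kv_def c_def s power2_eq_square algebra_simps)
  show \<kappa>0: "0 \<le> \<kappa>" using bu(1) bv(1) c0 by (simp add: \<kappa>)
  have le\<kappa>: "ku \<le> \<kappa>" "kv \<le> \<kappa>" "c \<le> \<kappa>" using bu(1) bv(1) c0 by (auto simp: \<kappa>)
  have ph: "poly_bounded (\<lambda>k. h (z k))"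
    by (rule poly_boundedI [of "\<bar>B0\<bar>" _ 0]) (auto intro: order_trans [OF h0])
  have ph': "poly_bounded (\<lambda>k. h' (z k))"
    by (rule poly_boundedI [of "\<bar>B1\<bar>" _ 0]) (auto intro: order_trans [OF h1])
  have B1: "0 \<le> B1" using h1 [of 0] by linarith
  \<comment> \<open>The constant 64 is a product of two factors 8: one from the fourth power of a
    sum, one from \<open>fourth_cumulant_bounds\<close>.\<close>
  have "E (jump_moment z) \<le> E (\<lambda>k. 8 * (jump_moment u k + jump_moment v k))"
    unfolding z_def
    by (rule E_mono [OF _ _ jump_moment_add_le])
      (intro poly_bounded_scale poly_bounded_add poly_bounded_jump_moment pu pv)+
  also have "\<dots> = 8 * (E (jump_moment u) + E (jump_moment v))"
    unfolding integral_mult_right_zero by (simp only: E_add poly_bounded_jump_moment pu pv)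
  also have "\<dots> \<le> 8 * (8 * real p * \<kappa> + 8 * real q * \<kappa>)"
    using bu(3) bv(3) le\<kappa> mult_left_mono [OF le\<kappa>(1), of "8 * real p"]
      mult_left_mono [OF le\<kappa>(2), of "8 * real q"] by simp
  finally have jz: "E (jump_moment z) \<le> 64 * real (p + q) * \<kappa>" by (simp add: algebra_simps)
  have jz0: "0 \<le> E (jump_moment z)"
    unfolding jump_moment_def [abs_def] using lam_nonneg
    by (intro Bochner_Integration.integral_nonneg sum_nonneg add_nonneg_nonneg mult_nonneg_nonneg) auto
  have chain: "\<bar>E (\<lambda>k. w k * h (z k)) - E (\<lambda>k. h' (z k) * (carre_du_champ w z k / real m))\<bar> \<le>
      B2 / 4 * (\<theta> * (64 * real (p + q) * \<kappa>) + 2 * E (\<lambda>k. (w k)\<^sup>2) / \<theta>)"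
    if w: "chaos I lam m w" and m: "m > 0" for m w
  proof -
    note pw = poly_bounded_chaos [OF w]
    have pcz: "poly_bounded (carre_du_champ w z)" and pcw: "poly_bounded (carre_du_champ w w)"
      and pch: "poly_bounded (carre_du_champ w (\<lambda>k. h (z k)))"
      by (intro poly_bounded_carre_du_champ pw pz ph)+
    have "real m * (E (\<lambda>k. w k * h (z k)) - E (\<lambda>k. h' (z k) * (carre_du_champ w z k / real m))) =
      E (carre_du_champ w (\<lambda>k. h (z k))) - E (\<lambda>k. h' (z k) * carre_du_champ w z k)"
      using m by (simp add: right_diff_distrib E_carre_du_champ [OF w ph])
    also have "\<dots> = E (\<lambda>k. carre_du_champ w (\<lambda>k. h (z k)) k - h' (z k) * carre_du_champ w z k)"
      by (rule E_diff [symmetric]) (intro pch poly_bounded_mult ph' pcz)+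
    also have "\<bar>\<dots>\<bar> \<le> E (\<lambda>k. \<bar>carre_du_champ w (\<lambda>k. h (z k)) k - h' (z k) * carre_du_champ w z k\<bar>)"
      by (rule integral_abs_bound)
    also have "\<dots> \<le> E (\<lambda>k. B2 / 4 * (\<theta> * jump_moment z k + 2 / \<theta> * carre_du_champ w w k))"
    proof (rule E_mono)
      show "poly_bounded (\<lambda>k. \<bar>carre_du_champ w (\<lambda>k. h (z k)) k - h' (z k) * carre_du_champ w z k\<bar>)"
        by (rule poly_bounded_le [OF poly_bounded_diff [OF pch poly_bounded_mult [OF ph' pcz]]]) simp
      show "poly_bounded (\<lambda>k. B2 / 4 * (\<theta> * jump_moment z k + 2 / \<theta> * carre_du_champ w w k))"
        by (intro poly_bounded_scale poly_bounded_add poly_bounded_jump_moment pz pcw)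
      show "\<bar>carre_du_champ w (\<lambda>k. h (z k)) k - h' (z k) * carre_du_champ w z k\<bar>
        \<le> B2 / 4 * (\<theta> * jump_moment z k + 2 / \<theta> * carre_du_champ w w k)" for k
        using carre_du_champ_chain_rule [OF taylor \<theta> \<open>B2 \<ge> 0\<close>, of w z k] by simp
    qed
    also have "\<dots> = B2 / 4 * (\<theta> * E (jump_moment z) + 2 / \<theta> * (real m * E (\<lambda>k. (w k)\<^sup>2)))"
      unfolding integral_mult_right_zero power2_eq_square
        E_add [OF poly_bounded_scale [OF poly_bounded_jump_moment [OF pz]] poly_bounded_scale [OF pcw]]
        E_carre_du_champ [OF w pw] ..
    \<comment> \<open>The jump term is enlarged by \<open>m \<ge> 1\<close> so that dividing by
      \<open>m\<close> leaves a bound of the same shape for both chaoses.\<close>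
    also have "\<dots> \<le> B2 / 4 * (real m * (\<theta> * (64 * real (p + q) * \<kappa>)) + 2 / \<theta> * (real m * E (\<lambda>k. (w k)\<^sup>2)))"
    proof (intro mult_left_mono add_right_mono)
      have "\<theta> * E (jump_moment z) \<le> 1 * (\<theta> * (64 * real (p + q) * \<kappa>))"
        using jz \<theta> by simp
      also have "\<dots> \<le> real m * (\<theta> * (64 * real (p + q) * \<kappa>))"
        using m \<theta> \<kappa>0 by (intro mult_right_mono mult_nonneg_nonneg) auto
      finally show "\<theta> * E (jump_moment z) \<le> real m * (\<theta> * (64 * real (p + q) * \<kappa>))" .
    qed (use \<open>B2 \<ge> 0\<close> in auto)
    also have "\<dots> = real m * (B2 / 4 * (\<theta> * (64 * real (p + q) * \<kappa>) + 2 * E (\<lambda>k. (w k)\<^sup>2) / \<theta>))"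
      by (simp add: algebra_simps)
    finally show ?thesis using m by (simp add: abs_mult)
  qed
  \<comment> \<open>This plays the role of a Stein kernel of \<open>z\<close>, up to the chain rule
    error. Its mean is \<open>s\<close>, because \<open>u\<close> and \<open>v\<close> are
    orthogonal.\<close>
  let ?T = "\<lambda>k. carre_du_champ u z k / real p + carre_du_champ v z k / real q"
  have pT: "poly_bounded (\<lambda>k. carre_du_champ u z k / real p)" "poly_bounded (\<lambda>k. carre_du_champ v z k / real q)"
    unfolding divide_inverse by (intro poly_bounded_mult poly_bounded_const poly_bounded_carre_du_champ pu pv pz)+
  let ?R = "B2 / 2 * (64 * real (p + q) * \<kappa> * \<theta> + s / \<theta>)"
  have 1: "\<bar>E (\<lambda>k. z k * h (z k)) - E (\<lambda>k. h' (z k) * ?T k)\<bar> \<le> ?R"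
  proof -
    have "E (\<lambda>k. z k * h (z k)) = E (\<lambda>k. u k * h (z k)) + E (\<lambda>k. v k * h (z k))"
      unfolding z_def distrib_right by (intro E_add poly_bounded_mult pu pv ph [unfolded z_def])
    moreover have "E (\<lambda>k. h' (z k) * ?T k) = E (\<lambda>k. h' (z k) * (carre_du_champ u z k / real p)) +
       E (\<lambda>k. h' (z k) * (carre_du_champ v z k / real q))"
      unfolding distrib_left by (intro E_add poly_bounded_mult ph' pT)
    ultimately have "\<bar>E (\<lambda>k. z k * h (z k)) - E (\<lambda>k. h' (z k) * ?T k)\<bar> \<le>
      B2 / 4 * (\<theta> * (64 * real (p + q) * \<kappa>) + 2 * a / \<theta>) + B2 / 4 * (\<theta> * (64 * real (p + q) * \<kappa>) + 2 * b / \<theta>)"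
      using chain [OF u pq(1)] chain [OF v pq(2)] unfolding a_def b_def by linarith
    also have "\<dots> = ?R"
      by (simp add: s add_divide_distrib algebra_simps)
    finally show ?thesis .
  qed
  have 2: "\<bar>E (\<lambda>k. h' (z k) * ?T k) - s * E (\<lambda>k. h' (z k))\<bar> \<le> B1 * (2 + real (p + q)) * sqrt \<kappa>"
  proof -
    let ?du = "\<lambda>k. carre_du_champ u u k - real p * a" and ?dv = "\<lambda>k. carre_du_champ v v k - real q * b"
    let ?d = "carre_du_champ u v"
    have pd: "poly_bounded ?du" "poly_bounded ?dv" "poly_bounded ?d"
      by (intro poly_bounded_diff poly_bounded_const poly_bounded_carre_du_champ pu pv)+
    have pd': "poly_bounded (\<lambda>k. \<bar>?du k\<bar>)" "poly_bounded (\<lambda>k. \<bar>?dv k\<bar>)" "poly_bounded (\<lambda>k. \<bar>?d k\<bar>)"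
      by (rule poly_bounded_le [OF pd(1)] poly_bounded_le [OF pd(2)] poly_bounded_le [OF pd(3)]; simp)+
    have T: "?T k - s = ?du k / real p + ?dv k / real q + (1 / real p + 1 / real q) * ?d k" for k
      using pq unfolding z_def carre_du_champ_add_right s carre_du_champ_commute [of v u]
      by (simp add: field_simps)
    have "1 / real p \<le> 1" "1 / real q \<le> 1" using pq by (auto simp: field_simps)
    then have inv: "1 / real p + 1 / real q \<le> 2" by linarith
    have eq: "E (\<lambda>k. h' (z k) * ?T k) - s * E (\<lambda>k. h' (z k)) = E (\<lambda>k. h' (z k) * (?T k - s))"
      unfolding right_diff_distrib
      by (subst E_diff) (auto intro!: poly_bounded_mult poly_bounded_add poly_bounded_const ph' pT simp: mult.commute)
    have "\<bar>E (\<lambda>k. h' (z k) * ?T k) - s * E (\<lambda>k. h' (z k))\<bar> \<le> E (\<lambda>k. \<bar>h' (z k) * (?T k - s)\<bar>)"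
      unfolding eq by (rule integral_abs_bound)
    also have "\<dots> \<le> E (\<lambda>k. B1 * (1 / real p * \<bar>?du k\<bar> + 1 / real q * \<bar>?dv k\<bar> + 2 * \<bar>?d k\<bar>))"
    proof (rule E_mono)
      have "poly_bounded (\<lambda>k. ?T k - s)"
        by (rule poly_bounded_diff [OF poly_bounded_add [OF pT] poly_bounded_const])
      with ph' have "poly_bounded (\<lambda>k. h' (z k) * (?T k - s))"
        by (rule poly_bounded_mult)
      then show "poly_bounded (\<lambda>k. \<bar>h' (z k) * (?T k - s)\<bar>)"
        by (rule poly_bounded_le) simp
      show "poly_bounded (\<lambda>k. B1 * (1 / real p * \<bar>?du k\<bar> + 1 / real q * \<bar>?dv k\<bar> + 2 * \<bar>?d k\<bar>))"
        by (intro poly_bounded_mult poly_bounded_add poly_bounded_const pd')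
      fix k
      have tri: "\<bar>x + y + w\<bar> \<le> \<bar>x\<bar> + \<bar>y\<bar> + \<bar>w\<bar>" for x y w :: real by linarith
      have "\<bar>?T k - s\<bar> \<le> \<bar>?du k / real p\<bar> + \<bar>?dv k / real q\<bar> + \<bar>(1 / real p + 1 / real q) * ?d k\<bar>"
        unfolding T by (rule tri)
      also have "\<bar>(1 / real p + 1 / real q) * ?d k\<bar> \<le> 2 * \<bar>?d k\<bar>"
        unfolding abs_mult using inv by (intro mult_right_mono) auto
      finally have "\<bar>?T k - s\<bar> \<le> 1 / real p * \<bar>?du k\<bar> + 1 / real q * \<bar>?dv k\<bar> + 2 * \<bar>?d k\<bar>"
        by (simp add: abs_divide)
      then show "\<bar>h' (z k) * (?T k - s)\<bar> \<le> B1 * (1 / real p * \<bar>?du k\<bar> + 1 / real q * \<bar>?dv k\<bar> + 2 * \<bar>?d k\<bar>)"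
        unfolding abs_mult by (intro mult_mono h1) (auto simp: B1)
    qed
    also have "\<dots> = B1 * (1 / real p * E (\<lambda>k. \<bar>?du k\<bar>) + 1 / real q * E (\<lambda>k. \<bar>?dv k\<bar>) + 2 * E (\<lambda>k. \<bar>?d k\<bar>))"
      using pd' [THEN integrable_poly_bounded] by simp
    \<comment> \<open>The factors \<open>1 / p\<close> and \<open>1 / q\<close> cancel the orders in
      the two variance bounds, giving one \<open>sqrt \<kappa>\<close> each; twice the bound
      \<open>(p + q) / 2\<close> for the mixed term gives the last summand.\<close>
    also have "\<dots> \<le> B1 * (sqrt \<kappa> + sqrt \<kappa> + real (p + q) * sqrt \<kappa>)"
    proof (intro mult_left_mono add_mono B1)
      have "E (\<lambda>k. \<bar>?du k\<bar>) \<le> sqrt ((real p)\<^sup>2 * \<kappa>)"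
        by (rule order_trans [OF E_abs_le_sqrt [OF pd(1)]], rule real_sqrt_le_mono,
            rule order_trans [OF bu(2)]) (use le\<kappa> in \<open>simp add: mult_left_mono\<close>)
      then show "1 / real p * E (\<lambda>k. \<bar>?du k\<bar>) \<le> sqrt \<kappa>"
        using pq by (simp add: real_sqrt_mult field_simps)
      have "E (\<lambda>k. \<bar>?dv k\<bar>) \<le> sqrt ((real q)\<^sup>2 * \<kappa>)"
        by (rule order_trans [OF E_abs_le_sqrt [OF pd(2)]], rule real_sqrt_le_mono,
            rule order_trans [OF bv(2)]) (use le\<kappa> in \<open>simp add: mult_left_mono\<close>)
      then show "1 / real q * E (\<lambda>k. \<bar>?dv k\<bar>) \<le> sqrt \<kappa>"
        using pq by (simp add: real_sqrt_mult field_simps)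
      have "E (\<lambda>k. \<bar>?d k\<bar>) \<le> sqrt ((real (p + q) / 2)\<^sup>2 * \<kappa>)"
        by (rule order_trans [OF E_abs_le_sqrt [OF pd(3)]], rule real_sqrt_le_mono,
            rule order_trans [OF bc(1)]) (use le\<kappa> in \<open>intro mult_left_mono, auto\<close>)
      then show "2 * E (\<lambda>k. \<bar>?d k\<bar>) \<le> real (p + q) * sqrt \<kappa>"
        by (simp add: real_sqrt_mult)
    qed
    finally show ?thesis by (simp add: algebra_simps)
  qed
  show "\<bar>E (\<lambda>k. z k * h (z k)) - s * E (\<lambda>k. h' (z k))\<bar> \<le> B1 * (2 + real (p + q)) * sqrt \<kappa> + ?R"
    using 1 2 by linarith
qed

section \<open>Changing the partition\<close>

text \<open>Difference operators lower the order and are adjoint to creation operators, so a weak limit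
  can be found by induction on the order, without completeness of \<open>L\<^sup>2\<close>.\<close>

lemma chaos_weak_limit:
  assumes "\<And>l. chaos I lam n (u l)"
    and "\<And>\<psi>. poly_bounded \<psi> \<Longrightarrow> convergent (\<lambda>l. E (\<lambda>k. u l k * \<psi> k))"
  shows "\<exists>v. chaos I lam n v \<and>
    (\<forall>\<psi>. poly_bounded \<psi> \<longrightarrow> (\<lambda>l. E (\<lambda>k. u l k * \<psi> k)) \<longlonglongrightarrow> E (\<lambda>k. v k * \<psi> k))"
  using assms
proof (induction n arbitrary: u)
  case 0
  define c where "c l = u l (\<lambda>_. 0)" for l
  have u: "u l = (\<lambda>_. c l)" for l
    using chaos_0D [OF 0(1) [of l] refl] by (auto simp: c_def)
  have "convergent c"
    using 0(2) [OF poly_bounded_const [of 1]] by (simp add: u)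
  then obtain c' where "c \<longlonglongrightarrow> c'" by (auto simp: convergent_def)
  then have "(\<lambda>l. E (\<lambda>k. u l k * \<psi> k)) \<longlonglongrightarrow> E (\<lambda>k. c' * \<psi> k)" for \<psi>
    by (simp add: u tendsto_mult_right)
  then show ?case
    by (intro exI [of _ "\<lambda>_. c'"]) (auto intro: chaos_const)
next
  case (Suc n)
  have pu: "poly_bounded (u l)" for l by (rule poly_bounded_chaos [OF Suc.prems(1)])
  have "\<exists>d. chaos I lam n d \<and> (\<forall>\<psi>. poly_bounded \<psi> \<longrightarrow>
     (\<lambda>l. lam i * E (\<lambda>k. diff_op i (u l) k * \<psi> k)) \<longlonglongrightarrow> lam i * E (\<lambda>k. d k * \<psi> k))"
    if i: "i \<in> I" for i
  \<comment> \<open>Integration by parts cannot recover the difference in a cell of zero mass, but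
    such a cell has weight zero in the energy identity, so the witness 0 suffices.\<close>
  proof (cases "lam i = 0")
    case True
    then show ?thesis by (intro exI [of _ "\<lambda>_. 0"]) (simp add: chaos_zero)
  next
    case False
    have e: "E (\<lambda>k. diff_op i (u l) k * \<psi> k) = E (\<lambda>k. u l k * create_op lam i \<psi> k) / lam i"
      if "poly_bounded \<psi>" for \<psi> l
      using E_create_op [OF i that pu] False by (simp add: mult.commute)
    have "\<exists>d. chaos I lam n d \<and> (\<forall>\<psi>. poly_bounded \<psi> \<longrightarrow>
        (\<lambda>l. E (\<lambda>k. diff_op i (u l) k * \<psi> k)) \<longlonglongrightarrow> E (\<lambda>k. d k * \<psi> k))"
    proof (rule Suc.IH)
      show "chaos I lam n (diff_op i (u l))" for l by (rule chaos_Suc_diff_op [OF Suc.prems(1) i])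
      fix \<psi> assume \<psi>: "poly_bounded \<psi>"
      have "convergent (\<lambda>l. E (\<lambda>k. u l k * create_op lam i \<psi> k))"
        by (intro Suc.prems(2) poly_bounded_create_op \<psi> i)
      then obtain L where "(\<lambda>l. E (\<lambda>k. u l k * create_op lam i \<psi> k)) \<longlonglongrightarrow> L"
        by (auto simp: convergent_def)
      then have "(\<lambda>l. E (\<lambda>k. u l k * create_op lam i \<psi> k) / lam i) \<longlonglongrightarrow> L / lam i"
        by (intro tendsto_intros False)
      then show "convergent (\<lambda>l. E (\<lambda>k. diff_op i (u l) k * \<psi> k))"
        unfolding e [OF \<psi>] by (auto simp: convergent_def)
    qed
    then show ?thesis by (auto intro!: tendsto_mult_left)
  qed
  then have "\<forall>i\<in>I. \<exists>d. chaos I lam n d \<and> (\<forall>\<psi>. poly_bounded \<psi> \<longrightarrow>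
     (\<lambda>l. lam i * E (\<lambda>k. diff_op i (u l) k * \<psi> k)) \<longlonglongrightarrow> lam i * E (\<lambda>k. d k * \<psi> k))"
    by blast
  from bchoice [OF this] obtain d where d: "\<And>i. i \<in> I \<Longrightarrow> chaos I lam n (d i)"
    "\<And>i \<psi>. i \<in> I \<Longrightarrow> poly_bounded \<psi> \<Longrightarrow>
     (\<lambda>l. lam i * E (\<lambda>k. diff_op i (u l) k * \<psi> k)) \<longlonglongrightarrow> lam i * E (\<lambda>k. d i k * \<psi> k)"
    by blast
  \<comment> \<open>On a chaos of order \<open>Suc n\<close> the number operator is
    \<open>Suc n\<close>, so a function is recovered from its differences by creating them again and
    dividing.\<close>
  define v where "v k = 1 / real (Suc n) * (\<Sum>i\<in>I. create_op lam i (d i) k)" for k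
  have "chaos I lam (Suc n) v"
    unfolding v_def [abs_def] by (intro chaos_scale chaos_sum chaos_create d)
  moreover have "(\<lambda>l. E (\<lambda>k. u l k * \<psi> k)) \<longlonglongrightarrow> E (\<lambda>k. v k * \<psi> k)" if \<psi>: "poly_bounded \<psi>" for \<psi>
  proof -
    have pd: "poly_bounded (d i)" if "i \<in> I" for i by (rule poly_bounded_chaos [OF d(1) [OF that]])
    have 1: "E (\<lambda>k. u l k * \<psi> k) =
      1 / real (Suc n) * (\<Sum>i\<in>I. lam i * E (\<lambda>k. diff_op i (u l) k * diff_op i \<psi> k))" for l
      using E_chaos_number [OF Suc.prems(1) \<psi>, of l] by (simp add: field_simps del: of_nat_Suc)
    have "E (\<lambda>k. v k * \<psi> k) = 1 / real (Suc n) * E (\<lambda>k. \<Sum>i\<in>I. create_op lam i (d i) k * \<psi> k)"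
      unfolding v_def by (simp add: sum_distrib_right flip: integral_mult_right_zero)
    also have "E (\<lambda>k. \<Sum>i\<in>I. create_op lam i (d i) k * \<psi> k) =
        (\<Sum>i\<in>I. lam i * E (\<lambda>k. d i k * diff_op i \<psi> k))"
      by (subst E_sum) (auto intro!: poly_bounded_mult poly_bounded_create_op pd \<psi> sum.cong E_create_op)
    finally have 2: "E (\<lambda>k. v k * \<psi> k) = 1 / real (Suc n) * (\<Sum>i\<in>I. lam i * E (\<lambda>k. d i k * diff_op i \<psi> k))" .
    show ?thesis unfolding 1 2
      by (intro tendsto_mult_left tendsto_sum d(2) poly_bounded_diff_op \<psi>)
  qed
  ultimately show ?case by blast
qed

end

section \<open>Merging cells and projecting onto the merged counts\<close>

locale block_map =
  fixes I :: "'i set" and J :: "'j set" and S :: "'j \<Rightarrow> 'i set"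
  assumes finite_I: "finite I" and finite_J: "finite J"
    and block_subset: "j \<in> J \<Longrightarrow> S j \<subseteq> I"
    and disjoint_blocks: "disjoint_family_on S J"
begin

text \<open>The value 0 outside \<open>J\<close> matches \<open>cell_counts\<close>, so that merged
  fine counts and coarse counts can agree as functions.\<close>

definition merge_counts :: "('i \<Rightarrow> nat) \<Rightarrow> 'j \<Rightarrow> nat" where
  "merge_counts k = (\<lambda>j. if j \<in> J then \<Sum>i\<in>S j. k i else 0)"

lemma finite_block: "j \<in> J \<Longrightarrow> finite (S j)"
  using block_subset finite_I finite_subset by blast

lemma merge_counts_Suc:
  assumes "j \<in> J" "i \<in> S j"
  shows "merge_counts (k(i := Suc (k i))) = (merge_counts k)(j := Suc (merge_counts k j))"
proof
  fix l
  have "(\<Sum>a\<in>S l. (k(i := Suc (k i))) a) = (\<Sum>a\<in>S l. k a + (if a = i then 1 else 0))"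
    by (intro sum.cong) auto
  moreover have "l \<in> J \<Longrightarrow> i \<in> S l \<longleftrightarrow> l = j"
    using assms disjoint_blocks by (auto simp: disjoint_family_on_def)
  ultimately show "merge_counts (k(i := Suc (k i))) l = ((merge_counts k)(j := Suc (merge_counts k j))) l"
    using assms finite_block by (auto simp: merge_counts_def sum.distrib)
qed

lemma merge_counts_Suc_outside:
  assumes "\<And>j. j \<in> J \<Longrightarrow> i \<notin> S j"
  shows "merge_counts (k(i := Suc (k i))) = merge_counts k"
  unfolding merge_counts_def using assms by (intro ext if_cong sum.cong) auto

lemma merge_counts_pred:
  assumes "j \<in> J" "i \<in> S j" "k i > 0"
  shows "merge_counts (k(i := k i - 1)) = (merge_counts k)(j := merge_counts k j - 1)"
proof -
  have "merge_counts k = merge_counts ((k(i := k i - 1))(i := Suc ((k(i := k i - 1)) i)))"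
    using assms(3) by (intro arg_cong [where f = merge_counts]) auto
  also have "\<dots> = (merge_counts (k(i := k i - 1)))(j := Suc (merge_counts (k(i := k i - 1)) j))"
    by (rule merge_counts_Suc [OF assms(1,2)])
  finally show ?thesis by simp
qed

text \<open>Creation in a coarse cell pulls back to the sum of the creations in the cells of its
  block: deleting any point of the block has the same effect on the merged count, and intensities
  add.\<close>

lemma chaos_merge_counts:
  assumes "chaos J mu n \<phi>" and mu: "\<And>j. j \<in> J \<Longrightarrow> mu j = (\<Sum>i\<in>S j. lam i)"
  shows "chaos I lam n (\<lambda>k. \<phi> (merge_counts k))"
  using assms(1)
proof (induction rule: chaos.induct)
  case (chaos_create n \<phi> j)
  have "create_op mu j \<phi> (merge_counts k) = (\<Sum>i\<in>S j. create_op lam i (\<lambda>k. \<phi> (merge_counts k)) k)" for k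
  proof -
    have "(\<Sum>i\<in>S j. create_op lam i (\<lambda>k. \<phi> (merge_counts k)) k) =
      (\<Sum>i\<in>S j. real (k i) * \<phi> ((merge_counts k)(j := merge_counts k j - 1)) - lam i * \<phi> (merge_counts k))"
    proof (intro sum.cong refl)
      fix i assume "i \<in> S j"
      then show "create_op lam i (\<lambda>k. \<phi> (merge_counts k)) k =
        real (k i) * \<phi> ((merge_counts k)(j := merge_counts k j - 1)) - lam i * \<phi> (merge_counts k)"
        using merge_counts_pred [OF chaos_create(2), of i k] by (cases "k i = 0") (auto simp: create_op_def)
    qed
    also have "\<dots> = create_op mu j \<phi> (merge_counts k)"
      using chaos_create(2) mu
      by (simp add: sum_subtractf create_op_def merge_counts_def flip: sum_distrib_right)
    finally show ?thesis by simp
  qed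
  then show ?case
    using chaos_create block_subset by (auto intro!: chaos_sum chaos.chaos_create)
qed (auto intro: chaos.intros)

end

locale poisson_coarsening = fine: poisson_counts I lam Q + coarse: poisson_counts J mu R +
    block_map I J S
  for I :: "'i set" and lam Q and J :: "'j set" and mu R and S :: "'j \<Rightarrow> 'i set" +
  assumes mu: "j \<in> J \<Longrightarrow> mu j = (\<Sum>i\<in>S j. lam i)"
    and R_eq: "R = map_pmf merge_counts Q"
begin

lemma poly_bounded_merge_counts:
  assumes "coarse.poly_bounded \<psi>"
  shows "fine.poly_bounded (\<lambda>k. \<psi> (merge_counts k))"
proof -
  obtain C d where c: "C \<ge> 0" "\<And>k. \<bar>\<psi> k\<bar> \<le> C * (1 + real (coarse.total k)) ^ d"
    using assms unfolding coarse.poly_bounded_def by blast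
  have le: "coarse.total (merge_counts k) \<le> fine.total k" for k
  proof -
    have "coarse.total (merge_counts k) = (\<Sum>j\<in>J. \<Sum>i\<in>S j. k i)"
      by (simp add: coarse.total_def merge_counts_def)
    also have "\<dots> = (\<Sum>i\<in>(\<Union>j\<in>J. S j). k i)"
      using finite_block finite_J disjoint_blocks
      by (intro sum.UNION_disjoint [symmetric]) (auto simp: disjoint_family_on_def)
    also have "\<dots> \<le> fine.total k"
      unfolding fine.total_def using block_subset finite_I by (intro sum_mono2) auto
    finally show ?thesis .
  qed
  show ?thesis
  proof (rule fine.poly_boundedI [OF c(1)])
    fix k
    have "C * (1 + real (coarse.total (merge_counts k))) ^ d \<le> C * (1 + real (fine.total k)) ^ d"
      using c(1) le by (intro mult_left_mono power_mono) auto
    with c(2) [of "merge_counts k"] show "\<bar>\<psi> (merge_counts k)\<bar> \<le> C * (1 + real (fine.total k)) ^ d"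
      by linarith
  qed
qed

text \<open>\<open>v\<close> is the conditional expectation of \<open>u\<close> given the merged counts.\<close>

lemma chaos_projection:
  assumes "chaos I lam n u"
  shows "\<exists>v. chaos J mu n v \<and> (\<forall>\<psi>. coarse.poly_bounded \<psi> \<longrightarrow>
    fine.E (\<lambda>k. u k * \<psi> (merge_counts k)) = coarse.E (\<lambda>k. v k * \<psi> k))"
  using assms
proof (induction rule: chaos.induct)
  case (chaos_const c)
  have "fine.E (\<lambda>k. c * \<psi> (merge_counts k)) = coarse.E (\<lambda>k. c * \<psi> k)" for \<psi>
    by (simp add: R_eq)
  then show ?case by (intro exI [of _ "\<lambda>_. c"]) (auto intro: chaos.chaos_const)
next
  case (chaos_create n \<phi> i)
  then obtain v where v: "chaos J mu n v" "\<And>\<psi>. coarse.poly_bounded \<psi> \<Longrightarrow>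
    fine.E (\<lambda>k. \<phi> k * \<psi> (merge_counts k)) = coarse.E (\<lambda>k. v k * \<psi> k)" by blast
  have p: "fine.poly_bounded \<phi>" by (rule fine.poly_bounded_chaos [OF chaos_create(1)])
  have ibp: "fine.E (\<lambda>k. create_op lam i \<phi> k * \<psi> (merge_counts k)) =
      lam i * fine.E (\<lambda>k. \<phi> k * diff_op i (\<lambda>k. \<psi> (merge_counts k)) k)"
    if "coarse.poly_bounded \<psi>" for \<psi>
    by (rule fine.E_create_op [OF chaos_create(2) p poly_bounded_merge_counts [OF that]])
  show ?case
  \<comment> \<open>By \<open>ibp\<close> the projection is decided by how \<psi> changes when a
    point is added to cell \<open>i\<close>.\<close>
  proof (cases "\<exists>j\<in>J. i \<in> S j \<and> lam i \<noteq> 0")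
    case True
    then obtain j where j: "j \<in> J" "i \<in> S j" "lam i \<noteq> 0" by blast
    have "lam i \<le> mu j"
      unfolding mu [OF j(1)] using j finite_block block_subset fine.lam_nonneg
      by (intro member_le_sum) auto
    then have pos: "mu j > 0" using j fine.lam_nonneg [OF chaos_create(2)] by linarith
    have d: "diff_op i (\<lambda>k. \<psi> (merge_counts k)) = (\<lambda>k. diff_op j \<psi> (merge_counts k))" for \<psi> :: "('j \<Rightarrow> nat) \<Rightarrow> real"
      by (simp add: diff_op_def merge_counts_Suc [OF j(1,2)])
    \<comment> \<open>Given the merged counts, a point of block \<open>j\<close> falls into cell
      \<open>i\<close> with probability \<open>lam i / mu j\<close>; this is the weight with which
      fine creation projects onto coarse creation.\<close>
    have "fine.E (\<lambda>k. create_op lam i \<phi> k * \<psi> (merge_counts k)) =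
      coarse.E (\<lambda>k. (lam i / mu j * create_op mu j v k) * \<psi> k)" if \<psi>: "coarse.poly_bounded \<psi>" for \<psi>
    proof -
      have "coarse.E (\<lambda>k. (lam i / mu j * create_op mu j v k) * \<psi> k) =
         lam i / mu j * coarse.E (\<lambda>k. create_op mu j v k * \<psi> k)"
        by (simp only: mult.assoc integral_mult_right_zero)
      also have "\<dots> = lam i * coarse.E (\<lambda>k. v k * diff_op j \<psi> k)"
        using pos by (simp add: coarse.E_create_op [OF j(1) coarse.poly_bounded_chaos [OF v(1)] \<psi>])
      also have "\<dots> = fine.E (\<lambda>k. create_op lam i \<phi> k * \<psi> (merge_counts k))"
        by (simp add: ibp [OF \<psi>] d v(2) [OF coarse.poly_bounded_diff_op [OF \<psi>]])
      finally show ?thesis ..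
    qed
    moreover have "chaos J mu (Suc n) (\<lambda>k. lam i / mu j * create_op mu j v k)"
      by (rule chaos.chaos_scale [OF chaos.chaos_create [OF v(1) j(1)]])
    ultimately show ?thesis by blast
  next
    \<comment> \<open>Either the mass of cell \<open>i\<close> is zero or merging ignores the cell;
      in both cases the pairing vanishes and the projection is 0.\<close>
    case False
    have "lam i * fine.E (\<lambda>k. \<phi> k * diff_op i (\<lambda>k. \<psi> (merge_counts k)) k) = 0" for \<psi>
    proof (cases "lam i = 0")
      case nz: False
      then have "merge_counts (k(i := Suc (k i))) = merge_counts k" for k
        using False by (intro merge_counts_Suc_outside) blast
      then have "diff_op i (\<lambda>k. \<psi> (merge_counts k)) = (\<lambda>_. 0)"
        by (simp add: diff_op_def)
      then show ?thesis by simp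
    qed simp
    with ibp show ?thesis by (intro exI [of _ "\<lambda>_. 0"]) (simp add: chaos_zero)
  qed
next
  case (chaos_add n \<phi> \<phi>')
  then obtain v v' where v: "chaos J mu n v" "chaos J mu n v'"
    "\<And>\<psi>. coarse.poly_bounded \<psi> \<Longrightarrow> fine.E (\<lambda>k. \<phi> k * \<psi> (merge_counts k)) = coarse.E (\<lambda>k. v k * \<psi> k)"
    "\<And>\<psi>. coarse.poly_bounded \<psi> \<Longrightarrow> fine.E (\<lambda>k. \<phi>' k * \<psi> (merge_counts k)) = coarse.E (\<lambda>k. v' k * \<psi> k)"
    by blast
  have "fine.E (\<lambda>k. (\<phi> k + \<phi>' k) * \<psi> (merge_counts k)) = coarse.E (\<lambda>k. (v k + v' k) * \<psi> k)"
    if \<psi>: "coarse.poly_bounded \<psi>" for \<psi>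
  proof -
    have "fine.poly_bounded (\<lambda>k. \<phi> k * \<psi> (merge_counts k))" "fine.poly_bounded (\<lambda>k. \<phi>' k * \<psi> (merge_counts k))"
      by (rule fine.poly_bounded_mult [OF fine.poly_bounded_chaos [OF chaos_add(1)] poly_bounded_merge_counts [OF \<psi>]]
        fine.poly_bounded_mult [OF fine.poly_bounded_chaos [OF chaos_add(2)] poly_bounded_merge_counts [OF \<psi>]])+
    moreover have "coarse.poly_bounded (\<lambda>k. v k * \<psi> k)" "coarse.poly_bounded (\<lambda>k. v' k * \<psi> k)"
      by (rule coarse.poly_bounded_mult [OF coarse.poly_bounded_chaos [OF v(1)] \<psi>]
        coarse.poly_bounded_mult [OF coarse.poly_bounded_chaos [OF v(2)] \<psi>])+
    ultimately show ?thesis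
      unfolding distrib_right by (simp only: fine.E_add coarse.E_add v(3,4) [OF \<psi>])
  qed
  with chaos.chaos_add [OF v(1,2)] show ?case by blast
next
  case (chaos_scale n \<phi> c)
  then obtain v where v: "chaos J mu n v" "\<And>\<psi>. coarse.poly_bounded \<psi> \<Longrightarrow>
    fine.E (\<lambda>k. \<phi> k * \<psi> (merge_counts k)) = coarse.E (\<lambda>k. v k * \<psi> k)" by blast
  then have "fine.E (\<lambda>k. c * \<phi> k * \<psi> (merge_counts k)) = coarse.E (\<lambda>k. c * v k * \<psi> k)"
    if "coarse.poly_bounded \<psi>" for \<psi>
    using that by (simp only: mult.assoc integral_mult_right_zero)
  with chaos.chaos_scale [OF v(1)] show ?case by blast
next
  case (chaos_zero n)
  show ?case by (intro exI [of _ "\<lambda>_. 0"]) (simp add: chaos.chaos_zero)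
qed

end

section \<open>Counts of a Poisson random measure\<close>

text \<open>This is \<open>compensated_box\<close> as a function of counts. It factors into Charlier
  polynomials, one for each cell, whose degree is the number of sides of the box equal to that
  cell.\<close>

definition box_polynomial ::
    "('i \<Rightarrow> real) \<Rightarrow> 'i set \<Rightarrow> nat \<Rightarrow> (nat \<Rightarrow> 'i) \<Rightarrow> ('i \<Rightarrow> nat) \<Rightarrow> real" where
  "box_polynomial lam I m i k = (\<Sum>J\<in>Pow {..<m}. (-1) ^ (m - card J) *
     (\<Prod>j\<in>I. \<Prod>r<card {l \<in> J. i l = j}. real (k j) - real r) * (\<Prod>l\<in>{..<m} - J. lam (i l)))"

text \<open>One more choice in a cell with \<open>k\<close> points can be made in \<open>k\<close>
  ways and leaves \<open>k - 1\<close> points for the others. At \<open>k = 0\<close> both sides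
  vanish, so the truncated predecessor is correct.\<close>

lemma falling_product_insert:
  assumes "finite I" "i m \<in> I" "finite J" "m \<notin> J"
  shows "(\<Prod>j\<in>I. \<Prod>r<card {l \<in> insert m J. i l = j}. real (k j) - real r) =
    real (k (i m)) * (\<Prod>j\<in>I. \<Prod>r<card {l \<in> J. i l = j}. real ((k(i m := k (i m) - 1)) j) - real r)"
proof -
  let ?k = "k(i m := k (i m) - 1)"
  have 1: "{l \<in> insert m J. i l = i m} = insert m {l \<in> J. i l = i m}" by auto
  have 2: "{l \<in> insert m J. i l = j} = {l \<in> J. i l = j}" if "j \<noteq> i m" for j using that by auto
  have "(\<Prod>r<card {l \<in> insert m J. i l = i m}. real (k (i m)) - real r) =
    real (k (i m)) * (\<Prod>r<card {l \<in> J. i l = i m}. real (?k (i m)) - real r)"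
  proof (cases "k (i m) = 0")
    case True
    then show ?thesis unfolding 1 using assms by (simp add: prod.lessThan_Suc_shift del: prod.lessThan_Suc)
  next
    case False
    then have "real (k (i m)) - real (Suc r) = real (?k (i m)) - real r" for r by simp
    then show ?thesis unfolding 1 using assms
      by (simp add: prod.lessThan_Suc_shift del: prod.lessThan_Suc of_nat_Suc)
  qed
  moreover have "(\<Prod>j\<in>I - {i m}. \<Prod>r<card {l \<in> insert m J. i l = j}. real (k j) - real r) =
    (\<Prod>j\<in>I - {i m}. \<Prod>r<card {l \<in> J. i l = j}. real (?k j) - real r)"
  proof (rule prod.cong [OF refl])
    fix j assume "j \<in> I - {i m}"
    then have "j \<noteq> i m" by simp
    then show "(\<Prod>r<card {l \<in> insert m J. i l = j}. real (k j) - real r) =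
      (\<Prod>r<card {l \<in> J. i l = j}. real (?k j) - real r)"
      by (simp add: 2 [OF \<open>j \<noteq> i m\<close>] del: insert_iff)
  qed
  ultimately show ?thesis
    unfolding prod.remove [OF assms(1,2)] by (simp only: mult.assoc)
qed

text \<open>Split the subsets of \<open>{..<Suc m}\<close> by membership of \<open>m\<close>. Those
  containing \<open>m\<close> give the deletion term of the creation operator, the others the
  compensator with its sign.\<close>

lemma box_polynomial_Suc:
  assumes "finite I" "i m \<in> I"
  shows "box_polynomial lam I (Suc m) i = create_op lam (i m) (box_polynomial lam I m i)"
proof
  fix k
  let ?F = "\<lambda>m k J. (-1) ^ (m - card J) *
     (\<Prod>j\<in>I. \<Prod>r<card {l \<in> J. i l = j}. real (k j) - real r) * (\<Prod>l\<in>{..<m} - J. lam (i l))"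
  have J: "finite J" "m \<notin> J" "card J \<le> m" if "J \<in> Pow {..<m}" for J
    using that card_mono [of "{..<m}" J] by (auto intro: finite_subset)
  have "box_polynomial lam I (Suc m) i k = (\<Sum>J\<in>Pow {..<m}. ?F (Suc m) k J) + (\<Sum>J\<in>insert m ` Pow {..<m}. ?F (Suc m) k J)"
    unfolding box_polynomial_def lessThan_Suc Pow_insert
    by (rule sum.union_disjoint) auto
  also have "(\<Sum>J\<in>Pow {..<m}. ?F (Suc m) k J) = (\<Sum>J\<in>Pow {..<m}. - lam (i m) * ?F m k J)"
  proof (intro sum.cong refl)
    fix J assume "J \<in> Pow {..<m}"
    note J = J [OF this]
    have "{..<Suc m} - J = insert m ({..<m} - J)" using J by auto
    then show "?F (Suc m) k J = - lam (i m) * ?F m k J"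
      using J by (simp add: Suc_diff_le)
  qed
  also have "(\<Sum>J\<in>insert m ` Pow {..<m}. ?F (Suc m) k J) = (\<Sum>J\<in>Pow {..<m}. ?F (Suc m) k (insert m J))"
    by (subst sum.reindex) (auto simp: inj_on_def)
  also have "\<dots> = (\<Sum>J\<in>Pow {..<m}. real (k (i m)) * ?F m (k(i m := k (i m) - 1)) J)"
  proof (intro sum.cong refl)
    fix J assume "J \<in> Pow {..<m}"
    note J = J [OF this]
    have "{..<Suc m} - insert m J = {..<m} - J" by auto
    then show "?F (Suc m) k (insert m J) = real (k (i m)) * ?F m (k(i m := k (i m) - 1)) J"
      using J unfolding falling_product_insert [of I i m J k, OF assms J(1,2)] by simp
  qed
  finally show "box_polynomial lam I (Suc m) i k = create_op lam (i m) (box_polynomial lam I m i) k"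
    by (simp add: create_op_def box_polynomial_def sum_distrib_left sum_negf)
qed

lemma chaos_box_polynomial:
  assumes "finite I" "\<And>l. l < m \<Longrightarrow> i l \<in> I"
  shows "chaos I lam m (box_polynomial lam I m i)"
  using assms(2)
proof (induction m)
  case 0
  have "box_polynomial lam I 0 i = (\<lambda>_. 1)" by (simp add: box_polynomial_def fun_eq_iff)
  then show ?case by (simp add: chaos_const)
next
  case (Suc m)
  then show ?case using assms(1) by (simp add: box_polynomial_Suc chaos_create)
qed

text \<open>Rounding makes the counts natural numbers at every \<omega>. It returns the true mass
  whenever that is a natural number, which holds almost surely for cells of finite control
  measure.\<close>

definition cell_counts :: "'i set \<Rightarrow> ('i \<Rightarrow> 'e set) \<Rightarrow> 'e measure \<Rightarrow> 'i \<Rightarrow> nat" where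
  "cell_counts I A \<nu> = (\<lambda>i. if i \<in> I then nat \<lfloor>measure \<nu> (A i)\<rfloor> else 0)"

lemma chaos_elementary_integral:
  obtains u where "chaos {..<N} (\<lambda>j. measure \<mu> (A j)) m u"
    "\<And>\<nu>. (\<And>j. j < N \<Longrightarrow> \<exists>n::nat. emeasure \<nu> (A j) = of_nat n) \<Longrightarrow>
      elementary_integral \<mu> \<nu> m N A a = u (cell_counts {..<N} A \<nu>)"
proof
  let ?u = "\<lambda>k. \<Sum>i \<in> {..<m} \<rightarrow>\<^sub>E {..<N}. a i * box_polynomial (\<lambda>j. measure \<mu> (A j)) {..<N} m i k"
  show "chaos {..<N} (\<lambda>j. measure \<mu> (A j)) m ?u"
    by (intro chaos_sum chaos_scale chaos_box_polynomial) auto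
  fix \<nu> :: "'a measure"
  assume n: "\<And>j. j < N \<Longrightarrow> \<exists>n::nat. emeasure \<nu> (A j) = of_nat n"
  have "measure \<nu> (A j) = real (cell_counts {..<N} A \<nu> j)" if "j < N" for j
    using n [OF that] that by (auto simp: cell_counts_def measure_def)
  then show "elementary_integral \<mu> \<nu> m N A a = ?u (cell_counts {..<N} A \<nu>)"
    unfolding elementary_integral_def compensated_box_def factorial_box_def box_polynomial_def
    by simp
qed

text \<open>In contrast to \<open>kernel_cells\<close> the index set is arbitrary, so that the atoms
  of a partition can be indexed by themselves.\<close>

definition finite_cells :: "'e measure \<Rightarrow> 'i set \<Rightarrow> ('i \<Rightarrow> 'e set) \<Rightarrow> bool" where
  "finite_cells \<mu> I A \<longleftrightarrow> finite I \<and> disjoint_family_on A I \<and>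
    (\<forall>i\<in>I. A i \<in> sets \<mu> \<and> emeasure \<mu> (A i) < \<infinity>)"

text \<open>The full type \<open>'i \<Rightarrow> nat\<close> can be uncountable. This countable set
  contains the range of the count vector, which makes it measurable for the discrete sigma algebra
  and its law a \<open>pmf\<close>.\<close>

lemma countable_supported: "finite I \<Longrightarrow> countable {k :: 'i \<Rightarrow> nat. \<forall>i. i \<notin> I \<longrightarrow> k i = 0}"
proof -
  assume "finite I"
  then have "countable (PiE I (\<lambda>_. UNIV :: nat set))" by (intro countable_PiE) auto
  then have "countable ((\<lambda>f i. if i \<in> I then f i else 0) ` PiE I (\<lambda>_. UNIV :: nat set))"
    by (rule countable_image)
  moreover have "{k. \<forall>i. i \<notin> I \<longrightarrow> k i = 0} \<subseteq> (\<lambda>f i. if i \<in> I then f i else 0) ` PiE I (\<lambda>_. UNIV :: nat set)"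
  proof
    fix k :: "'i \<Rightarrow> nat" assume "k \<in> {k. \<forall>i. i \<notin> I \<longrightarrow> k i = 0}"
    then have "k = (\<lambda>i. if i \<in> I then restrict k I i else 0)" by (auto simp: fun_eq_iff)
    then show "k \<in> (\<lambda>f i. if i \<in> I then f i else 0) ` PiE I (\<lambda>_. UNIV :: nat set)"
      by (intro image_eqI [where x = "restrict k I"]) auto
  qed
  ultimately show ?thesis by (rule countable_subset [rotated])
qed

section \<open>The joint law of the counts of disjoint cells\<close>

context poisson_random_measure
begin

text \<open>The prescribed Poisson probabilities add up to 1 by the exponential series, so no mass
  is left for other values.\<close>

lemma AE_emeasure_nat:
  assumes "A \<in> sets \<mu>" "emeasure \<mu> A < \<infinity>"
  shows "AE \<omega> in P. \<exists>n::nat. emeasure (\<eta> \<omega>) A = of_nat n"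
proof -
  let ?E = "\<lambda>n::nat. {\<omega> \<in> space P. emeasure (\<eta> \<omega>) A = of_nat n}"
  have E: "?E n \<in> events" for n using measurable_eta [OF assms(1)] by measurable
  have "(\<lambda>n. prob (?E n)) sums prob (\<Union>n. ?E n)"
    by (rule finite_measure_UNION) (use E in \<open>auto simp: disjoint_family_on_def\<close>)
  moreover have "(\<lambda>n. prob (?E n)) sums 1"
  proof -
    have "(\<lambda>n. (measure \<mu> A ^ n /\<^sub>R fact n) * exp (- measure \<mu> A)) sums (exp (measure \<mu> A) * exp (- measure \<mu> A))"
      by (intro sums_mult2 exp_converges)
    then show ?thesis
      by (simp add: poisson_finite [OF assms] divide_inverse mult.commute exp_minus)
  qed
  ultimately have "prob (\<Union>n. ?E n) = 1" by (rule sums_unique2)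
  then have "AE \<omega> in P. \<omega> \<in> (\<Union>n. ?E n)" by (rule AE_prob_1)
  then show ?thesis by (rule AE_mp) auto
qed

lemma AE_cells_nat:
  assumes "finite_cells \<mu> I A"
  shows "AE \<omega> in P. \<forall>i\<in>I. emeasure (\<eta> \<omega>) (A i) = of_nat (cell_counts I A (\<eta> \<omega>) i)"
proof -
  have "AE \<omega> in P. \<forall>i\<in>I. \<exists>n::nat. emeasure (\<eta> \<omega>) (A i) = of_nat n"
    using assms by (intro AE_finite_allI AE_emeasure_nat) (auto simp: finite_cells_def)
  then show ?thesis
  proof (rule AE_mp, intro AE_I2 impI ballI)
    fix \<omega> i assume "\<forall>i\<in>I. \<exists>n::nat. emeasure (\<eta> \<omega>) (A i) = of_nat n" "i \<in> I"
    then obtain n :: nat where "emeasure (\<eta> \<omega>) (A i) = of_nat n" by blast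
    with \<open>i \<in> I\<close> show "emeasure (\<eta> \<omega>) (A i) = of_nat (cell_counts I A (\<eta> \<omega>) i)"
      by (simp add: cell_counts_def measure_def)
  qed
qed

lemma measurable_cell_counts:
  assumes "finite_cells \<mu> I A"
  shows "(\<lambda>\<omega>. cell_counts I A (\<eta> \<omega>)) \<in> measurable P (count_space UNIV)"
proof -
  let ?R = "{k. \<forall>i. i \<notin> I \<longrightarrow> k i = (0 :: nat)}"
  have fin: "finite I" using assms by (simp add: finite_cells_def)
  have m: "(\<lambda>\<omega>. measure (\<eta> \<omega>) (A i)) \<in> borel_measurable P" if "i \<in> I" for i
    unfolding measure_def using assms that measurable_eta by (auto simp: finite_cells_def)
  have "(\<lambda>\<omega>. cell_counts I A (\<eta> \<omega>)) \<in> measurable P (count_space ?R)"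
    unfolding measurable_count_space_eq_countable [OF countable_supported [OF fin]]
  proof (intro conjI ballI)
    show "(\<lambda>\<omega>. cell_counts I A (\<eta> \<omega>)) \<in> space P \<rightarrow> ?R" by (auto simp: cell_counts_def)
    fix k assume k: "k \<in> ?R"
    have "(\<lambda>\<omega>. cell_counts I A (\<eta> \<omega>)) -` {k} \<inter> space P =
      {\<omega> \<in> space P. \<forall>i\<in>I. nat \<lfloor>measure (\<eta> \<omega>) (A i)\<rfloor> = k i}"
      using k by (auto simp: cell_counts_def fun_eq_iff)
    also have "\<dots> \<in> events"
    proof (rule sets.sets_Collect_finite_All [OF _ fin])
      fix i assume "i \<in> I"
      from m [OF this] show "{\<omega> \<in> space P. nat \<lfloor>measure (\<eta> \<omega>) (A i)\<rfloor> = k i} \<in> events"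
        by measurable
    qed
    finally show "(\<lambda>\<omega>. cell_counts I A (\<eta> \<omega>)) -` {k} \<inter> space P \<in> events" .
  qed
  then show ?thesis
    by (rule measurable_compose [where f = "\<lambda>\<omega>. cell_counts I A (\<eta> \<omega>)" and g = "\<lambda>x. x", simplified])
       (auto simp: measurable_def)
qed

lemma prob_cells:
  assumes "finite_cells \<mu> I A"
  shows "prob {\<omega> \<in> space P. \<forall>i\<in>I. emeasure (\<eta> \<omega>) (A i) = of_nat (k i)} =
    (\<Prod>i\<in>I. measure \<mu> (A i) ^ k i / fact (k i) * exp (- measure \<mu> (A i)))"
proof (cases "I = {}")
  case True
  then show ?thesis by (simp add: prob_space)
next
  case False
  have fin: "finite I" and disj: "disjoint_family_on A I"
    and A: "\<And>i. i \<in> I \<Longrightarrow> A i \<in> sets \<mu> \<and> emeasure \<mu> (A i) < \<infinity>"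
    using assms by (auto simp: finite_cells_def)
  \<comment> \<open>\<open>independent_scattering\<close> concerns families indexed by an initial
    segment, so \<open>I\<close> is enumerated.\<close>
  obtain g where g: "bij_betw g {..<card I} I"
    using ex_bij_betw_nat_finite [OF fin] by (auto simp: lessThan_atLeast0)
  then have gI: "g l \<in> I" if "l < card I" for l using that by (auto simp: bij_betw_def)
  have ne: "{..<card I} \<noteq> {}" using False fin by (auto simp: card_gt_0_iff lessThan_empty_iff)
  have "indep_vars (\<lambda>_. borel) (\<lambda>l \<omega>. emeasure (\<eta> \<omega>) ((A \<circ> g) l)) {..<card I}"
  proof (rule independent_scattering)
    show "(A \<circ> g) ` {..<card I} \<subseteq> sets \<mu>" using A gI by auto
    show "disjoint_family_on (A \<circ> g) {..<card I}"
      unfolding disjoint_family_on_def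
    proof (intro ballI impI)
      fix l l' assume "l \<in> {..<card I}" "l' \<in> {..<card I}" "l \<noteq> l'"
      then have "g l \<noteq> g l'" "g l \<in> I" "g l' \<in> I"
        using g gI by (auto simp: bij_betw_def inj_on_def)
      then show "(A \<circ> g) l \<inter> (A \<circ> g) l' = {}"
        using disjoint_family_onD [OF disj] by simp
    qed
  qed
  then have "prob (\<Inter>l\<in>{..<card I}. (\<lambda>\<omega>. emeasure (\<eta> \<omega>) ((A \<circ> g) l)) -` {of_nat (k (g l))} \<inter> space P) =
    (\<Prod>l<card I. prob ((\<lambda>\<omega>. emeasure (\<eta> \<omega>) ((A \<circ> g) l)) -` {of_nat (k (g l))} \<inter> space P))"
    using ne by (intro indep_varsD) auto
  also have "(\<Inter>l\<in>{..<card I}. (\<lambda>\<omega>. emeasure (\<eta> \<omega>) ((A \<circ> g) l)) -` {of_nat (k (g l))} \<inter> space P) =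
    {\<omega> \<in> space P. \<forall>i\<in>I. emeasure (\<eta> \<omega>) (A i) = of_nat (k i)}"
  proof -
    have all: "(\<forall>i\<in>I. R i) \<longleftrightarrow> (\<forall>l\<in>{..<card I}. R (g l))" for R
    proof -
      have "(\<forall>i\<in>g ` {..<card I}. R i) \<longleftrightarrow> (\<forall>l\<in>{..<card I}. R (g l))" by simp
      then show ?thesis by (simp only: bij_betw_imp_surj_on [OF g])
    qed
    show ?thesis unfolding all using ne by auto
  qed
  also have "(\<Prod>l<card I. prob ((\<lambda>\<omega>. emeasure (\<eta> \<omega>) ((A \<circ> g) l)) -` {of_nat (k (g l))} \<inter> space P)) =
     (\<Prod>l<card I. measure \<mu> (A (g l)) ^ k (g l) / fact (k (g l)) * exp (- measure \<mu> (A (g l))))"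
  proof (intro prod.cong refl)
    fix l assume "l \<in> {..<card I}"
    then have "g l \<in> I" using gI by simp
    then have "prob {\<omega> \<in> space P. emeasure (\<eta> \<omega>) (A (g l)) = of_nat (k (g l))} =
      measure \<mu> (A (g l)) ^ k (g l) / fact (k (g l)) * exp (- measure \<mu> (A (g l)))"
      using A by (intro poisson_finite) auto
    moreover have "(\<lambda>\<omega>. emeasure (\<eta> \<omega>) ((A \<circ> g) l)) -` {of_nat (k (g l))} \<inter> space P =
      {\<omega> \<in> space P. emeasure (\<eta> \<omega>) (A (g l)) = of_nat (k (g l))}"
      by auto
    ultimately show "prob ((\<lambda>\<omega>. emeasure (\<eta> \<omega>) ((A \<circ> g) l)) -` {of_nat (k (g l))} \<inter> space P) =
      measure \<mu> (A (g l)) ^ k (g l) / fact (k (g l)) * exp (- measure \<mu> (A (g l)))"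
      by (simp only:)
  qed
  also have "\<dots> = (\<Prod>i\<in>I. measure \<mu> (A i) ^ k i / fact (k i) * exp (- measure \<mu> (A i)))"
    by (rule prod.reindex_bij_betw [OF g])
  finally show ?thesis .
qed

definition counts_pmf :: "'i set \<Rightarrow> ('i \<Rightarrow> 'e set) \<Rightarrow> ('i \<Rightarrow> nat) pmf" where
  "counts_pmf I A = Abs_pmf (distr P (count_space UNIV) (\<lambda>\<omega>. cell_counts I A (\<eta> \<omega>)))"

lemma measure_counts_pmf:
  assumes "finite_cells \<mu> I A"
  shows "measure_pmf (counts_pmf I A) = distr P (count_space UNIV) (\<lambda>\<omega>. cell_counts I A (\<eta> \<omega>))"
  unfolding counts_pmf_def
proof (rule Abs_pmf_inverse, intro CollectI conjI)
  let ?D = "distr P (count_space UNIV) (\<lambda>\<omega>. cell_counts I A (\<eta> \<omega>))"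
  show D: "prob_space ?D" by (rule prob_space_distr [OF measurable_cell_counts [OF assms]])
  show "sets ?D = UNIV" by simp
  interpret D: prob_space ?D by (rule D)
  have "AE k in ?D. k \<in> {k. \<forall>i. i \<notin> I \<longrightarrow> k i = 0}"
    by (subst AE_distr_iff [OF measurable_cell_counts [OF assms]]) (auto simp: cell_counts_def)
  then show "AE x in ?D. measure ?D {x} \<noteq> 0"
    using countable_supported [of I] assms by (subst D.AE_support_countable) (auto simp: finite_cells_def)
qed

lemma pmf_counts_pmf:
  assumes "finite_cells \<mu> I A"
  shows "pmf (counts_pmf I A) k = (if \<forall>i. i \<notin> I \<longrightarrow> k i = 0
    then \<Prod>i\<in>I. measure \<mu> (A i) ^ k i / fact (k i) * exp (- measure \<mu> (A i)) else 0)"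
proof -
  have "pmf (counts_pmf I A) k = prob {\<omega> \<in> space P. cell_counts I A (\<eta> \<omega>) = k}"
    unfolding pmf.rep_eq measure_counts_pmf [OF assms]
    by (subst measure_distr [OF measurable_cell_counts [OF assms]])
      (auto intro!: arg_cong [where f = prob])
  also have "\<dots> = (if \<forall>i. i \<notin> I \<longrightarrow> k i = 0
    then \<Prod>i\<in>I. measure \<mu> (A i) ^ k i / fact (k i) * exp (- measure \<mu> (A i)) else 0)"
  proof (cases "\<forall>i. i \<notin> I \<longrightarrow> k i = 0")
    case True
    have ev: "{\<omega> \<in> space P. cell_counts I A (\<eta> \<omega>) = k} \<in> events"
      using measurable_sets [OF measurable_cell_counts [OF assms], of "{k}"]
      by (simp add: vimage_def Int_def conj_commute)
    have "(\<lambda>\<omega>. emeasure (\<eta> \<omega>) (A i)) \<in> borel_measurable P" if "i \<in> I" for i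
      using assms that measurable_eta by (auto simp: finite_cells_def)
    moreover have "finite I" using assms by (simp add: finite_cells_def)
    ultimately have ev': "{\<omega> \<in> space P. \<forall>i\<in>I. emeasure (\<eta> \<omega>) (A i) = of_nat (k i)} \<in> events"
      by measurable
    have "prob {\<omega> \<in> space P. cell_counts I A (\<eta> \<omega>) = k} =
        prob {\<omega> \<in> space P. \<forall>i\<in>I. emeasure (\<eta> \<omega>) (A i) = of_nat (k i)}"
    proof (rule finite_measure_eq_AE [OF _ ev ev'])
      show "AE x in P. (x \<in> {\<omega> \<in> space P. cell_counts I A (\<eta> \<omega>) = k}) =
        (x \<in> {\<omega> \<in> space P. \<forall>i\<in>I. emeasure (\<eta> \<omega>) (A i) = of_nat (k i)})"
        using AE_cells_nat [OF assms]
      proof (rule AE_mp, intro AE_I2 impI)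
        fix \<omega> assume "\<forall>i\<in>I. emeasure (\<eta> \<omega>) (A i) = of_nat (cell_counts I A (\<eta> \<omega>) i)"
        moreover have "cell_counts I A (\<eta> \<omega>) = k \<longleftrightarrow> (\<forall>i\<in>I. cell_counts I A (\<eta> \<omega>) i = k i)"
          using True by (auto simp: fun_eq_iff) (auto simp: cell_counts_def)
        ultimately show "(\<omega> \<in> {\<omega> \<in> space P. cell_counts I A (\<eta> \<omega>) = k}) =
          (\<omega> \<in> {\<omega> \<in> space P. \<forall>i\<in>I. emeasure (\<eta> \<omega>) (A i) = of_nat (k i)})" by auto
      qed
    qed
    with True prob_cells [OF assms, of k] show ?thesis by simp
  next
    case False
    then have "{\<omega> \<in> space P. cell_counts I A (\<eta> \<omega>) = k} = {}" by (auto simp: cell_counts_def)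
    with False show ?thesis by (simp only: measure_empty if_False)
  qed
  finally show ?thesis .
qed

lemma poisson_counts_cells:
  assumes "finite_cells \<mu> I A"
  shows "poisson_counts I (\<lambda>i. measure \<mu> (A i)) (counts_pmf I A)"
proof
  show fin: "finite I" using assms by (simp add: finite_cells_def)
  show "0 \<le> measure \<mu> (A i)" for i by simp
  fix i k assume i: "i \<in> I"
  have s: "(\<forall>j. j \<notin> I \<longrightarrow> (k(i := Suc (k i))) j = 0) \<longleftrightarrow> (\<forall>j. j \<notin> I \<longrightarrow> k j = 0)" using i by auto
  show "pmf (counts_pmf I A) (k(i := Suc (k i))) * real (Suc (k i)) = measure \<mu> (A i) * pmf (counts_pmf I A) k"
  proof (cases "\<forall>j. j \<notin> I \<longrightarrow> k j = 0")
    case True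
    have e: "(\<Prod>j\<in>I - {i}. measure \<mu> (A j) ^ (k(i := Suc (k i))) j / fact ((k(i := Suc (k i))) j) * exp (- measure \<mu> (A j))) =
      (\<Prod>j\<in>I - {i}. measure \<mu> (A j) ^ k j / fact (k j) * exp (- measure \<mu> (A j)))"
      by (intro prod.cong) auto
    show ?thesis
      unfolding pmf_counts_pmf [OF assms] s if_P [OF True] prod.remove [OF fin i] e fun_upd_same
      by (simp add: divide_simps del: of_nat_Suc)
  next
    case False
    show ?thesis
      unfolding pmf_counts_pmf [OF assms] s if_not_P [OF False] by simp
  qed
qed

lemma integral_counts_pmf:
  fixes \<phi> :: "('i \<Rightarrow> nat) \<Rightarrow> real"
  assumes "finite_cells \<mu> I A"
  shows "measure_pmf.expectation (counts_pmf I A) \<phi> = (\<integral>\<omega>. \<phi> (cell_counts I A (\<eta> \<omega>)) \<partial>P)"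
    and "integrable (measure_pmf (counts_pmf I A)) \<phi> \<longleftrightarrow> integrable P (\<lambda>\<omega>. \<phi> (cell_counts I A (\<eta> \<omega>)))"
  unfolding measure_counts_pmf [OF assms]
  by (rule integral_distr integrable_distr_eq; rule measurable_cell_counts [OF assms] borel_measurable_count_space)+

lemma borel_measurable_cell_counts:
  assumes "finite_cells \<mu> I A" and "\<phi> \<in> UNIV \<rightarrow> space M"
  shows "(\<lambda>\<omega>. \<phi> (cell_counts I A (\<eta> \<omega>))) \<in> measurable P M"
  by (rule measurable_compose [OF measurable_cell_counts [OF assms(1)]])
    (use assms(2) in \<open>auto simp: measurable_def\<close>)

text \<open>Masses add over a block for every \<omega> in the space, but the counts are rounded
  masses and add only where all masses are natural numbers, hence the almost sure statement.\<close>

lemma coarsening_cells: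
  assumes A: "finite_cells \<mu> I A" and B: "finite_cells \<mu> J B"
    and S: "\<And>j. j \<in> J \<Longrightarrow> S j \<subseteq> I" "disjoint_family_on S J" "\<And>j. j \<in> J \<Longrightarrow> B j = (\<Union>i\<in>S j. A i)"
  shows "poisson_coarsening I (\<lambda>i. measure \<mu> (A i)) (counts_pmf I A) J (\<lambda>j. measure \<mu> (B j)) (counts_pmf J B) S"
    and "AE \<omega> in P. cell_counts J B (\<eta> \<omega>) = block_map.merge_counts J S (cell_counts I A (\<eta> \<omega>))"
proof -
  interpret block_map I J S
    using A B S by unfold_locales (auto simp: finite_cells_def)
  have dA: "disjoint_family_on A I" using A by (simp add: finite_cells_def)
  have dS: "disjoint_family_on A (S j)" if "j \<in> J" for j
    using disjoint_family_on_mono [OF S(1) [OF that] dA] .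
  have ae: "AE \<omega> in P. cell_counts J B (\<eta> \<omega>) = merge_counts (cell_counts I A (\<eta> \<omega>))"
    using AE_cells_nat [OF A] AE_cells_nat [OF B] AE_space
  proof eventually_elim
    case (elim \<omega>)
    show "cell_counts J B (\<eta> \<omega>) = merge_counts (cell_counts I A (\<eta> \<omega>))"
    proof
      fix j
      show "cell_counts J B (\<eta> \<omega>) j = merge_counts (cell_counts I A (\<eta> \<omega>)) j"
      proof (cases "j \<in> J")
        case True
        have "of_nat (cell_counts J B (\<eta> \<omega>) j) = emeasure (\<eta> \<omega>) (\<Union>i\<in>S j. A i)"
          using elim True S(3) by simp
        also have "\<dots> = (\<Sum>i\<in>S j. emeasure (\<eta> \<omega>) (A i))"
        proof (rule sum_emeasure [symmetric])
          show "A ` S j \<subseteq> sets (\<eta> \<omega>)"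
            using A S(1) [OF True] sets_eta [OF elim(3)] by (auto simp: finite_cells_def)
        qed (use dS finite_block True in auto)
        also have "\<dots> = (\<Sum>i\<in>S j. of_nat (cell_counts I A (\<eta> \<omega>) i))"
          using elim S(1) [OF True] by (intro sum.cong) auto
        also have "\<dots> = of_nat (merge_counts (cell_counts I A (\<eta> \<omega>)) j)"
          using True by (simp add: merge_counts_def)
        finally show ?thesis by (simp only: of_nat_eq_iff)
      next
        case False
        then show ?thesis by (simp add: cell_counts_def merge_counts_def)
      qed
    qed
  qed
  then show "AE \<omega> in P. cell_counts J B (\<eta> \<omega>) = block_map.merge_counts J S (cell_counts I A (\<eta> \<omega>))" .
  interpret fine: poisson_counts I "\<lambda>i. measure \<mu> (A i)" "counts_pmf I A" by (rule poisson_counts_cells [OF A])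
  interpret coarse: poisson_counts J "\<lambda>j. measure \<mu> (B j)" "counts_pmf J B" by (rule poisson_counts_cells [OF B])
  show "poisson_coarsening I (\<lambda>i. measure \<mu> (A i)) (counts_pmf I A) J (\<lambda>j. measure \<mu> (B j)) (counts_pmf J B) S"
  proof
    fix j assume j: "j \<in> J"
    show "measure \<mu> (B j) = (\<Sum>i\<in>S j. measure \<mu> (A i))"
      unfolding S(3) [OF j]
      using A S(1) [OF j] finite_block [OF j] dS [OF j]
      by (intro measure_finite_Union) (auto simp: finite_cells_def less_top)
  next
    have "measure_pmf (counts_pmf J B) = distr P (count_space UNIV) (\<lambda>\<omega>. merge_counts (cell_counts I A (\<eta> \<omega>)))"
      unfolding measure_counts_pmf [OF B]
    proof (rule distr_cong_AE [OF refl refl ae])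
      show "(\<lambda>\<omega>. cell_counts J B (\<eta> \<omega>)) \<in> measurable P (count_space UNIV)" by (rule measurable_cell_counts [OF B])
      show "(\<lambda>\<omega>. merge_counts (cell_counts I A (\<eta> \<omega>))) \<in> measurable P (count_space UNIV)"
        by (rule borel_measurable_cell_counts [OF A]) auto
    qed
    also have "\<dots> = distr (measure_pmf (counts_pmf I A)) (count_space UNIV) merge_counts"
      unfolding measure_counts_pmf [OF A]
      by (subst distr_distr) (auto simp: comp_def intro: measurable_cell_counts [OF A])
    also have "\<dots> = measure_pmf (map_pmf merge_counts (counts_pmf I A))"
      by (simp add: map_pmf_rep_eq)
    finally show "counts_pmf J B = map_pmf merge_counts (counts_pmf I A)"
      by (simp add: measure_pmf_inject)
  qed
qed

end

section \<open>Approximation of multiple integrals on finite partitions\<close>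

text \<open>Points are grouped by the members of the family that contain them. The empty pattern is
  excluded because the points outside all members need not form a set of finite measure, and empty
  atoms are excluded so that no atom lies in two disjoint sets.\<close>

definition atoms :: "'a set set \<Rightarrow> 'a set set" where
  "atoms \<S> = (\<lambda>T. {y. {S \<in> \<S>. y \<in> S} = T}) ` (Pow \<S> - {{}}) - {{}}"

lemma finite_atoms: "finite \<S> \<Longrightarrow> finite (atoms \<S>)"
  unfolding atoms_def by auto

lemma disjoint_atoms: "C \<in> atoms \<S> \<Longrightarrow> C' \<in> atoms \<S> \<Longrightarrow> C \<noteq> C' \<Longrightarrow> C \<inter> C' = {}"
  unfolding atoms_def by auto

lemma Union_atoms:
  assumes "S \<in> \<S>"
  shows "S = \<Union>{C \<in> atoms \<S>. C \<subseteq> S}"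
proof
  show "S \<subseteq> \<Union>{C \<in> atoms \<S>. C \<subseteq> S}"
  proof
    fix y assume y: "y \<in> S"
    let ?C = "{y'. {S \<in> \<S>. y' \<in> S} = {S \<in> \<S>. y \<in> S}}"
    have "?C \<in> atoms \<S>" using assms y unfolding atoms_def by auto
    moreover have "?C \<subseteq> S" "y \<in> ?C" using assms y by auto
    ultimately show "y \<in> \<Union>{C \<in> atoms \<S>. C \<subseteq> S}" by blast
  qed
qed auto

definition finite_sets :: "'e measure \<Rightarrow> 'e set set \<Rightarrow> bool" where
  "finite_sets \<mu> \<S> \<longleftrightarrow> finite \<S> \<and> (\<forall>S\<in>\<S>. S \<in> sets \<mu> \<and> emeasure \<mu> S < \<infinity>)"

lemma finite_cells_atoms:
  assumes "finite_sets \<mu> \<S>"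
  shows "finite_cells \<mu> (atoms \<S>) (\<lambda>C. C)"
  unfolding finite_cells_def
proof (intro conjI ballI)
  have fin: "finite \<S>" and S: "\<And>S. S \<in> \<S> \<Longrightarrow> S \<in> sets \<mu> \<and> emeasure \<mu> S < \<infinity>"
    using assms by (auto simp: finite_sets_def)
  show "finite (atoms \<S>)" by (rule finite_atoms [OF fin])
  show "disjoint_family_on (\<lambda>C. C) (atoms \<S>)"
    unfolding disjoint_family_on_def using disjoint_atoms by blast
  fix C assume "C \<in> atoms \<S>"
  then obtain T where T: "T \<subseteq> \<S>" "T \<noteq> {}" "C = {y. {S \<in> \<S>. y \<in> S} = T}"
    unfolding atoms_def by auto
  have C: "C = \<Inter>T - \<Union>(\<S> - T)" using T by auto
  have "(\<Inter>S\<in>T. S) \<in> sets \<mu>"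
    using T S finite_subset [OF T(1) fin] by (intro sets.finite_INT) auto
  then have "\<Inter>T \<in> sets \<mu>" by simp
  moreover have "\<Union>(\<S> - T) \<in> sets \<mu>"
    using S fin by (intro sets.finite_Union) auto
  ultimately show "C \<in> sets \<mu>" unfolding C by (rule sets.Diff)
  obtain S' where "S' \<in> T" using T by auto
  then have "emeasure \<mu> C \<le> emeasure \<mu> S'"
    using T S C by (intro emeasure_mono) auto
  also have "\<dots> < \<infinity>" using S T \<open>S' \<in> T\<close> by auto
  finally show "emeasure \<mu> C < \<infinity>" .
qed

lemma finite_sets_atoms: "finite_sets \<mu> \<S> \<Longrightarrow> finite_sets \<mu> (atoms \<S>)"
  using finite_cells_atoms unfolding finite_cells_def finite_sets_def by blast

lemma finite_sets_Un: "finite_sets \<mu> \<S> \<Longrightarrow> finite_sets \<mu> \<S>' \<Longrightarrow> finite_sets \<mu> (\<S> \<union> \<S>')"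
  unfolding finite_sets_def by auto

lemma finite_cells_kernel_cells: "kernel_cells \<mu> N A \<Longrightarrow> finite_cells \<mu> {..<N} A"
  unfolding kernel_cells_def finite_cells_def by auto

lemma finite_sets_kernel_cells: "kernel_cells \<mu> N A \<Longrightarrow> finite_sets \<mu> (A ` {..<N})"
  unfolding kernel_cells_def finite_sets_def by auto

section \<open>Moment inequalities and truncation\<close>

lemma young_fourth_power: "x * y ^ 3 \<le> x ^ 4 / 4 + 3 * y ^ 4 / 4" for x y :: real
proof -
  have "x ^ 4 + 3 * y ^ 4 - 4 * (x * y ^ 3) = (x - y)\<^sup>2 * ((x + y)\<^sup>2 + 2 * y\<^sup>2)"
    by algebra
  moreover have "0 \<le> (x - y)\<^sup>2 * ((x + y)\<^sup>2 + 2 * y\<^sup>2)" by simp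
  ultimately show ?thesis by linarith
qed

lemma integrable_fourth_power_add:
  fixes f g :: "'a \<Rightarrow> real"
  assumes [measurable]: "f \<in> borel_measurable M" "g \<in> borel_measurable M"
    and "integrable M (\<lambda>x. f x ^ 4)" "integrable M (\<lambda>x. g x ^ 4)"
  shows "integrable M (\<lambda>x. (f x + g x) ^ 4)"
    and "(\<integral>x. (f x + g x) ^ 4 \<partial>M) \<le> 8 * ((\<integral>x. f x ^ 4 \<partial>M) + (\<integral>x. g x ^ 4 \<partial>M))"
proof -
  have i: "integrable M (\<lambda>x. 8 * (f x ^ 4 + g x ^ 4))" using assms by auto
  show j: "integrable M (\<lambda>x. (f x + g x) ^ 4)"
    by (rule Bochner_Integration.integrable_bound [OF i])
      (auto intro!: AE_I2 order_trans [OF fourth_power_add_le])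
  have "(\<integral>x. (f x + g x) ^ 4 \<partial>M) \<le> (\<integral>x. 8 * (f x ^ 4 + g x ^ 4) \<partial>M)"
    by (rule integral_mono [OF j i fourth_power_add_le])
  also have "\<dots> = 8 * ((\<integral>x. f x ^ 4 \<partial>M) + (\<integral>x. g x ^ 4 \<partial>M))" using assms by simp
  finally show "(\<integral>x. (f x + g x) ^ 4 \<partial>M) \<le> 8 * ((\<integral>x. f x ^ 4 \<partial>M) + (\<integral>x. g x ^ 4 \<partial>M))" .
qed

lemma integrable_fourth_power_diff:
  fixes f g :: "'a \<Rightarrow> real"
  assumes "f \<in> borel_measurable M" "g \<in> borel_measurable M"
    and "integrable M (\<lambda>x. f x ^ 4)" "integrable M (\<lambda>x. g x ^ 4)"
  shows "integrable M (\<lambda>x. (f x - g x) ^ 4)"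
    and "(\<integral>x. (f x - g x) ^ 4 \<partial>M) \<le> 8 * ((\<integral>x. f x ^ 4 \<partial>M) + (\<integral>x. g x ^ 4 \<partial>M))"
  using integrable_fourth_power_add [of f M "\<lambda>x. - g x"] assms by auto

lemma integrable_product_of_squares:
  fixes f g :: "'a \<Rightarrow> real"
  assumes [measurable]: "f \<in> borel_measurable M" "g \<in> borel_measurable M"
    and "integrable M (\<lambda>x. (f x)\<^sup>2)" "integrable M (\<lambda>x. (g x)\<^sup>2)"
  shows "integrable M (\<lambda>x. f x * g x)"
proof (rule Bochner_Integration.integrable_bound)
  show "integrable M (\<lambda>x. (f x)\<^sup>2 + (g x)\<^sup>2)" using assms by auto
  show "AE x in M. norm (f x * g x) \<le> norm ((f x)\<^sup>2 + (g x)\<^sup>2)"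
  proof (intro AE_I2)
    fix x
    have "2 * \<bar>f x * g x\<bar> \<le> (f x)\<^sup>2 + (g x)\<^sup>2"
      using sum_squares_bound [of "\<bar>f x\<bar>" "\<bar>g x\<bar>"] by (simp add: abs_mult)
    then show "norm (f x * g x) \<le> norm ((f x)\<^sup>2 + (g x)\<^sup>2)" by simp
  qed
qed auto

lemma integrable_square_diff:
  fixes f g :: "'a \<Rightarrow> real"
  assumes [measurable]: "f \<in> borel_measurable M" "g \<in> borel_measurable M"
    and "integrable M (\<lambda>x. (f x)\<^sup>2)" "integrable M (\<lambda>x. (g x)\<^sup>2)"
  shows "integrable M (\<lambda>x. (f x - g x)\<^sup>2)"
  using assms integrable_product_of_squares [OF assms] by (simp add: power2_diff mult.assoc)

lemma L2_pairing_tendsto_0: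
  fixes F :: "nat \<Rightarrow> 'a \<Rightarrow> real"
  assumes [measurable]: "\<And>l. F l \<in> borel_measurable M" "g \<in> borel_measurable M"
    and F: "\<And>l. integrable M (\<lambda>x. (F l x)\<^sup>2)" "(\<lambda>l. \<integral>x. (F l x)\<^sup>2 \<partial>M) \<longlonglongrightarrow> 0"
    and g: "integrable M (\<lambda>x. (g x)\<^sup>2)"
  shows "(\<lambda>l. \<integral>x. F l x * g x \<partial>M) \<longlonglongrightarrow> 0"
proof (rule LIMSEQ_I)
  fix r :: real assume r: "0 < r"
  let ?b = "\<integral>x. (g x)\<^sup>2 \<partial>M"
  have b: "0 \<le> ?b" by simp
  \<comment> \<open>The weight in the arithmetic-geometric inequality: with it the fixed function
    contributes less than \<open>r / 2\<close>, and \<open>N\<close> makes the other part smaller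
    than \<open>r / 2\<close>. Adding 1 keeps it positive.\<close>
  define t where "t = (?b + 1) / r"
  have t: "t > 0" using b r unfolding t_def by (intro divide_pos_pos add_nonneg_pos) auto
  obtain N where N: "\<And>l. l \<ge> N \<Longrightarrow> norm ((\<integral>x. (F l x)\<^sup>2 \<partial>M) - 0) < r / t"
    using LIMSEQ_D [OF F(2), of "r / t"] r t by auto
  have "norm ((\<integral>x. F l x * g x \<partial>M) - 0) < r" if "l \<ge> N" for l
  proof -
    have "\<bar>\<integral>x. F l x * g x \<partial>M\<bar> \<le> (\<integral>x. \<bar>F l x * g x\<bar> \<partial>M)" by (rule integral_abs_bound)
    also have "\<dots> \<le> (\<integral>x. (t * (F l x)\<^sup>2 + (g x)\<^sup>2 / t) / 2 \<partial>M)"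
    proof (rule integral_mono)
      show "integrable M (\<lambda>x. \<bar>F l x * g x\<bar>)"
        using integrable_product_of_squares [OF assms(1,2) F(1) g] by (rule integrable_abs)
      show "integrable M (\<lambda>x. (t * (F l x)\<^sup>2 + (g x)\<^sup>2 / t) / 2)" using F(1) g by simp
      fix x
      have "0 \<le> (t * \<bar>F l x\<bar> - \<bar>g x\<bar>)\<^sup>2" by simp
      also have "\<dots> = t * (t * \<bar>F l x\<bar>\<^sup>2) + \<bar>g x\<bar>\<^sup>2 - t * (2 * (\<bar>F l x\<bar> * \<bar>g x\<bar>))"
        by algebra
      also have "\<dots> = t * (t * (F l x)\<^sup>2) + (g x)\<^sup>2 - t * (2 * \<bar>F l x * g x\<bar>)"
        by (simp add: abs_mult)
      finally have "t * (2 * \<bar>F l x * g x\<bar>) \<le> t * (t * (F l x)\<^sup>2 + (g x)\<^sup>2 / t)"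
        using t by (simp add: distrib_left)
      then show "\<bar>F l x * g x\<bar> \<le> (t * (F l x)\<^sup>2 + (g x)\<^sup>2 / t) / 2" using t by simp
    qed
    also have "\<dots> = (t * (\<integral>x. (F l x)\<^sup>2 \<partial>M) + ?b / t) / 2" using F(1) g by simp
    also have "\<dots> < r"
    proof -
      have "t * (\<integral>x. (F l x)\<^sup>2 \<partial>M) < r" using N [OF that] t by (simp add: field_simps)
      moreover have "?b / t < r"
      proof -
        have "r * t = ?b + 1" using r by (simp add: t_def)
        then show ?thesis unfolding pos_divide_less_eq [OF t] by simp
      qed
      ultimately show ?thesis by simp
    qed
    finally show ?thesis by simp
  qed
  then show "\<exists>N. \<forall>l\<ge>N. norm ((\<integral>x. F l x * g x \<partial>M) - 0) < r" by blast
qed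

definition truncate :: "real \<Rightarrow> real \<Rightarrow> real" where
  "truncate M x = max (- M) (min M x)"

lemma truncate_bounded: "M \<ge> 0 \<Longrightarrow> \<bar>truncate M x\<bar> \<le> M"
  by (auto simp: truncate_def)

lemma truncate_lipschitz: "\<bar>truncate M x - truncate M y\<bar> \<le> \<bar>x - y\<bar>"
  by (auto simp: truncate_def max_def min_def)

lemma truncate_diff_le: "M \<ge> 0 \<Longrightarrow> \<bar>x - truncate M x\<bar> \<le> \<bar>x\<bar>"
  by (auto simp: truncate_def max_def min_def)

lemma truncate_eq: "\<bar>x\<bar> \<le> M \<Longrightarrow> truncate M x = x"
  by (auto simp: truncate_def max_def min_def)

lemma borel_measurable_truncate [measurable]: "truncate M \<in> borel_measurable borel"
  unfolding truncate_def [abs_def] by measurable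

lemma truncation_tendsto:
  assumes [measurable]: "X \<in> borel_measurable M" and "integrable M (\<lambda>x. X x ^ 4)"
  shows "(\<lambda>n. \<integral>x. (X x - truncate (real n) (X x)) ^ 4 \<partial>M) \<longlonglongrightarrow> 0"
proof -
  have "(\<lambda>n. \<integral>x. (X x - truncate (real n) (X x)) ^ 4 \<partial>M) \<longlonglongrightarrow> (\<integral>x. 0 \<partial>M)"
  proof (rule integral_dominated_convergence [where w = "\<lambda>x. X x ^ 4"])
    show "AE x in M. (\<lambda>n. (X x - truncate (real n) (X x)) ^ 4) \<longlonglongrightarrow> 0"
    proof (intro AE_I2)
      fix x
      obtain N :: nat where "\<bar>X x\<bar> \<le> real N" using real_arch_simple by blast
      then have "eventually (\<lambda>n. (X x - truncate (real n) (X x)) ^ 4 = 0) sequentially"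
        by (intro eventually_sequentiallyI [of N]) (simp add: truncate_eq)
      then show "(\<lambda>n. (X x - truncate (real n) (X x)) ^ 4) \<longlonglongrightarrow> 0"
        by (rule tendsto_eventually)
    qed
    show "AE x in M. norm ((X x - truncate (real n) (X x)) ^ 4) \<le> X x ^ 4" for n
    proof (intro AE_I2)
      fix x
      have "\<bar>X x - truncate (real n) (X x)\<bar> ^ 4 \<le> \<bar>X x\<bar> ^ 4"
        by (intro power_mono truncate_diff_le) auto
      then show "norm ((X x - truncate (real n) (X x)) ^ 4) \<le> X x ^ 4" by simp
    qed
  qed (use assms in auto)
  then show ?thesis by simp
qed

section \<open>Projecting a multiple integral onto the counts of a partition\<close>

context poisson_random_measure
begin

abbreviation atom_counts :: "'e set set \<Rightarrow> 'w \<Rightarrow> 'e set \<Rightarrow> nat" where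
  "atom_counts \<S> \<omega> \<equiv> cell_counts (atoms \<S>) (\<lambda>C. C) (\<eta> \<omega>)"

abbreviation atom_pmf :: "'e set set \<Rightarrow> ('e set \<Rightarrow> nat) pmf" where
  "atom_pmf \<S> \<equiv> counts_pmf (atoms \<S>) (\<lambda>C. C)"

lemma coarsening_atoms:
  assumes "finite_sets \<mu> \<S>" "finite_cells \<mu> J B" "B ` J \<subseteq> \<S>"
  shows "poisson_coarsening (atoms \<S>) (measure \<mu>) (atom_pmf \<S>) J (\<lambda>j. measure \<mu> (B j)) (counts_pmf J B)
      (\<lambda>j. {C \<in> atoms \<S>. C \<subseteq> B j})"
    and "AE \<omega> in P. cell_counts J B (\<eta> \<omega>) =
      block_map.merge_counts J (\<lambda>j. {C \<in> atoms \<S>. C \<subseteq> B j}) (atom_counts \<S> \<omega>)"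
proof -
  have d: "disjoint_family_on (\<lambda>j. {C \<in> atoms \<S>. C \<subseteq> B j}) J"
    unfolding disjoint_family_on_def
  proof (intro ballI impI equals0I)
    fix i j C assume ij: "i \<in> J" "j \<in> J" "i \<noteq> j"
      and C: "C \<in> {C \<in> atoms \<S>. C \<subseteq> B i} \<inter> {C \<in> atoms \<S>. C \<subseteq> B j}"
    have "B i \<inter> B j = {}"
      using assms(2) ij unfolding finite_cells_def disjoint_family_on_def by blast
    moreover have "C \<noteq> {}" using C unfolding atoms_def by blast
    ultimately show False using C by blast
  qed
  have e: "B j = (\<Union>C\<in>{C \<in> atoms \<S>. C \<subseteq> B j}. C)" if "j \<in> J" for j
    using Union_atoms [of "B j" \<S>] assms(3) that by auto
  note c = coarsening_cells [OF finite_cells_atoms [OF assms(1)] assms(2), of "\<lambda>j. {C \<in> atoms \<S>. C \<subseteq> B j}"]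
  show "poisson_coarsening (atoms \<S>) (measure \<mu>) (atom_pmf \<S>) J (\<lambda>j. measure \<mu> (B j)) (counts_pmf J B)
      (\<lambda>j. {C \<in> atoms \<S>. C \<subseteq> B j})"
    by (rule c(1) [OF _ d e]) auto
  show "AE \<omega> in P. cell_counts J B (\<eta> \<omega>) =
      block_map.merge_counts J (\<lambda>j. {C \<in> atoms \<S>. C \<subseteq> B j}) (atom_counts \<S> \<omega>)"
    by (rule c(2) [OF _ d e]) auto
qed

lemma poisson_counts_atoms:
  "finite_sets \<mu> \<S> \<Longrightarrow> poisson_counts (atoms \<S>) (measure \<mu>) (atom_pmf \<S>)"
  using poisson_counts_cells [OF finite_cells_atoms] by simp

lemma elementary_integral_atoms:
  assumes "finite_sets \<mu> \<S>" "kernel_cells \<mu> N A" "A ` {..<N} \<subseteq> \<S>"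
  obtains u where "chaos (atoms \<S>) (measure \<mu>) m u"
    "AE \<omega> in P. elementary_integral \<mu> (\<eta> \<omega>) m N A a = u (atom_counts \<S> \<omega>)"
proof -
  obtain u where u: "chaos {..<N} (\<lambda>j. measure \<mu> (A j)) m u"
    "\<And>\<nu>. (\<And>j. j < N \<Longrightarrow> \<exists>n::nat. emeasure \<nu> (A j) = of_nat n) \<Longrightarrow>
      elementary_integral \<mu> \<nu> m N A a = u (cell_counts {..<N} A \<nu>)"
    using chaos_elementary_integral by blast
  note fc = finite_cells_kernel_cells [OF assms(2)]
  note co = coarsening_atoms [OF assms(1) fc assms(3)]
  interpret poisson_coarsening "atoms \<S>" "measure \<mu>" "atom_pmf \<S>" "{..<N}" "\<lambda>j. measure \<mu> (A j)"
    "counts_pmf {..<N} A" "\<lambda>j. {C \<in> atoms \<S>. C \<subseteq> A j}"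
    by (rule co(1))
  have "AE \<omega> in P. elementary_integral \<mu> (\<eta> \<omega>) m N A a = u (merge_counts (atom_counts \<S> \<omega>))"
    using co(2) AE_cells_nat [OF fc]
  proof eventually_elim
    case (elim \<omega>)
    then show ?case using u(2) [of "\<eta> \<omega>"] by auto
  qed
  with chaos_merge_counts [OF u(1) mu] show ?thesis by (rule that)
qed

lemma integrable_power_counts:
  assumes "finite_sets \<mu> \<S>" "poisson_counts.poly_bounded (atoms \<S>) \<psi>"
  shows "(\<lambda>\<omega>. \<psi> (atom_counts \<S> \<omega>)) \<in> borel_measurable P"
    and "integrable P (\<lambda>\<omega>. \<psi> (atom_counts \<S> \<omega>) ^ n)"
proof -
  interpret poisson_counts "atoms \<S>" "measure \<mu>" "atom_pmf \<S>" by (rule poisson_counts_atoms [OF assms(1)])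
  note fc = finite_cells_atoms [OF assms(1)]
  show "(\<lambda>\<omega>. \<psi> (atom_counts \<S> \<omega>)) \<in> borel_measurable P"
    by (rule borel_measurable_cell_counts [OF fc]) auto
  show "integrable P (\<lambda>\<omega>. \<psi> (atom_counts \<S> \<omega>) ^ n)"
    using integrable_poly_bounded [OF poly_bounded_power [OF assms(2)]]
    unfolding integral_counts_pmf(2) [OF fc] .
qed

text \<open>The result is the conditional expectation of \<open>X\<close> given the counts. Each
  elementary integral is projected from a common refinement; \<open>L2\<close> convergence makes the
  pairings with test functions converge, and \<open>chaos_weak_limit\<close> finds the limit inside
  the same chaos.\<close>

lemma multiple_integral_projection:
  assumes X: "has_multiple_poisson_integral P \<mu> \<eta> m f X" and S: "finite_sets \<mu> \<S>"
  obtains v where "chaos (atoms \<S>) (measure \<mu>) m v"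
    "\<And>\<psi>. poisson_counts.poly_bounded (atoms \<S>) \<psi> \<Longrightarrow>
      (\<integral>\<omega>. X \<omega> * \<psi> (atom_counts \<S> \<omega>) \<partial>P) = (\<integral>\<omega>. v (atom_counts \<S> \<omega>) * \<psi> (atom_counts \<S> \<omega>) \<partial>P)"
proof -
  from X obtain N A a where sq: "square_integrable P X" and cells: "\<And>k. kernel_cells \<mu> (N k) (A k)"
    and conv: "L2_converges P (\<lambda>k \<omega>. elementary_integral \<mu> (\<eta> \<omega>) m (N k) (A k) (a k)) X"
    unfolding has_multiple_poisson_integral_def by blast
  have Xm [measurable]: "X \<in> borel_measurable P" and X2: "integrable P (\<lambda>\<omega>. (X \<omega>)\<^sup>2)"
    using sq by (auto simp: square_integrable_def)
  interpret coarse: poisson_counts "atoms \<S>" "measure \<mu>" "atom_pmf \<S>" by (rule poisson_counts_atoms [OF S])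
  note fcS = finite_cells_atoms [OF S]
  \<comment> \<open>\<open>U\<close> is a square integrable version of the elementary integral and
    \<open>v\<close> its projection, chosen together for every \<open>l\<close>.\<close>
  let ?R = "\<lambda>l v U. chaos (atoms \<S>) (measure \<mu>) m v \<and> U \<in> borel_measurable P \<and> integrable P (\<lambda>\<omega>. (U \<omega>)\<^sup>2) \<and>
     (AE \<omega> in P. elementary_integral \<mu> (\<eta> \<omega>) m (N l) (A l) (a l) = U \<omega>) \<and>
     (\<forall>\<psi>. coarse.poly_bounded \<psi> \<longrightarrow> (\<integral>\<omega>. U \<omega> * \<psi> (atom_counts \<S> \<omega>) \<partial>P) = coarse.E (\<lambda>k. v k * \<psi> k))"
  have "\<exists>v U. ?R l v U" for l
  proof -
    \<comment> \<open>The refinement contains \<open>atoms \<S>\<close> itself, since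
      \<open>coarsening_atoms\<close> requires the coarse cells to be members of the family whose
      atoms are the fine cells.\<close>
    let ?T = "atoms \<S> \<union> A l ` {..<N l}"
    have T: "finite_sets \<mu> ?T"
      by (intro finite_sets_Un finite_sets_atoms S finite_sets_kernel_cells cells)
    obtain u where u: "chaos (atoms ?T) (measure \<mu>) m u"
      "AE \<omega> in P. elementary_integral \<mu> (\<eta> \<omega>) m (N l) (A l) (a l) = u (atom_counts ?T \<omega>)"
      by (rule elementary_integral_atoms [OF T cells]) auto
    have sub: "(\<lambda>C. C) ` atoms \<S> \<subseteq> ?T" by auto
    note co = coarsening_atoms [OF T fcS sub]
    interpret c: poisson_coarsening "atoms ?T" "measure \<mu>" "atom_pmf ?T" "atoms \<S>" "measure \<mu>" "atom_pmf \<S>"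
      "\<lambda>D. {C \<in> atoms ?T. C \<subseteq> D}"
      by (rule co(1))
    obtain v where v: "chaos (atoms \<S>) (measure \<mu>) m v"
      "\<And>\<psi>. coarse.poly_bounded \<psi> \<Longrightarrow> c.fine.E (\<lambda>k. u k * \<psi> (c.merge_counts k)) = coarse.E (\<lambda>k. v k * \<psi> k)"
      using c.chaos_projection [OF u(1)] by blast
    have pu: "c.fine.poly_bounded u" by (rule c.fine.poly_bounded_chaos [OF u(1)])
    have "(\<integral>\<omega>. u (atom_counts ?T \<omega>) * \<psi> (atom_counts \<S> \<omega>) \<partial>P) = coarse.E (\<lambda>k. v k * \<psi> k)"
      if \<psi>: "coarse.poly_bounded \<psi>" for \<psi>
    proof -
      have "(\<integral>\<omega>. u (atom_counts ?T \<omega>) * \<psi> (atom_counts \<S> \<omega>) \<partial>P) =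
        (\<integral>\<omega>. u (atom_counts ?T \<omega>) * \<psi> (c.merge_counts (atom_counts ?T \<omega>)) \<partial>P)"
      proof (rule integral_cong_AE)
        show "AE \<omega> in P. u (atom_counts ?T \<omega>) * \<psi> (atom_counts \<S> \<omega>) =
            u (atom_counts ?T \<omega>) * \<psi> (c.merge_counts (atom_counts ?T \<omega>))"
          using co(2) by eventually_elim simp
        show "(\<lambda>\<omega>. u (atom_counts ?T \<omega>) * \<psi> (atom_counts \<S> \<omega>)) \<in> borel_measurable P"
          by (intro borel_measurable_times integrable_power_counts(1) T S pu \<psi>)
        show "(\<lambda>\<omega>. u (atom_counts ?T \<omega>) * \<psi> (c.merge_counts (atom_counts ?T \<omega>))) \<in> borel_measurable P"
          by (rule borel_measurable_cell_counts [OF finite_cells_atoms [OF T]]) auto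
      qed
      also have "\<dots> = c.fine.E (\<lambda>k. u k * \<psi> (c.merge_counts k))"
        by (rule integral_counts_pmf(1) [OF finite_cells_atoms [OF T], symmetric])
      finally show ?thesis using v(2) [OF \<psi>] by simp
    qed
    with v(1) u(2) integrable_power_counts [OF T pu] show ?thesis
      by (intro exI [of _ v] exI [of _ "\<lambda>\<omega>. u (atom_counts ?T \<omega>)"]) auto
  qed
  then obtain v where "\<forall>l. \<exists>U. ?R l (v l) U"
    using choice [of "\<lambda>l v. \<exists>U. ?R l v U"] by blast
  then obtain U where "\<forall>l. ?R l (v l) (U l)"
    using choice [of "\<lambda>l U. ?R l (v l) U"] by blast
  then have v: "\<And>l. chaos (atoms \<S>) (measure \<mu>) m (v l)"
    and Um [measurable]: "\<And>l. U l \<in> borel_measurable P" and U2: "\<And>l. integrable P (\<lambda>\<omega>. (U l \<omega>)\<^sup>2)"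
    and UA: "\<And>l. AE \<omega> in P. elementary_integral \<mu> (\<eta> \<omega>) m (N l) (A l) (a l) = U l \<omega>"
    and Uv: "\<And>l \<psi>. coarse.poly_bounded \<psi> \<Longrightarrow>
      (\<integral>\<omega>. U l \<omega> * \<psi> (atom_counts \<S> \<omega>) \<partial>P) = coarse.E (\<lambda>k. v l k * \<psi> k)"
    by blast+
  have D2: "integrable P (\<lambda>\<omega>. (U l \<omega> - X \<omega>)\<^sup>2)" for l
    by (rule integrable_square_diff [OF Um Xm U2 X2])
  have conv': "(\<lambda>l. \<integral>\<omega>. (U l \<omega> - X \<omega>)\<^sup>2 \<partial>P) \<longlonglongrightarrow> 0"
  proof -
    have "(\<integral>\<^sup>+ \<omega>. ennreal ((elementary_integral \<mu> (\<eta> \<omega>) m (N l) (A l) (a l) - X \<omega>)\<^sup>2) \<partial>P) =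
      ennreal (\<integral>\<omega>. (U l \<omega> - X \<omega>)\<^sup>2 \<partial>P)" for l
    proof -
      have "(\<integral>\<^sup>+ \<omega>. ennreal ((elementary_integral \<mu> (\<eta> \<omega>) m (N l) (A l) (a l) - X \<omega>)\<^sup>2) \<partial>P) =
        (\<integral>\<^sup>+ \<omega>. ennreal ((U l \<omega> - X \<omega>)\<^sup>2) \<partial>P)"
        by (rule nn_integral_cong_AE) (use UA [of l] in eventually_elim, simp)
      also have "\<dots> = ennreal (\<integral>\<omega>. (U l \<omega> - X \<omega>)\<^sup>2 \<partial>P)"
        by (rule nn_integral_eq_integral [OF D2]) auto
      finally show ?thesis .
    qed
    with conv have "(\<lambda>l. ennreal (\<integral>\<omega>. (U l \<omega> - X \<omega>)\<^sup>2 \<partial>P)) \<longlonglongrightarrow> ennreal 0"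
      by (simp add: L2_converges_def)
    then show ?thesis by (rule tendsto_ennrealD) auto
  qed
  have lim: "(\<lambda>l. coarse.E (\<lambda>k. v l k * \<psi> k)) \<longlonglongrightarrow> (\<integral>\<omega>. X \<omega> * \<psi> (atom_counts \<S> \<omega>) \<partial>P)"
    if \<psi>: "coarse.poly_bounded \<psi>" for \<psi>
  proof -
    note s = integrable_power_counts [OF S \<psi>]
    have "(\<lambda>l. \<integral>\<omega>. (U l \<omega> - X \<omega>) * \<psi> (atom_counts \<S> \<omega>) \<partial>P) \<longlonglongrightarrow> 0"
      by (rule L2_pairing_tendsto_0 [OF _ s(1) D2 conv' s(2)]) auto
    moreover have "(\<integral>\<omega>. (U l \<omega> - X \<omega>) * \<psi> (atom_counts \<S> \<omega>) \<partial>P) =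
      coarse.E (\<lambda>k. v l k * \<psi> k) - (\<integral>\<omega>. X \<omega> * \<psi> (atom_counts \<S> \<omega>) \<partial>P)" for l
      unfolding left_diff_distrib Uv [OF \<psi>, symmetric]
      by (intro Bochner_Integration.integral_diff integrable_product_of_squares s Um Xm U2 X2)
    ultimately show ?thesis by (simp add: LIM_zero_iff)
  qed
  obtain w where w: "chaos (atoms \<S>) (measure \<mu>) m w"
    "\<And>\<psi>. coarse.poly_bounded \<psi> \<Longrightarrow> (\<lambda>l. coarse.E (\<lambda>k. v l k * \<psi> k)) \<longlonglongrightarrow> coarse.E (\<lambda>k. w k * \<psi> k)"
    using coarse.chaos_weak_limit [of m v] v lim unfolding convergent_def by blast
  show ?thesis
  proof (rule that [OF w(1)])
    fix \<psi> assume \<psi>: "coarse.poly_bounded \<psi>"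
    have "(\<integral>\<omega>. X \<omega> * \<psi> (atom_counts \<S> \<omega>) \<partial>P) = coarse.E (\<lambda>k. w k * \<psi> k)"
      by (rule LIMSEQ_unique [OF lim [OF \<psi>] w(2) [OF \<psi>]])
    also have "\<dots> = (\<integral>\<omega>. w (atom_counts \<S> \<omega>) * \<psi> (atom_counts \<S> \<omega>) \<partial>P)"
      by (rule integral_counts_pmf(1) [OF fcS])
    finally show "(\<integral>\<omega>. X \<omega> * \<psi> (atom_counts \<S> \<omega>) \<partial>P) =
      (\<integral>\<omega>. w (atom_counts \<S> \<omega>) * \<psi> (atom_counts \<S> \<omega>) \<partial>P)" .
  qed
qed

end

section \<open>Approximation in fourth mean\<close>

context poisson_random_measure
begin

text \<open>The truncation \<tau> of a good elementary integral is close to \<open>X\<close> in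
  fourth mean. The projection \<open>v\<close> of \<open>X\<close> is at least comparably close,
  because \<open>v - \<tau>\<close> is the conditional expectation of \<open>X - \<tau>\<close>.
  Every larger family of sets works too, so two variables can later share one partition.\<close>

lemma multiple_integral_L4_approximation:
  assumes X: "has_multiple_poisson_integral P \<mu> \<eta> m f X"
    and X4: "integrable P (\<lambda>\<omega>. X \<omega> ^ 4)" and \<epsilon>: "\<epsilon> > 0"
  obtains \<S>0 where "finite_sets \<mu> \<S>0"
    "\<And>\<S>. finite_sets \<mu> \<S> \<Longrightarrow> \<S>0 \<subseteq> \<S> \<Longrightarrow>
      \<exists>v. chaos (atoms \<S>) (measure \<mu>) m v \<and> (\<integral>\<omega>. (X \<omega> - v (atom_counts \<S> \<omega>)) ^ 4 \<partial>P) \<le> \<epsilon>"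
proof -
  from X obtain N A a where sq: "square_integrable P X" and cells: "\<And>k. kernel_cells \<mu> (N k) (A k)"
    and conv: "L2_converges P (\<lambda>k \<omega>. elementary_integral \<mu> (\<eta> \<omega>) m (N k) (A k) (a k)) X"
    unfolding has_multiple_poisson_integral_def by blast
  have Xm [measurable]: "X \<in> borel_measurable P" and X2: "integrable P (\<lambda>\<omega>. (X \<omega>)\<^sup>2)"
    using sq by (auto simp: square_integrable_def)
  \<comment> \<open>The inequality for fourth powers of sums is used twice with factor 8 and two
    terms: two errors of \<open>\<epsilon> / 256\<close> give \<open>\<epsilon> / 16\<close>, and
    two of these give \<epsilon>.\<close>
  have "eventually (\<lambda>n. (\<integral>\<omega>. (X \<omega> - truncate (real n) (X \<omega>)) ^ 4 \<partial>P) < \<epsilon> / 256) sequentially"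
    using truncation_tendsto [OF Xm X4] \<epsilon> by (intro order_tendstoD) auto
  then obtain n where n: "(\<integral>\<omega>. (X \<omega> - truncate (real n) (X \<omega>)) ^ 4 \<partial>P) < \<epsilon> / 256"
    by (auto simp: eventually_sequentially)
  define M where "M = real n"
  have M: "M \<ge> 0" by (simp add: M_def)
  \<comment> \<open>The difference of two truncations is at most \<open>2 * M\<close> and at most
    the original difference, so its fourth power is at most \<open>4 * M\<^sup>2\<close> times the
    squared difference. Adding 1 covers \<open>M = 0\<close>.\<close>
  define \<delta> where "\<delta> = \<epsilon> / (256 * (4 * M\<^sup>2 + 1))"
  have \<delta>: "\<delta> > 0" using \<epsilon> unfolding \<delta>_def by (intro divide_pos_pos mult_pos_pos add_nonneg_pos) auto
  have \<delta>M: "4 * M\<^sup>2 * \<delta> \<le> \<epsilon> / 256"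
  proof -
    have "4 * M\<^sup>2 * \<delta> \<le> (4 * M\<^sup>2 + 1) * \<delta>" using \<delta> by (simp add: algebra_simps)
    also have "\<dots> = \<epsilon> / 256"
    proof -
      have "4 * M\<^sup>2 + 1 \<noteq> 0" by (simp add: add_nonneg_eq_0_iff)
      then show ?thesis unfolding \<delta>_def by (simp add: field_simps)
    qed
    finally show ?thesis .
  qed
  have "eventually (\<lambda>l. (\<integral>\<^sup>+ \<omega>. ennreal ((elementary_integral \<mu> (\<eta> \<omega>) m (N l) (A l) (a l) - X \<omega>)\<^sup>2) \<partial>P)
      < ennreal \<delta>) sequentially"
    using conv \<delta> unfolding L2_converges_def by (intro order_tendstoD) auto
  then obtain l where l: "(\<integral>\<^sup>+ \<omega>. ennreal ((elementary_integral \<mu> (\<eta> \<omega>) m (N l) (A l) (a l) - X \<omega>)\<^sup>2) \<partial>P)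
      < ennreal \<delta>"
    by (auto simp: eventually_sequentially)
  show ?thesis
  proof (rule that [of "A l ` {..<N l}"])
    show "finite_sets \<mu> (A l ` {..<N l})" by (rule finite_sets_kernel_cells [OF cells])
    fix \<S> assume S: "finite_sets \<mu> \<S>" and sub: "A l ` {..<N l} \<subseteq> \<S>"
    interpret poisson_counts "atoms \<S>" "measure \<mu>" "atom_pmf \<S>" by (rule poisson_counts_atoms [OF S])
    obtain u where u: "chaos (atoms \<S>) (measure \<mu>) m u"
      "AE \<omega> in P. elementary_integral \<mu> (\<eta> \<omega>) m (N l) (A l) (a l) = u (atom_counts \<S> \<omega>)"
      by (rule elementary_integral_atoms [OF S cells sub])
    obtain v where v: "chaos (atoms \<S>) (measure \<mu>) m v"
      "\<And>\<psi>. poly_bounded \<psi> \<Longrightarrow>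
        (\<integral>\<omega>. X \<omega> * \<psi> (atom_counts \<S> \<omega>) \<partial>P) = (\<integral>\<omega>. v (atom_counts \<S> \<omega>) * \<psi> (atom_counts \<S> \<omega>) \<partial>P)"
      using multiple_integral_projection [OF X S] by blast
    define \<tau> where "\<tau> k = truncate M (u k)" for k
    define w where "w k = v k - \<tau> k" for k
    have p\<tau>: "poly_bounded \<tau>"
      by (rule poly_boundedI [of M _ 0]) (use M in \<open>auto simp: \<tau>_def intro: truncate_bounded\<close>)
    have pw: "poly_bounded w" unfolding w_def [abs_def]
      by (intro poly_bounded_diff p\<tau> poly_bounded_chaos [OF v(1)])
    have pw3: "poly_bounded (\<lambda>k. w k ^ 3)" by (rule poly_bounded_power [OF pw])
    let ?K = "atom_counts \<S>"
    note um = integrable_power_counts [OF S poly_bounded_chaos [OF u(1)]]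
      and vm = integrable_power_counts [OF S poly_bounded_chaos [OF v(1)]]
      and \<tau>m = integrable_power_counts [OF S p\<tau>]
      and wm = integrable_power_counts [OF S pw]
      and w3m = integrable_power_counts [OF S pw3]
    have D4: "integrable P (\<lambda>\<omega>. (X \<omega> - \<tau> (?K \<omega>)) ^ 4)"
      by (rule integrable_fourth_power_diff [OF Xm \<tau>m(1) X4 \<tau>m(2)])
    have uX2: "integrable P (\<lambda>\<omega>. (X \<omega> - u (?K \<omega>))\<^sup>2)"
      by (rule integrable_square_diff [OF Xm um(1) X2 um(2)])
    have "(\<integral>\<^sup>+ \<omega>. ennreal ((elementary_integral \<mu> (\<eta> \<omega>) m (N l) (A l) (a l) - X \<omega>)\<^sup>2) \<partial>P) =
      (\<integral>\<^sup>+ \<omega>. ennreal ((X \<omega> - u (?K \<omega>))\<^sup>2) \<partial>P)"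
      by (rule nn_integral_cong_AE) (use u(2) in eventually_elim, simp add: power2_commute)
    also have "\<dots> = ennreal (\<integral>\<omega>. (X \<omega> - u (?K \<omega>))\<^sup>2 \<partial>P)"
      by (rule nn_integral_eq_integral [OF uX2]) auto
    finally have d2: "(\<integral>\<omega>. (X \<omega> - u (?K \<omega>))\<^sup>2 \<partial>P) < \<delta>"
      using l \<delta> by (simp add: ennreal_less_iff)
    have tm: "(\<lambda>\<omega>. X \<omega> - truncate M (X \<omega>)) \<in> borel_measurable P"
      "(\<lambda>\<omega>. truncate M (X \<omega>) - \<tau> (?K \<omega>)) \<in> borel_measurable P"
      using \<tau>m(1) by measurable
    have t4: "integrable P (\<lambda>\<omega>. (X \<omega> - truncate M (X \<omega>)) ^ 4)"
    proof (rule Bochner_Integration.integrable_bound [OF X4])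
      show "AE \<omega> in P. norm ((X \<omega> - truncate M (X \<omega>)) ^ 4) \<le> norm (X \<omega> ^ 4)"
      proof (intro AE_I2)
        fix \<omega>
        have "\<bar>X \<omega> - truncate M (X \<omega>)\<bar> ^ 4 \<le> \<bar>X \<omega>\<bar> ^ 4"
          by (intro power_mono truncate_diff_le M) auto
        then show "norm ((X \<omega> - truncate M (X \<omega>)) ^ 4) \<le> norm (X \<omega> ^ 4)" by simp
      qed
    qed auto
    have tt: "(truncate M (X \<omega>) - \<tau> (?K \<omega>)) ^ 4 \<le> 4 * M\<^sup>2 * (X \<omega> - u (?K \<omega>))\<^sup>2" for \<omega>
    proof -
      have 1: "\<bar>truncate M (X \<omega>) - \<tau> (?K \<omega>)\<bar> \<le> 2 * M"
        using truncate_bounded [OF M, of "X \<omega>"] truncate_bounded [OF M, of "u (?K \<omega>)"] by (simp add: \<tau>_def)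
      have 2: "\<bar>truncate M (X \<omega>) - \<tau> (?K \<omega>)\<bar> \<le> \<bar>X \<omega> - u (?K \<omega>)\<bar>"
        unfolding \<tau>_def by (rule truncate_lipschitz)
      have "\<bar>truncate M (X \<omega>) - \<tau> (?K \<omega>)\<bar>\<^sup>2 * \<bar>truncate M (X \<omega>) - \<tau> (?K \<omega>)\<bar>\<^sup>2 \<le> (2 * M)\<^sup>2 * \<bar>X \<omega> - u (?K \<omega>)\<bar>\<^sup>2"
        by (intro mult_mono power_mono 1 2) auto
      then show ?thesis by (simp add: power_mult_distrib flip: power_add)
    qed
    have tt4: "integrable P (\<lambda>\<omega>. (truncate M (X \<omega>) - \<tau> (?K \<omega>)) ^ 4)"
      by (rule Bochner_Integration.integrable_bound [of _ "\<lambda>\<omega>. 4 * M\<^sup>2 * (X \<omega> - u (?K \<omega>))\<^sup>2"])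
        (use uX2 tm tt in \<open>auto intro!: AE_I2 order_trans [OF tt]\<close>)
    have "(\<integral>\<omega>. (truncate M (X \<omega>) - \<tau> (?K \<omega>)) ^ 4 \<partial>P) \<le> (\<integral>\<omega>. 4 * M\<^sup>2 * (X \<omega> - u (?K \<omega>))\<^sup>2 \<partial>P)"
      by (rule integral_mono [OF tt4 _ tt]) (use uX2 in auto)
    also have "\<dots> = 4 * M\<^sup>2 * (\<integral>\<omega>. (X \<omega> - u (?K \<omega>))\<^sup>2 \<partial>P)" by simp
    also have "\<dots> \<le> 4 * M\<^sup>2 * \<delta>" using d2 by (intro mult_left_mono) auto
    finally have b2: "(\<integral>\<omega>. (truncate M (X \<omega>) - \<tau> (?K \<omega>)) ^ 4 \<partial>P) \<le> \<epsilon> / 256"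
      using \<delta>M by linarith
    have "(\<integral>\<omega>. (X \<omega> - \<tau> (?K \<omega>)) ^ 4 \<partial>P) =
      (\<integral>\<omega>. ((X \<omega> - truncate M (X \<omega>)) + (truncate M (X \<omega>) - \<tau> (?K \<omega>))) ^ 4 \<partial>P)" by simp
    also have "\<dots> \<le> 8 * ((\<integral>\<omega>. (X \<omega> - truncate M (X \<omega>)) ^ 4 \<partial>P) + (\<integral>\<omega>. (truncate M (X \<omega>) - \<tau> (?K \<omega>)) ^ 4 \<partial>P))"
      by (rule integrable_fourth_power_add(2) [OF tm t4 tt4])
    finally have D: "(\<integral>\<omega>. (X \<omega> - \<tau> (?K \<omega>)) ^ 4 \<partial>P) \<le> \<epsilon> / 16"
      using n b2 by (simp add: M_def)
    have iX: "integrable P (\<lambda>\<omega>. X \<omega> * w (?K \<omega>) ^ 3)" and iv: "integrable P (\<lambda>\<omega>. v (?K \<omega>) * w (?K \<omega>) ^ 3)"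
      and i\<tau>: "integrable P (\<lambda>\<omega>. \<tau> (?K \<omega>) * w (?K \<omega>) ^ 3)"
      by (rule integrable_product_of_squares [OF Xm w3m(1) X2 w3m(2)]
          integrable_product_of_squares [OF vm(1) w3m(1) vm(2) w3m(2)]
          integrable_product_of_squares [OF \<tau>m(1) w3m(1) \<tau>m(2) w3m(2)])+
    \<comment> \<open>Contraction in fourth mean by testing against \<open>w ^ 3\<close>, a function
      of the counts, where \<open>v\<close> may be replaced by \<open>X\<close>. Young's inequality
      then puts three quarters of the fourth moment of \<open>w\<close> on the right, and it is
      absorbed.\<close>
    have "(\<integral>\<omega>. w (?K \<omega>) ^ 4 \<partial>P) = (\<integral>\<omega>. v (?K \<omega>) * w (?K \<omega>) ^ 3 - \<tau> (?K \<omega>) * w (?K \<omega>) ^ 3 \<partial>P)"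
    proof (intro Bochner_Integration.integral_cong refl)
      show "w (?K \<omega>) ^ 4 = v (?K \<omega>) * w (?K \<omega>) ^ 3 - \<tau> (?K \<omega>) * w (?K \<omega>) ^ 3" for \<omega>
        unfolding w_def by algebra
    qed
    also have "\<dots> = (\<integral>\<omega>. v (?K \<omega>) * w (?K \<omega>) ^ 3 \<partial>P) - (\<integral>\<omega>. \<tau> (?K \<omega>) * w (?K \<omega>) ^ 3 \<partial>P)"
      by (rule Bochner_Integration.integral_diff [OF iv i\<tau>])
    also have "(\<integral>\<omega>. v (?K \<omega>) * w (?K \<omega>) ^ 3 \<partial>P) = (\<integral>\<omega>. X \<omega> * w (?K \<omega>) ^ 3 \<partial>P)"
      by (rule v(2) [OF pw3, symmetric])
    also have "\<dots> - (\<integral>\<omega>. \<tau> (?K \<omega>) * w (?K \<omega>) ^ 3 \<partial>P) = (\<integral>\<omega>. X \<omega> * w (?K \<omega>) ^ 3 - \<tau> (?K \<omega>) * w (?K \<omega>) ^ 3 \<partial>P)"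
      by (rule Bochner_Integration.integral_diff [OF iX i\<tau>, symmetric])
    also have "\<dots> \<le> (\<integral>\<omega>. (X \<omega> - \<tau> (?K \<omega>)) ^ 4 / 4 + 3 * w (?K \<omega>) ^ 4 / 4 \<partial>P)"
    proof (rule integral_mono)
      show "X \<omega> * w (?K \<omega>) ^ 3 - \<tau> (?K \<omega>) * w (?K \<omega>) ^ 3 \<le> (X \<omega> - \<tau> (?K \<omega>)) ^ 4 / 4 + 3 * w (?K \<omega>) ^ 4 / 4" for \<omega>
        unfolding left_diff_distrib [symmetric] by (rule young_fourth_power)
    qed (use iX i\<tau> D4 wm in auto)
    also have "\<dots> = (\<integral>\<omega>. (X \<omega> - \<tau> (?K \<omega>)) ^ 4 \<partial>P) / 4 + 3 * (\<integral>\<omega>. w (?K \<omega>) ^ 4 \<partial>P) / 4"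
      using D4 wm by simp
    finally have w4: "(\<integral>\<omega>. w (?K \<omega>) ^ 4 \<partial>P) \<le> (\<integral>\<omega>. (X \<omega> - \<tau> (?K \<omega>)) ^ 4 \<partial>P)" by simp
    have "(\<integral>\<omega>. (X \<omega> - v (?K \<omega>)) ^ 4 \<partial>P) = (\<integral>\<omega>. ((X \<omega> - \<tau> (?K \<omega>)) - w (?K \<omega>)) ^ 4 \<partial>P)"
      by (simp add: w_def)
    also have "\<dots> \<le> 8 * ((\<integral>\<omega>. (X \<omega> - \<tau> (?K \<omega>)) ^ 4 \<partial>P) + (\<integral>\<omega>. w (?K \<omega>) ^ 4 \<partial>P))"
      by (rule integrable_fourth_power_diff(2) [OF _ wm(1) D4 wm(2)]) (use \<tau>m in auto)
    also have "\<dots> \<le> \<epsilon>" using D w4 by simp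
    finally show "\<exists>v. chaos (atoms \<S>) (measure \<mu>) m v \<and> (\<integral>\<omega>. (X \<omega> - v (?K \<omega>)) ^ 4 \<partial>P) \<le> \<epsilon>"
      using v(1) by blast
  qed
qed

end

text \<open>Let \<open>m\<close> dominate all values and 1, and let \<open>d\<close> dominate all
  increments. Each difference is then at most \<open>4 * (d * m ^ 3)\<close>; the 1 in
  \<open>m\<close> covers the differences of lower degree. Expanding \<open>m ^ 4\<close> by four
  nested fourth power inequalities gives \<open>4096 = 8 ^ 4\<close>.\<close>

lemma fourth_degree_differences:
  fixes x y u v \<theta> :: real
  assumes "\<theta> > 0"
  defines "H \<equiv> 4 * (\<theta> * (4096 * (1 + x ^ 4 + y ^ 4 + (x - u) ^ 4 + (y - v) ^ 4)) + 8 * ((x - u) ^ 4 + (y - v) ^ 4) / \<theta> ^ 3)"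
  shows "\<bar>x ^ 3 * y - u ^ 3 * v\<bar> \<le> H" and "\<bar>x * y ^ 3 - u * v ^ 3\<bar> \<le> H"
    and "\<bar>(x + y) ^ 4 - (u + v) ^ 4\<bar> \<le> H" and "\<bar>(x + y)\<^sup>2 - (u + v)\<^sup>2\<bar> \<le> H"
    and "\<bar>(x + y) - (u + v)\<bar> \<le> H"
proof -
  define d where "d = \<bar>x - u\<bar> + \<bar>y - v\<bar>"
  define m where "m = 1 + (\<bar>x\<bar> + (\<bar>y\<bar> + d))"
  have d0: "0 \<le> d" and m1: "1 \<le> m" by (auto simp: d_def m_def)
  have b: "\<bar>x\<bar> \<le> m" "\<bar>y\<bar> \<le> m" "\<bar>u\<bar> \<le> m" "\<bar>v\<bar> \<le> m" "\<bar>x + y\<bar> \<le> m" "\<bar>u + v\<bar> \<le> m"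
    "\<bar>x - u\<bar> \<le> d" "\<bar>y - v\<bar> \<le> d" "\<bar>(x + y) - (u + v)\<bar> \<le> d"
    by (auto simp: d_def m_def)
  have mp: "0 \<le> m" using m1 by simp
  have d4: "d ^ 4 \<le> 8 * ((x - u) ^ 4 + (y - v) ^ 4)"
    using fourth_power_add_le [of "\<bar>x - u\<bar>" "\<bar>y - v\<bar>"] by (simp add: d_def)
  have m4: "m ^ 4 \<le> 4096 * (1 + x ^ 4 + y ^ 4 + (x - u) ^ 4 + (y - v) ^ 4)"
  proof -
    have "m ^ 4 \<le> 8 * (1 + (\<bar>x\<bar> + (\<bar>y\<bar> + d)) ^ 4)"
      unfolding m_def using fourth_power_add_le [of 1] by simp
    moreover have "(\<bar>x\<bar> + (\<bar>y\<bar> + d)) ^ 4 \<le> 8 * (x ^ 4 + (\<bar>y\<bar> + d) ^ 4)"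
      using fourth_power_add_le [of "\<bar>x\<bar>"] by simp
    moreover have "(\<bar>y\<bar> + d) ^ 4 \<le> 8 * (y ^ 4 + d ^ 4)"
      using fourth_power_add_le [of "\<bar>y\<bar>"] by simp
    moreover have "0 \<le> x ^ 4" "0 \<le> y ^ 4" "0 \<le> (x - u) ^ 4" "0 \<le> (y - v) ^ 4" by simp_all
    ultimately show ?thesis using d4 by (simp only: distrib_left)
  qed
  \<comment> \<open>If \<open>d\<close> is small relative to \<open>m\<close>, a factor
    \<open>d\<close> is replaced by \<open>\<theta> * m\<close>; otherwise three factors
    \<open>m\<close> are replaced by \<open>d / \<theta>\<close>.\<close>
  have dm: "d * m ^ 3 \<le> \<theta> * m ^ 4 + d ^ 4 / \<theta> ^ 3"
  proof (cases "d \<le> \<theta> * m")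
    case True
    then have "d * m ^ 3 \<le> (\<theta> * m) * m ^ 3" using mp by (intro mult_right_mono) auto
    also have "\<dots> = \<theta> * m ^ 4" by algebra
    finally show ?thesis using assms d0 by (simp add: add_increasing2)
  next
    case False
    then have "m \<le> d / \<theta>" using assms by (simp add: field_simps)
    then have "d * m ^ 3 \<le> d * (d / \<theta>) ^ 3" using mp d0 by (intro mult_left_mono power_mono) auto
    also have "\<dots> = d ^ 4 / \<theta> ^ 3" by (simp add: power_divide power4_eq_xxxx power3_eq_cube)
    finally show ?thesis using assms mp by (simp add: add_increasing)
  qed
  have H: "4 * (d * m ^ 3) \<le> H"
  proof -
    have "\<theta> * m ^ 4 + d ^ 4 / \<theta> ^ 3 \<le> \<theta> * (4096 * (1 + x ^ 4 + y ^ 4 + (x - u) ^ 4 + (y - v) ^ 4)) + 8 * ((x - u) ^ 4 + (y - v) ^ 4) / \<theta> ^ 3"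
      using assms(1) m4 d4 by (intro add_mono mult_left_mono divide_right_mono) auto
    from order_trans [OF dm this] show ?thesis unfolding H_def by (rule mult_left_mono) simp
  qed
  have cube: "\<bar>s ^ 3 * r - s' ^ 3 * r'\<bar> \<le> 4 * (d * m ^ 3)"
    if "\<bar>s\<bar> \<le> m" "\<bar>r\<bar> \<le> m" "\<bar>s'\<bar> \<le> m" "\<bar>s - s'\<bar> \<le> d" "\<bar>r - r'\<bar> \<le> d" for s r s' r'
  proof -
    have "s ^ 3 * r - s' ^ 3 * r' = (s - s') * ((s * s + s * s' + s' * s') * r) + (r - r') * (s' * s' * s')"
      by algebra
    also have "\<bar>\<dots>\<bar> \<le> \<bar>s - s'\<bar> * ((\<bar>s\<bar> * \<bar>s\<bar> + \<bar>s\<bar> * \<bar>s'\<bar> + \<bar>s'\<bar> * \<bar>s'\<bar>) * \<bar>r\<bar>) + \<bar>r - r'\<bar> * (\<bar>s'\<bar> * \<bar>s'\<bar> * \<bar>s'\<bar>)"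
      by (intro order_trans [OF abs_triangle_ineq] add_mono)
        (auto simp: abs_mult intro!: mult_left_mono mult_right_mono order_trans [OF abs_triangle_ineq] add_mono)
    also have "\<dots> \<le> d * ((m * m + m * m + m * m) * m) + d * (m * m * m)"
      using that mp d0 by (intro add_mono mult_mono) auto
    also have "\<dots> = 4 * (d * m ^ 3)" by algebra
    finally show ?thesis .
  qed
  show "\<bar>x ^ 3 * y - u ^ 3 * v\<bar> \<le> H"
    by (rule order_trans [OF cube [OF b(1,2,3,7,8)] H])
  show "\<bar>x * y ^ 3 - u * v ^ 3\<bar> \<le> H"
    using order_trans [OF cube [OF b(2,1,4,8,7)] H] by (simp only: mult.commute)
  have "s ^ 4 = s ^ 3 * s" for s :: real by algebra
  then show "\<bar>(x + y) ^ 4 - (u + v) ^ 4\<bar> \<le> H"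
    using order_trans [OF cube [OF b(5,5,6,9,9)] H] by simp
  have m0: "d \<le> d * m ^ 3" and m2: "d * m \<le> d * m ^ 3"
    using mult_left_mono [OF one_le_power [OF m1, of 3] d0]
      mult_left_mono [OF power_increasing [OF _ m1, of 1 3] d0] by simp_all
  have "\<bar>(x + y) + (u + v)\<bar> \<le> 2 * m" using b(5,6) by linarith
  then have "\<bar>(x + y) - (u + v)\<bar> * \<bar>(x + y) + (u + v)\<bar> \<le> d * (2 * m)"
    using b(9) d0 by (intro mult_mono) auto
  moreover have "(x + y)\<^sup>2 - (u + v)\<^sup>2 = ((x + y) - (u + v)) * ((x + y) + (u + v))" by algebra
  ultimately have "\<bar>(x + y)\<^sup>2 - (u + v)\<^sup>2\<bar> \<le> 2 * (d * m)"
    by (simp add: abs_mult)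
  moreover have "0 \<le> d * m ^ 3" using d0 mp by simp
  ultimately show "\<bar>(x + y)\<^sup>2 - (u + v)\<^sup>2\<bar> \<le> H" using m2 H by linarith
  show "\<bar>(x + y) - (u + v)\<bar> \<le> H" using b(9) m0 H \<open>0 \<le> d * m ^ 3\<close> by linarith
qed

lemma (in prob_space) fourth_moment_continuity:
  assumes [measurable]: "X \<in> borel_measurable M" "Y \<in> borel_measurable M"
    and X4: "integrable M (\<lambda>\<omega>. X \<omega> ^ 4)" and Y4: "integrable M (\<lambda>\<omega>. Y \<omega> ^ 4)" and \<delta>: "(\<delta>::real) > 0"
  obtains \<epsilon> where "\<epsilon> > 0"
    "\<And>U V. \<lbrakk>U \<in> borel_measurable M; V \<in> borel_measurable M;
      integrable M (\<lambda>\<omega>. U \<omega> ^ 4); integrable M (\<lambda>\<omega>. V \<omega> ^ 4);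
      expectation (\<lambda>\<omega>. (X \<omega> - U \<omega>) ^ 4) \<le> \<epsilon>; expectation (\<lambda>\<omega>. (Y \<omega> - V \<omega>) ^ 4) \<le> \<epsilon>\<rbrakk> \<Longrightarrow>
      \<bar>expectation (\<lambda>\<omega>. X \<omega> ^ 3 * Y \<omega>) - expectation (\<lambda>\<omega>. U \<omega> ^ 3 * V \<omega>)\<bar> \<le> \<delta> \<and>
      \<bar>expectation (\<lambda>\<omega>. X \<omega> * Y \<omega> ^ 3) - expectation (\<lambda>\<omega>. U \<omega> * V \<omega> ^ 3)\<bar> \<le> \<delta> \<and>
      \<bar>expectation (\<lambda>\<omega>. (X \<omega> + Y \<omega>) ^ 4) - expectation (\<lambda>\<omega>. (U \<omega> + V \<omega>) ^ 4)\<bar> \<le> \<delta> \<and>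
      \<bar>expectation (\<lambda>\<omega>. (X \<omega> + Y \<omega>)\<^sup>2) - expectation (\<lambda>\<omega>. (U \<omega> + V \<omega>)\<^sup>2)\<bar> \<le> \<delta> \<and>
      expectation (\<lambda>\<omega>. \<bar>X \<omega> + Y \<omega> - (U \<omega> + V \<omega>)\<bar>) \<le> \<delta>"
proof -
  \<comment> \<open>The 3 consists of the constant 1 in the bound \<open>H\<close> and of the two
    fourth mean errors, each at most \<open>\<epsilon> \<le> 1\<close>.\<close>
  define C where "C = 3 + expectation (\<lambda>\<omega>. X \<omega> ^ 4) + expectation (\<lambda>\<omega>. Y \<omega> ^ 4)"
  have C: "C > 0" unfolding C_def by (intro add_pos_nonneg) auto
  \<comment> \<open>The choices of \<theta> and \<epsilon> make each of the two parts of the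
    expectation of \<open>H\<close> at most \<open>\<delta> / 2\<close>: first
    \<open>4 * 4096 * \<theta> * C\<close>, then
    \<open>4 * 8 * 2 * \<epsilon> / \<theta> ^ 3\<close>.\<close>
  define \<theta> where "\<theta> = \<delta> / (32768 * C)"
  have \<theta>: "\<theta> > 0" using \<delta> C by (simp add: \<theta>_def)
  define \<epsilon> where "\<epsilon> = min 1 (\<delta> * \<theta> ^ 3 / 128)"
  have \<epsilon>: "\<epsilon> > 0" "\<epsilon> \<le> 1" "\<epsilon> \<le> \<delta> * \<theta> ^ 3 / 128" using \<delta> \<theta> by (auto simp: \<epsilon>_def)
  show ?thesis
  proof (rule that [OF \<epsilon>(1)])
    fix U V assume [measurable]: "U \<in> borel_measurable M" "V \<in> borel_measurable M"
      and U4: "integrable M (\<lambda>\<omega>. U \<omega> ^ 4)" and V4: "integrable M (\<lambda>\<omega>. V \<omega> ^ 4)"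
      and XU: "expectation (\<lambda>\<omega>. (X \<omega> - U \<omega>) ^ 4) \<le> \<epsilon>" and YV: "expectation (\<lambda>\<omega>. (Y \<omega> - V \<omega>) ^ 4) \<le> \<epsilon>"
    have XU4: "integrable M (\<lambda>\<omega>. (X \<omega> - U \<omega>) ^ 4)" and YV4: "integrable M (\<lambda>\<omega>. (Y \<omega> - V \<omega>) ^ 4)"
      by (intro integrable_fourth_power_diff X4 Y4 U4 V4; measurable)+
    define H where "H \<omega> = 4 * (\<theta> * (4096 * (1 + X \<omega> ^ 4 + Y \<omega> ^ 4 + (X \<omega> - U \<omega>) ^ 4 + (Y \<omega> - V \<omega>) ^ 4)) +
      8 * ((X \<omega> - U \<omega>) ^ 4 + (Y \<omega> - V \<omega>) ^ 4) / \<theta> ^ 3)" for \<omega>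
    have iH: "integrable M H" unfolding H_def [abs_def] using X4 Y4 XU4 YV4 by auto
    let ?a = "expectation (\<lambda>\<omega>. (X \<omega> - U \<omega>) ^ 4)" and ?b = "expectation (\<lambda>\<omega>. (Y \<omega> - V \<omega>) ^ 4)"
    have "expectation H = 4 * (\<theta> * (4096 * (1 + expectation (\<lambda>\<omega>. X \<omega> ^ 4) + expectation (\<lambda>\<omega>. Y \<omega> ^ 4) + ?a + ?b)) + 8 * (?a + ?b) / \<theta> ^ 3)"
      unfolding H_def [abs_def] using X4 Y4 XU4 YV4 by (simp add: prob_space)
    also have "\<dots> \<le> 4 * (\<theta> * (4096 * C) + 8 * (2 * (\<delta> * \<theta> ^ 3 / 128)) / \<theta> ^ 3)"
    proof -
      have 1: "1 + expectation (\<lambda>\<omega>. X \<omega> ^ 4) + expectation (\<lambda>\<omega>. Y \<omega> ^ 4) + ?a + ?b \<le> C"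
        using XU YV \<epsilon>(2) unfolding C_def by linarith
      have 2: "?a + ?b \<le> 2 * (\<delta> * \<theta> ^ 3 / 128)" using XU YV \<epsilon>(3) by linarith
      have "\<theta> * (4096 * (1 + expectation (\<lambda>\<omega>. X \<omega> ^ 4) + expectation (\<lambda>\<omega>. Y \<omega> ^ 4) + ?a + ?b)) \<le> \<theta> * (4096 * C)"
        using \<theta> 1 by (intro mult_left_mono) auto
      moreover have "8 * (?a + ?b) / \<theta> ^ 3 \<le> 8 * (2 * (\<delta> * \<theta> ^ 3 / 128)) / \<theta> ^ 3"
        using \<theta> 2 by (intro divide_right_mono mult_left_mono) auto
      ultimately have "\<theta> * (4096 * (1 + expectation (\<lambda>\<omega>. X \<omega> ^ 4) + expectation (\<lambda>\<omega>. Y \<omega> ^ 4) + ?a + ?b)) +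
          8 * (?a + ?b) / \<theta> ^ 3 \<le> \<theta> * (4096 * C) + 8 * (2 * (\<delta> * \<theta> ^ 3 / 128)) / \<theta> ^ 3"
        by (rule add_mono)
      then show ?thesis by (rule mult_left_mono) simp
    qed
    also have "\<dots> = \<delta>"
      using C \<theta> by (simp add: \<theta>_def)
    finally have EH: "expectation H \<le> \<delta>" .
    have close: "\<bar>expectation f - expectation g\<bar> \<le> \<delta>"
      if "integrable M f" "integrable M g" "\<And>\<omega>. \<bar>f \<omega> - g \<omega>\<bar> \<le> H \<omega>" for f g :: "'a \<Rightarrow> real"
    proof -
      have "\<bar>expectation f - expectation g\<bar> = \<bar>expectation (\<lambda>\<omega>. f \<omega> - g \<omega>)\<bar>" using that by simp
      also have "\<dots> \<le> expectation (\<lambda>\<omega>. \<bar>f \<omega> - g \<omega>\<bar>)" by (rule integral_abs_bound)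
      also have "\<dots> \<le> expectation H" by (rule integral_mono) (use that iH in auto)
      finally show ?thesis using EH by linarith
    qed
    have i31: "integrable M (\<lambda>\<omega>. F \<omega> * G \<omega> ^ 3)"
      if [measurable]: "F \<in> borel_measurable M" "G \<in> borel_measurable M"
        and "integrable M (\<lambda>\<omega>. F \<omega> ^ 4)" "integrable M (\<lambda>\<omega>. G \<omega> ^ 4)" for F G :: "'a \<Rightarrow> real"
    proof (rule Bochner_Integration.integrable_bound)
      show "integrable M (\<lambda>\<omega>. F \<omega> ^ 4 / 4 + 3 * G \<omega> ^ 4 / 4)" using that by auto
      show "AE \<omega> in M. norm (F \<omega> * G \<omega> ^ 3) \<le> norm (F \<omega> ^ 4 / 4 + 3 * G \<omega> ^ 4 / 4)"
      proof (intro AE_I2)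
        fix \<omega>
        have "\<bar>F \<omega>\<bar> * \<bar>G \<omega>\<bar> ^ 3 \<le> \<bar>F \<omega>\<bar> ^ 4 / 4 + 3 * \<bar>G \<omega>\<bar> ^ 4 / 4" by (rule young_fourth_power)
        then show "norm (F \<omega> * G \<omega> ^ 3) \<le> norm (F \<omega> ^ 4 / 4 + 3 * G \<omega> ^ 4 / 4)"
          by (simp add: abs_mult power_abs)
      qed
    qed auto
    have i4: "integrable M (\<lambda>\<omega>. (X \<omega> + Y \<omega>) ^ 4)" "integrable M (\<lambda>\<omega>. (U \<omega> + V \<omega>) ^ 4)"
      by (intro integrable_fourth_power_add X4 Y4 U4 V4; measurable)+
    have i2: "integrable M (\<lambda>\<omega>. (F \<omega>)\<^sup>2)" and i1: "integrable M F"
      if [measurable]: "F \<in> borel_measurable M" and "integrable M (\<lambda>\<omega>. F \<omega> ^ 4)" for F :: "'a \<Rightarrow> real"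
    proof -
      show "integrable M (\<lambda>\<omega>. (F \<omega>)\<^sup>2)"
        by (rule square_integrable_imp_integrable) (use that in \<open>simp_all flip: power_mult\<close>)
      then show "integrable M F" by (rule square_integrable_imp_integrable [OF that(1)])
    qed
    have "\<bar>expectation (\<lambda>\<omega>. X \<omega> ^ 3 * Y \<omega>) - expectation (\<lambda>\<omega>. U \<omega> ^ 3 * V \<omega>)\<bar> \<le> \<delta>"
    proof (rule close)
      show "integrable M (\<lambda>\<omega>. X \<omega> ^ 3 * Y \<omega>)" "integrable M (\<lambda>\<omega>. U \<omega> ^ 3 * V \<omega>)"
        using i31 [of Y X] i31 [of V U] X4 Y4 U4 V4 by (auto simp: mult.commute)
      show "\<bar>X \<omega> ^ 3 * Y \<omega> - U \<omega> ^ 3 * V \<omega>\<bar> \<le> H \<omega>" for \<omega>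
        unfolding H_def by (rule fourth_degree_differences(1) [OF \<theta>])
    qed
    moreover have "\<bar>expectation (\<lambda>\<omega>. X \<omega> * Y \<omega> ^ 3) - expectation (\<lambda>\<omega>. U \<omega> * V \<omega> ^ 3)\<bar> \<le> \<delta>"
    proof (rule close)
      show "integrable M (\<lambda>\<omega>. X \<omega> * Y \<omega> ^ 3)" "integrable M (\<lambda>\<omega>. U \<omega> * V \<omega> ^ 3)"
        using i31 [of X Y] i31 [of U V] X4 Y4 U4 V4 by auto
      show "\<bar>X \<omega> * Y \<omega> ^ 3 - U \<omega> * V \<omega> ^ 3\<bar> \<le> H \<omega>" for \<omega>
        unfolding H_def by (rule fourth_degree_differences(2) [OF \<theta>])
    qed
    moreover have "\<bar>expectation (\<lambda>\<omega>. (X \<omega> + Y \<omega>) ^ 4) - expectation (\<lambda>\<omega>. (U \<omega> + V \<omega>) ^ 4)\<bar> \<le> \<delta>"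
      by (rule close [OF i4]) (unfold H_def, rule fourth_degree_differences(3) [OF \<theta>])
    moreover have "\<bar>expectation (\<lambda>\<omega>. (X \<omega> + Y \<omega>)\<^sup>2) - expectation (\<lambda>\<omega>. (U \<omega> + V \<omega>)\<^sup>2)\<bar> \<le> \<delta>"
    proof (rule close)
      show "integrable M (\<lambda>\<omega>. (X \<omega> + Y \<omega>)\<^sup>2)" "integrable M (\<lambda>\<omega>. (U \<omega> + V \<omega>)\<^sup>2)"
        by (rule i2 [OF _ i4(1)] i2 [OF _ i4(2)]; measurable)+
      show "\<bar>(X \<omega> + Y \<omega>)\<^sup>2 - (U \<omega> + V \<omega>)\<^sup>2\<bar> \<le> H \<omega>" for \<omega>
        unfolding H_def by (rule fourth_degree_differences(4) [OF \<theta>])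
    qed
    moreover have "expectation (\<lambda>\<omega>. \<bar>X \<omega> + Y \<omega> - (U \<omega> + V \<omega>)\<bar>) \<le> expectation H"
    proof (rule integral_mono [OF _ iH])
      show "integrable M (\<lambda>\<omega>. \<bar>X \<omega> + Y \<omega> - (U \<omega> + V \<omega>)\<bar>)"
        by (rule integrable_abs [OF Bochner_Integration.integrable_diff [OF i1 [OF _ i4(1)] i1 [OF _ i4(2)]]]; measurable)
      show "\<bar>X \<omega> + Y \<omega> - (U \<omega> + V \<omega>)\<bar> \<le> H \<omega>" for \<omega>
        unfolding H_def by (rule fourth_degree_differences(5) [OF \<theta>])
    qed
    moreover note order_trans [OF this EH]
    ultimately show "\<bar>expectation (\<lambda>\<omega>. X \<omega> ^ 3 * Y \<omega>) - expectation (\<lambda>\<omega>. U \<omega> ^ 3 * V \<omega>)\<bar> \<le> \<delta> \<and>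
      \<bar>expectation (\<lambda>\<omega>. X \<omega> * Y \<omega> ^ 3) - expectation (\<lambda>\<omega>. U \<omega> * V \<omega> ^ 3)\<bar> \<le> \<delta> \<and>
      \<bar>expectation (\<lambda>\<omega>. (X \<omega> + Y \<omega>) ^ 4) - expectation (\<lambda>\<omega>. (U \<omega> + V \<omega>) ^ 4)\<bar> \<le> \<delta> \<and>
      \<bar>expectation (\<lambda>\<omega>. (X \<omega> + Y \<omega>)\<^sup>2) - expectation (\<lambda>\<omega>. (U \<omega> + V \<omega>)\<^sup>2)\<bar> \<le> \<delta> \<and>
      expectation (\<lambda>\<omega>. \<bar>X \<omega> + Y \<omega> - (U \<omega> + V \<omega>)\<bar>) \<le> \<delta>"
      by blast
  qed
qed

section \<open>Characteristic functions\<close>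

lemma lipschitz_of_derivative_bound:
  fixes f f' :: "real \<Rightarrow> real"
  assumes "\<And>x. (f has_real_derivative f' x) (at x)" "\<And>x. \<bar>f' x\<bar> \<le> B"
  shows "\<bar>f x - f y\<bar> \<le> B * \<bar>x - y\<bar>"
  using field_differentiable_bound [of UNIV f f' B x y] assms by (simp add: has_field_derivative_at_within)

lemma taylor_quadratic_bound:
  fixes f f' :: "real \<Rightarrow> real"
  assumes f: "\<And>x. (f has_real_derivative f' x) (at x)" and L: "\<And>x y. \<bar>f' x - f' y\<bar> \<le> L * \<bar>x - y\<bar>"
  shows "\<bar>f b - f a - f' a * (b - a)\<bar> \<le> L * (b - a)\<^sup>2"
proof -
  have L0: "0 \<le> L" using L [of 0 1] by simp
  let ?S = "cball a \<bar>b - a\<bar>"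
  have "norm ((f b - f' a * b) - (f a - f' a * a)) \<le> (L * \<bar>b - a\<bar>) * norm (b - a)"
  proof (rule field_differentiable_bound [of ?S "\<lambda>x. f x - f' a * x" "\<lambda>x. f' x - f' a"])
    fix z assume z: "z \<in> ?S"
    show "((\<lambda>x. f x - f' a * x) has_field_derivative f' z - f' a) (at z within ?S)"
      by (rule has_field_derivative_at_within) (auto intro!: derivative_eq_intros f)
    have "\<bar>f' z - f' a\<bar> \<le> L * \<bar>z - a\<bar>" by (rule L)
    also have "\<dots> \<le> L * \<bar>b - a\<bar>" using z L0 by (intro mult_left_mono) (auto simp: dist_real_def)
    finally show "norm (f' z - f' a) \<le> L * \<bar>b - a\<bar>" by simp
  qed (auto simp: dist_real_def)
  then show ?thesis by (simp add: algebra_simps power2_eq_square)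
qed

lemma sin_scaled_taylor: "\<bar>sin (t * b) - sin (t * a) - t * cos (t * a) * (b - a)\<bar> \<le> t\<^sup>2 * (b - a)\<^sup>2"
  and cos_scaled_taylor: "\<bar>cos (t * b) - cos (t * a) - (- t * sin (t * a)) * (b - a)\<bar> \<le> t\<^sup>2 * (b - a)\<^sup>2"
  for t :: real
proof -
  have b: "\<bar>t * (t * u)\<bar> \<le> t\<^sup>2" if "\<bar>u\<bar> \<le> 1" for u
    using mult_left_mono [OF that, of "t\<^sup>2"] by (simp add: abs_mult power2_eq_square)
  show "\<bar>sin (t * b) - sin (t * a) - t * cos (t * a) * (b - a)\<bar> \<le> t\<^sup>2 * (b - a)\<^sup>2"
  proof (rule taylor_quadratic_bound [of "\<lambda>x. sin (t * x)" "\<lambda>x. t * cos (t * x)"])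
    show "((\<lambda>x. sin (t * x)) has_real_derivative t * cos (t * x)) (at x)" for x
      by (auto intro!: derivative_eq_intros)
    show "\<bar>t * cos (t * x) - t * cos (t * y)\<bar> \<le> t\<^sup>2 * \<bar>x - y\<bar>" for x y
      by (rule lipschitz_of_derivative_bound [of _ "\<lambda>x. t * (t * (- sin (t * x)))"])
        (auto intro!: derivative_eq_intros b)
  qed
  show "\<bar>cos (t * b) - cos (t * a) - (- t * sin (t * a)) * (b - a)\<bar> \<le> t\<^sup>2 * (b - a)\<^sup>2"
  proof (rule taylor_quadratic_bound [of "\<lambda>x. cos (t * x)" "\<lambda>x. - t * sin (t * x)"])
    show "((\<lambda>x. cos (t * x)) has_real_derivative - t * sin (t * x)) (at x)" for x
      by (auto intro!: derivative_eq_intros)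
    show "\<bar>- t * sin (t * x) - - t * sin (t * y)\<bar> \<le> t\<^sup>2 * \<bar>x - y\<bar>" for x y
      by (rule lipschitz_of_derivative_bound [of _ "\<lambda>x. t * (t * (- cos (t * x)))"])
        (auto intro!: derivative_eq_intros b)
  qed
qed

text \<open>A quadratic error bound survives taking expectations, so together with the Taylor bounds
  for sine and cosine this differentiates trigonometric moments under the integral.\<close>

lemma has_derivative_of_quadratic_error:
  fixes f :: "real \<Rightarrow> real"
  assumes "\<And>y. \<bar>f y - f x - D * (y - x)\<bar> \<le> K * (y - x)\<^sup>2"
  shows "(f has_real_derivative D) (at x)"
  unfolding has_field_derivative_iff
proof (rule LIM_zero_cancel, rule Lim_null_comparison)
  show "\<forall>\<^sub>F y in at x. norm ((f y - f x) / (y - x) - D) \<le> K * \<bar>y - x\<bar>"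
    unfolding eventually_at_filter
  proof (intro always_eventually allI impI)
    fix y assume "y \<noteq> x"
    then have "\<bar>(f y - f x) / (y - x) - D\<bar> = \<bar>f y - f x - D * (y - x)\<bar> / \<bar>y - x\<bar>"
      by (simp add: abs_divide [symmetric] diff_divide_distrib)
    also have "\<dots> \<le> K * (y - x)\<^sup>2 / \<bar>y - x\<bar>" using assms by (intro divide_right_mono) auto
    also have "\<dots> = K * \<bar>y - x\<bar>"
    proof -
      have "K * a\<^sup>2 / a = K * a" if "a \<noteq> 0" for a using that by (simp add: power2_eq_square)
      from this [of "\<bar>y - x\<bar>"] \<open>y \<noteq> x\<close> show ?thesis by simp
    qed
    finally show "norm ((f y - f x) / (y - x) - D) \<le> K * \<bar>y - x\<bar>" by simp
  qed
  have "((\<lambda>y. K * \<bar>y - x\<bar>) \<longlongrightarrow> K * \<bar>x - x\<bar>) (at x)" by (intro tendsto_intros)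
  then show "((\<lambda>y. K * \<bar>y - x\<bar>) \<longlongrightarrow> 0) (at x)" by simp
qed

text \<open>Multiply by the integrating factor \<open>exp (s * t\<^sup>2 / 2)\<close> and apply the
  mean value bound. The factor is largest at \<open>T\<close>, so dividing by it leaves only
  \<open>e * \<bar>T\<bar>\<close>.\<close>

lemma perturbed_gaussian_ode:
  fixes c c' :: "real \<Rightarrow> real"
  assumes c: "\<And>t. (c has_real_derivative c' t) (at t)" and s: "s \<ge> 0"
    and e: "\<And>t. \<bar>t\<bar> \<le> \<bar>T\<bar> \<Longrightarrow> \<bar>c' t + s * t * c t\<bar> \<le> e"
  shows "\<bar>c T - c 0 * exp (- s * T\<^sup>2 / 2)\<bar> \<le> e * \<bar>T\<bar>"
proof -
  let ?g = "\<lambda>t. exp (s * t\<^sup>2 / 2) * c t"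
  let ?S = "cball (0::real) \<bar>T\<bar>"
  have e0: "0 \<le> e" using e [of 0] by simp
  have "norm (?g T - ?g 0) \<le> (exp (s * T\<^sup>2 / 2) * e) * norm (T - 0)"
  proof (rule field_differentiable_bound [of ?S ?g "\<lambda>t. exp (s * t\<^sup>2 / 2) * (c' t + s * t * c t)"])
    fix t assume "t \<in> ?S"
    then have t: "\<bar>t\<bar> \<le> \<bar>T\<bar>" by simp
    show "(?g has_field_derivative exp (s * t\<^sup>2 / 2) * (c' t + s * t * c t)) (at t within ?S)"
      by (rule has_field_derivative_at_within)
        (auto intro!: derivative_eq_intros c simp: algebra_simps)
    have "t\<^sup>2 \<le> T\<^sup>2" using t by (simp add: abs_le_square_iff)
    then have "exp (s * t\<^sup>2 / 2) \<le> exp (s * T\<^sup>2 / 2)" using s by (simp add: mult_left_mono)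
    then show "norm (exp (s * t\<^sup>2 / 2) * (c' t + s * t * c t)) \<le> exp (s * T\<^sup>2 / 2) * e"
      using e [OF t] by (simp add: abs_mult mult_mono)
  qed auto
  then have "\<bar>exp (s * T\<^sup>2 / 2) * c T - c 0\<bar> \<le> exp (s * T\<^sup>2 / 2) * (e * \<bar>T\<bar>)" by simp
  moreover have "exp (s * T\<^sup>2 / 2) * c T - c 0 = exp (s * T\<^sup>2 / 2) * (c T - c 0 * exp (- s * T\<^sup>2 / 2))"
    by (simp add: right_diff_distrib exp_minus)
  ultimately show ?thesis by (simp add: abs_mult)
qed

text \<open>The real and imaginary parts of the characteristic function have the first terms in the
  two assumptions as derivatives, up to sign, so both nearly solve the Gaussian equation, with
  initial values 1 and 0.\<close>

lemma (in prob_space) trig_moments_near_gaussian: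
  fixes W :: "'a \<Rightarrow> real"
  assumes [measurable]: "W \<in> borel_measurable M" and W2: "integrable M (\<lambda>\<omega>. (W \<omega>)\<^sup>2)" and s: "s \<ge> 0"
    and sin_eq: "\<And>t. \<bar>t\<bar> \<le> \<bar>T\<bar> \<Longrightarrow>
      \<bar>expectation (\<lambda>\<omega>. W \<omega> * sin (t * W \<omega>)) - s * expectation (\<lambda>\<omega>. t * cos (t * W \<omega>))\<bar> \<le> e"
    and cos_eq: "\<And>t. \<bar>t\<bar> \<le> \<bar>T\<bar> \<Longrightarrow>
      \<bar>expectation (\<lambda>\<omega>. W \<omega> * cos (t * W \<omega>)) - s * expectation (\<lambda>\<omega>. - t * sin (t * W \<omega>))\<bar> \<le> e"
  shows "\<bar>expectation (\<lambda>\<omega>. cos (T * W \<omega>)) - exp (- s * T\<^sup>2 / 2)\<bar> \<le> e * \<bar>T\<bar>"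
    and "\<bar>expectation (\<lambda>\<omega>. sin (T * W \<omega>))\<bar> \<le> e * \<bar>T\<bar>"
proof -
  have W1: "integrable M W" by (rule square_integrable_imp_integrable [OF assms(1) W2])
  have ic: "integrable M (\<lambda>\<omega>. cos (t * W \<omega>))" and isn: "integrable M (\<lambda>\<omega>. sin (t * W \<omega>))" for t
    by (rule integrable_const_bound [of _ 1]; simp)+
  have iWs: "integrable M (\<lambda>\<omega>. W \<omega> * sin (t * W \<omega>))" and iWc: "integrable M (\<lambda>\<omega>. W \<omega> * cos (t * W \<omega>))" for t
    by (rule Bochner_Integration.integrable_bound [OF W1]; auto simp: abs_mult intro!: AE_I2 mult_left_le)+
  have dc: "((\<lambda>t. expectation (\<lambda>\<omega>. cos (t * W \<omega>))) has_real_derivative - expectation (\<lambda>\<omega>. W \<omega> * sin (t * W \<omega>))) (at t)" for t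
  proof (rule has_derivative_of_quadratic_error)
    fix y
    let ?f = "\<lambda>\<omega>. cos (y * W \<omega>) - cos (t * W \<omega>) - (- (W \<omega> * sin (t * W \<omega>))) * (y - t)"
    have eq: "expectation (\<lambda>\<omega>. cos (y * W \<omega>)) - expectation (\<lambda>\<omega>. cos (t * W \<omega>)) -
        - expectation (\<lambda>\<omega>. W \<omega> * sin (t * W \<omega>)) * (y - t) = expectation ?f"
      using ic iWs by simp
    have "\<bar>expectation (\<lambda>\<omega>. cos (y * W \<omega>)) - expectation (\<lambda>\<omega>. cos (t * W \<omega>)) -
        - expectation (\<lambda>\<omega>. W \<omega> * sin (t * W \<omega>)) * (y - t)\<bar> \<le> expectation (\<lambda>\<omega>. \<bar>?f \<omega>\<bar>)"
      unfolding eq by (rule integral_abs_bound)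
    also have "\<dots> \<le> expectation (\<lambda>\<omega>. (W \<omega>)\<^sup>2 * (y - t)\<^sup>2)"
    proof (rule integral_mono)
      show "\<bar>?f \<omega>\<bar> \<le> (W \<omega>)\<^sup>2 * (y - t)\<^sup>2" for \<omega>
        using cos_scaled_taylor [of "W \<omega>" y t] by (simp add: mult.commute)
    qed (use ic iWs W2 in auto)
    finally show "\<bar>expectation (\<lambda>\<omega>. cos (y * W \<omega>)) - expectation (\<lambda>\<omega>. cos (t * W \<omega>)) -
        - expectation (\<lambda>\<omega>. W \<omega> * sin (t * W \<omega>)) * (y - t)\<bar> \<le> expectation (\<lambda>\<omega>. (W \<omega>)\<^sup>2) * (y - t)\<^sup>2"
      by simp
  qed
  have ds: "((\<lambda>t. expectation (\<lambda>\<omega>. sin (t * W \<omega>))) has_real_derivative expectation (\<lambda>\<omega>. W \<omega> * cos (t * W \<omega>))) (at t)" for t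
  proof (rule has_derivative_of_quadratic_error)
    fix y
    let ?f = "\<lambda>\<omega>. sin (y * W \<omega>) - sin (t * W \<omega>) - W \<omega> * cos (t * W \<omega>) * (y - t)"
    have eq: "expectation (\<lambda>\<omega>. sin (y * W \<omega>)) - expectation (\<lambda>\<omega>. sin (t * W \<omega>)) -
        expectation (\<lambda>\<omega>. W \<omega> * cos (t * W \<omega>)) * (y - t) = expectation ?f"
      using isn iWc by simp
    have "\<bar>expectation (\<lambda>\<omega>. sin (y * W \<omega>)) - expectation (\<lambda>\<omega>. sin (t * W \<omega>)) -
        expectation (\<lambda>\<omega>. W \<omega> * cos (t * W \<omega>)) * (y - t)\<bar> \<le> expectation (\<lambda>\<omega>. \<bar>?f \<omega>\<bar>)"
      unfolding eq by (rule integral_abs_bound)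
    also have "\<dots> \<le> expectation (\<lambda>\<omega>. (W \<omega>)\<^sup>2 * (y - t)\<^sup>2)"
    proof (rule integral_mono)
      show "\<bar>?f \<omega>\<bar> \<le> (W \<omega>)\<^sup>2 * (y - t)\<^sup>2" for \<omega>
        using sin_scaled_taylor [of "W \<omega>" y t] by (simp add: mult.commute)
    qed (use isn iWc W2 in auto)
    finally show "\<bar>expectation (\<lambda>\<omega>. sin (y * W \<omega>)) - expectation (\<lambda>\<omega>. sin (t * W \<omega>)) -
        expectation (\<lambda>\<omega>. W \<omega> * cos (t * W \<omega>)) * (y - t)\<bar> \<le> expectation (\<lambda>\<omega>. (W \<omega>)\<^sup>2) * (y - t)\<^sup>2"
      by simp
  qed
  have "\<bar>expectation (\<lambda>\<omega>. cos (T * W \<omega>)) - expectation (\<lambda>\<omega>. cos (0 * W \<omega>)) * exp (- s * T\<^sup>2 / 2)\<bar> \<le> e * \<bar>T\<bar>"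
  proof (rule perturbed_gaussian_ode [OF dc s])
    fix t assume "\<bar>t\<bar> \<le> \<bar>T\<bar>"
    from sin_eq [OF this] show "\<bar>- expectation (\<lambda>\<omega>. W \<omega> * sin (t * W \<omega>)) + s * t * expectation (\<lambda>\<omega>. cos (t * W \<omega>))\<bar> \<le> e"
      by (simp add: abs_minus_commute mult.assoc)
  qed
  then show "\<bar>expectation (\<lambda>\<omega>. cos (T * W \<omega>)) - exp (- s * T\<^sup>2 / 2)\<bar> \<le> e * \<bar>T\<bar>"
    by (simp add: prob_space)
  have "\<bar>expectation (\<lambda>\<omega>. sin (T * W \<omega>)) - expectation (\<lambda>\<omega>. sin (0 * W \<omega>)) * exp (- s * T\<^sup>2 / 2)\<bar> \<le> e * \<bar>T\<bar>"
  proof (rule perturbed_gaussian_ode [OF ds s])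
    fix t assume "\<bar>t\<bar> \<le> \<bar>T\<bar>"
    from cos_eq [OF this] show "\<bar>expectation (\<lambda>\<omega>. W \<omega> * cos (t * W \<omega>)) + s * t * expectation (\<lambda>\<omega>. sin (t * W \<omega>))\<bar> \<le> e"
      by (simp add: mult.assoc)
  qed
  then show "\<bar>expectation (\<lambda>\<omega>. sin (T * W \<omega>))\<bar> \<le> e * \<bar>T\<bar>" by simp
qed

section \<open>Convergence of sums of two multiple integrals\<close>

text \<open>The choice \<open>\<theta> = 1 / sqrt \<kappa>\<close> makes both \<theta>-dependent
  terms of \<open>stein_bound\<close> of order \<open>sqrt \<kappa>\<close>.\<close>

lemma (in poisson_counts) stein_bound_sqrt:
  fixes h h' :: "real \<Rightarrow> real"
  assumes u: "chaos I lam p u" and v: "chaos I lam q v" and pq: "p > 0" "q > 0" "p \<noteq> q"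
    and h0: "\<And>x. \<bar>h x\<bar> \<le> B0" and h1: "\<And>x. \<bar>h' x\<bar> \<le> B1"
    and taylor: "\<And>x y. \<bar>h y - h x - h' x * (y - x)\<bar> \<le> B2 * (y - x)\<^sup>2" and B2: "B2 \<ge> 0"
  defines "z \<equiv> \<lambda>k. u k + v k"
  defines "s \<equiv> E (\<lambda>k. (z k)\<^sup>2)"
  defines "\<kappa> \<equiv> E (\<lambda>k. z k ^ 4) - 3 * s\<^sup>2 - 4 * E (\<lambda>k. u k ^ 3 * v k) - 4 * E (\<lambda>k. u k * v k ^ 3)"
  shows "\<bar>E (\<lambda>k. z k * h (z k)) - s * E (\<lambda>k. h' (z k))\<bar> \<le>
      (B1 * (2 + real (p + q)) + B2 * (32 * real (p + q) + s)) * sqrt \<kappa>"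
proof -
  have \<kappa>: "0 \<le> \<kappa>"
    unfolding \<kappa>_def s_def z_def by (rule stein_bound(1) [OF u v pq h0 h1 taylor B2 zero_less_one])
  have s0: "0 \<le> s" by (simp add: s_def)
  let ?L = "\<bar>E (\<lambda>k. z k * h (z k)) - s * E (\<lambda>k. h' (z k))\<bar>"
  have sb: "?L \<le> B1 * (2 + real (p + q)) * sqrt \<kappa> + B2 / 2 * (64 * real (p + q) * \<kappa> * \<theta> + s / \<theta>)"
    if "\<theta> > 0" for \<theta>
    unfolding \<kappa>_def s_def z_def by (rule stein_bound(2) [OF u v pq h0 h1 taylor B2 that])
  show ?thesis
  proof (cases "\<kappa> = 0")
    case False
    then have pos: "sqrt \<kappa> > 0" using \<kappa> by simp
    have "?L \<le> B1 * (2 + real (p + q)) * sqrt \<kappa> + B2 / 2 * (64 * real (p + q) * \<kappa> * (1 / sqrt \<kappa>) + s / (1 / sqrt \<kappa>))"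
      using pos by (intro sb) auto
    also have "64 * real (p + q) * \<kappa> * (1 / sqrt \<kappa>) = 64 * real (p + q) * sqrt \<kappa>"
    proof -
      have e: "\<kappa> * (1 / sqrt \<kappa>) = sqrt \<kappa>" using real_div_sqrt [OF \<kappa>] by simp
      show ?thesis unfolding mult.assoc e ..
    qed
    finally have "?L \<le> B1 * (2 + real (p + q)) * sqrt \<kappa> + B2 / 2 * (64 * real (p + q) * sqrt \<kappa> + s * sqrt \<kappa>)"
      by simp
    also have "\<dots> \<le> B1 * (2 + real (p + q)) * sqrt \<kappa> + B2 / 2 * (64 * real (p + q) * sqrt \<kappa> + 2 * s * sqrt \<kappa>)"
      using B2 s0 pos by (intro add_left_mono mult_left_mono) auto
    also have "\<dots> = (B1 * (2 + real (p + q)) + B2 * (32 * real (p + q) + s)) * sqrt \<kappa>"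
      by (simp add: algebra_simps)
    finally show ?thesis .
  next
    \<comment> \<open>The optimal \<theta> is infinite here: only the term
      \<open>s / \<theta>\<close> remains, and it can be made smaller than any \<epsilon>.\<close>
    case True
    have "?L \<le> 0 + \<epsilon>" if \<epsilon>: "\<epsilon> > 0" for \<epsilon>
    proof -
      define \<theta> where "\<theta> = (B2 * s + 1) / \<epsilon>"
      have \<theta>: "\<theta> > 0" using B2 s0 \<epsilon> unfolding \<theta>_def by (intro divide_pos_pos add_nonneg_pos) auto
      have "?L \<le> B2 * s / (2 * \<theta>)" using sb [OF \<theta>] True by simp
      also have "\<dots> \<le> \<epsilon>"
      proof -
        have "\<epsilon> * (2 * \<theta>) = 2 * (B2 * s + 1)" using \<epsilon> by (simp add: \<theta>_def)
        moreover have "0 \<le> B2 * s" using B2 s0 by simp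
        ultimately have "B2 * s \<le> \<epsilon> * (2 * \<theta>)" by simp
        then show ?thesis using \<theta> by (simp add: pos_divide_le_eq)
      qed
      finally show ?thesis by simp
    qed
    then have "?L \<le> 0" by (rule field_le_epsilon)
    then show ?thesis using True by simp
  qed
qed

context poisson_random_measure
begin

text \<open>One partition refines those found for \<open>X\<close> and for \<open>Y\<close>, and the
  Stein bound is applied to the sum of the two approximations. In \<kappa> the variance is the one
  of \<open>W\<close>, so replacing the variance of the sum by \<open>s\<close> costs nothing
  there.\<close>

lemma sum_of_multiple_integrals_approximation:
  assumes X: "has_multiple_poisson_integral P \<mu> \<eta> p f X" and Y: "has_multiple_poisson_integral P \<mu> \<eta> q g Y"
    and X4: "integrable P (\<lambda>\<omega>. X \<omega> ^ 4)" and Y4: "integrable P (\<lambda>\<omega>. Y \<omega> ^ 4)"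
    and pq: "p > 0" "q > 0" "p \<noteq> q" and \<delta>: "(\<delta>::real) > 0"
  obtains W s \<kappa> where "W \<in> borel_measurable P" "integrable P (\<lambda>\<omega>. (W \<omega>)\<^sup>2)" "0 \<le> s"
    "\<bar>expectation (\<lambda>\<omega>. (X \<omega> + Y \<omega>)\<^sup>2) - s\<bar> \<le> \<delta>"
    "\<bar>\<kappa> - (expectation (\<lambda>\<omega>. (X \<omega> + Y \<omega>) ^ 4) - 3 * s\<^sup>2
      - 4 * expectation (\<lambda>\<omega>. X \<omega> ^ 3 * Y \<omega>) - 4 * expectation (\<lambda>\<omega>. X \<omega> * Y \<omega> ^ 3))\<bar> \<le> 9 * \<delta>"
    "expectation (\<lambda>\<omega>. \<bar>X \<omega> + Y \<omega> - W \<omega>\<bar>) \<le> \<delta>" "integrable P (\<lambda>\<omega>. \<bar>X \<omega> + Y \<omega> - W \<omega>\<bar>)"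
    "\<And>t. \<bar>expectation (\<lambda>\<omega>. W \<omega> * sin (t * W \<omega>)) - s * expectation (\<lambda>\<omega>. t * cos (t * W \<omega>))\<bar> \<le>
        (\<bar>t\<bar> * (2 + real (p + q)) + t\<^sup>2 * (32 * real (p + q) + s)) * sqrt \<kappa>"
    "\<And>t. \<bar>expectation (\<lambda>\<omega>. W \<omega> * cos (t * W \<omega>)) - s * expectation (\<lambda>\<omega>. - t * sin (t * W \<omega>))\<bar> \<le>
        (\<bar>t\<bar> * (2 + real (p + q)) + t\<^sup>2 * (32 * real (p + q) + s)) * sqrt \<kappa>"
proof -
  have Xm [measurable]: "X \<in> borel_measurable P" and X2: "integrable P (\<lambda>\<omega>. (X \<omega>)\<^sup>2)"
    and Ym [measurable]: "Y \<in> borel_measurable P" and Y2: "integrable P (\<lambda>\<omega>. (Y \<omega>)\<^sup>2)"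
    using X Y unfolding has_multiple_poisson_integral_def square_integrable_def by auto
  obtain \<epsilon> where \<epsilon>: "\<epsilon> > 0" and close:
    "\<And>U V. \<lbrakk>U \<in> borel_measurable P; V \<in> borel_measurable P;
      integrable P (\<lambda>\<omega>. U \<omega> ^ 4); integrable P (\<lambda>\<omega>. V \<omega> ^ 4);
      expectation (\<lambda>\<omega>. (X \<omega> - U \<omega>) ^ 4) \<le> \<epsilon>; expectation (\<lambda>\<omega>. (Y \<omega> - V \<omega>) ^ 4) \<le> \<epsilon>\<rbrakk> \<Longrightarrow>
      \<bar>expectation (\<lambda>\<omega>. X \<omega> ^ 3 * Y \<omega>) - expectation (\<lambda>\<omega>. U \<omega> ^ 3 * V \<omega>)\<bar> \<le> \<delta> \<and>
      \<bar>expectation (\<lambda>\<omega>. X \<omega> * Y \<omega> ^ 3) - expectation (\<lambda>\<omega>. U \<omega> * V \<omega> ^ 3)\<bar> \<le> \<delta> \<and>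
      \<bar>expectation (\<lambda>\<omega>. (X \<omega> + Y \<omega>) ^ 4) - expectation (\<lambda>\<omega>. (U \<omega> + V \<omega>) ^ 4)\<bar> \<le> \<delta> \<and>
      \<bar>expectation (\<lambda>\<omega>. (X \<omega> + Y \<omega>)\<^sup>2) - expectation (\<lambda>\<omega>. (U \<omega> + V \<omega>)\<^sup>2)\<bar> \<le> \<delta> \<and>
      expectation (\<lambda>\<omega>. \<bar>X \<omega> + Y \<omega> - (U \<omega> + V \<omega>)\<bar>) \<le> \<delta>"
    using fourth_moment_continuity [OF Xm Ym X4 Y4 \<delta>] by blast
  obtain \<S>1 where S1: "finite_sets \<mu> \<S>1" "\<And>\<S>. finite_sets \<mu> \<S> \<Longrightarrow> \<S>1 \<subseteq> \<S> \<Longrightarrow>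
      \<exists>v. chaos (atoms \<S>) (measure \<mu>) p v \<and> expectation (\<lambda>\<omega>. (X \<omega> - v (atom_counts \<S> \<omega>)) ^ 4) \<le> \<epsilon>"
    by (rule multiple_integral_L4_approximation [OF X X4 \<epsilon>]) blast
  obtain \<S>2 where S2: "finite_sets \<mu> \<S>2" "\<And>\<S>. finite_sets \<mu> \<S> \<Longrightarrow> \<S>2 \<subseteq> \<S> \<Longrightarrow>
      \<exists>v. chaos (atoms \<S>) (measure \<mu>) q v \<and> expectation (\<lambda>\<omega>. (Y \<omega> - v (atom_counts \<S> \<omega>)) ^ 4) \<le> \<epsilon>"
    by (rule multiple_integral_L4_approximation [OF Y Y4 \<epsilon>]) blast
  define \<S> where "\<S> = \<S>1 \<union> \<S>2"
  have S: "finite_sets \<mu> \<S>" unfolding \<S>_def by (rule finite_sets_Un [OF S1(1) S2(1)])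
  obtain u where u: "chaos (atoms \<S>) (measure \<mu>) p u" "expectation (\<lambda>\<omega>. (X \<omega> - u (atom_counts \<S> \<omega>)) ^ 4) \<le> \<epsilon>"
    using S1(2) [OF S] by (auto simp: \<S>_def)
  obtain v where v: "chaos (atoms \<S>) (measure \<mu>) q v" "expectation (\<lambda>\<omega>. (Y \<omega> - v (atom_counts \<S> \<omega>)) ^ 4) \<le> \<epsilon>"
    using S2(2) [OF S] by (auto simp: \<S>_def)
  interpret poisson_counts "atoms \<S>" "measure \<mu>" "atom_pmf \<S>" by (rule poisson_counts_atoms [OF S])
  note fc = finite_cells_atoms [OF S]
  note um = integrable_power_counts [OF S poly_bounded_chaos [OF u(1)]]
    and vm = integrable_power_counts [OF S poly_bounded_chaos [OF v(1)]]
  let ?K = "atom_counts \<S>"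
  have E_eq: "E \<phi> = expectation (\<lambda>\<omega>. \<phi> (?K \<omega>))" for \<phi> :: "('e set \<Rightarrow> nat) \<Rightarrow> real"
    by (rule integral_counts_pmf(1) [OF fc])
  define W where "W \<omega> = u (?K \<omega>) + v (?K \<omega>)" for \<omega>
  define s where "s = expectation (\<lambda>\<omega>. (W \<omega>)\<^sup>2)"
  define \<kappa> where "\<kappa> = expectation (\<lambda>\<omega>. W \<omega> ^ 4) - 3 * s\<^sup>2
    - 4 * expectation (\<lambda>\<omega>. u (?K \<omega>) ^ 3 * v (?K \<omega>)) - 4 * expectation (\<lambda>\<omega>. u (?K \<omega>) * v (?K \<omega>) ^ 3)"
  note cl = close [OF um(1) vm(1) um(2) vm(2) u(2) v(2), folded W_def]
  have puv: "poly_bounded (\<lambda>k. u k + v k)"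
    by (intro poly_bounded_add poly_bounded_chaos [OF u(1)] poly_bounded_chaos [OF v(1)])
  note Wm = integrable_power_counts [OF S puv, folded W_def]
  have stein: "\<bar>expectation (\<lambda>\<omega>. W \<omega> * h (W \<omega>)) - s * expectation (\<lambda>\<omega>. h' (W \<omega>))\<bar> \<le>
      (B1 * (2 + real (p + q)) + B2 * (32 * real (p + q) + s)) * sqrt \<kappa>"
    if "\<And>x. \<bar>h x\<bar> \<le> 1" "\<And>x. \<bar>h' x\<bar> \<le> B1" "\<And>x y. \<bar>h y - h x - h' x * (y - x)\<bar> \<le> B2 * (y - x)\<^sup>2" "B2 \<ge> 0"
    for h h' :: "real \<Rightarrow> real" and B1 B2
    using stein_bound_sqrt [of p u q v h 1 h' B1 B2, OF u(1) v(1) pq that]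
    unfolding E_eq W_def [symmetric] s_def [symmetric] \<kappa>_def [symmetric] .
  have bt: "\<bar>t * x\<bar> \<le> \<bar>t\<bar>" if "\<bar>x\<bar> \<le> 1" for t x :: real
    using mult_left_mono [OF that, of "\<bar>t\<bar>"] by (simp add: abs_mult)
  show ?thesis
  proof (rule that [of W s \<kappa>])
    show "W \<in> borel_measurable P" by (rule Wm(1))
    show "integrable P (\<lambda>\<omega>. (W \<omega>)\<^sup>2)" by (rule Wm(2))
    show "0 \<le> s" by (simp add: s_def)
    show "\<bar>expectation (\<lambda>\<omega>. (X \<omega> + Y \<omega>)\<^sup>2) - s\<bar> \<le> \<delta>" using cl unfolding s_def by blast
    show "expectation (\<lambda>\<omega>. \<bar>X \<omega> + Y \<omega> - W \<omega>\<bar>) \<le> \<delta>" using cl by blast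
    \<comment> \<open>The fourth moment contributes one \<delta> and each mixed moment, having
      coefficient 4, contributes four.\<close>
    show "\<bar>\<kappa> - (expectation (\<lambda>\<omega>. (X \<omega> + Y \<omega>) ^ 4) - 3 * s\<^sup>2
      - 4 * expectation (\<lambda>\<omega>. X \<omega> ^ 3 * Y \<omega>) - 4 * expectation (\<lambda>\<omega>. X \<omega> * Y \<omega> ^ 3))\<bar> \<le> 9 * \<delta>"
      using cl unfolding \<kappa>_def by linarith
    show "integrable P (\<lambda>\<omega>. \<bar>X \<omega> + Y \<omega> - W \<omega>\<bar>)"
      by (intro integrable_abs Bochner_Integration.integrable_diff Bochner_Integration.integrable_add
          square_integrable_imp_integrable [OF Xm X2] square_integrable_imp_integrable [OF Ym Y2]
          square_integrable_imp_integrable [OF Wm(1) Wm(2)])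
    fix t
    show "\<bar>expectation (\<lambda>\<omega>. W \<omega> * sin (t * W \<omega>)) - s * expectation (\<lambda>\<omega>. t * cos (t * W \<omega>))\<bar> \<le>
        (\<bar>t\<bar> * (2 + real (p + q)) + t\<^sup>2 * (32 * real (p + q) + s)) * sqrt \<kappa>"
      by (rule stein [of "\<lambda>x. sin (t * x)" "\<lambda>x. t * cos (t * x)"]) (auto intro: sin_scaled_taylor bt)
    show "\<bar>expectation (\<lambda>\<omega>. W \<omega> * cos (t * W \<omega>)) - s * expectation (\<lambda>\<omega>. - t * sin (t * W \<omega>))\<bar> \<le>
        (\<bar>t\<bar> * (2 + real (p + q)) + t\<^sup>2 * (32 * real (p + q) + s)) * sqrt \<kappa>"
    proof (rule stein [of "\<lambda>x. cos (t * x)" "\<lambda>x. - t * sin (t * x)"])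
      show "\<bar>- t * sin (t * x)\<bar> \<le> \<bar>t\<bar>" for x using bt [of "sin (t * x)" "- t"] by simp
    qed (auto intro: cos_scaled_taylor [simplified] simp: cos_scaled_taylor)
  qed
qed

text \<open>Sine and cosine are 1-Lipschitz, so replacing \<open>W\<close> by the sum costs
  \<open>\<bar>T\<bar> * \<delta>\<close>. With \<open>\<bar>\<kappa>\<bar>\<close> under the root
  the bound is nonnegative and monotone in \<open>\<bar>T\<bar>\<close> without any information on
  the sign of \<kappa>.\<close>

lemma trig_moments_of_sum:
  assumes X: "has_multiple_poisson_integral P \<mu> \<eta> p f X" and Y: "has_multiple_poisson_integral P \<mu> \<eta> q g Y"
    and X4: "integrable P (\<lambda>\<omega>. X \<omega> ^ 4)" and Y4: "integrable P (\<lambda>\<omega>. Y \<omega> ^ 4)"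
    and pq: "p > 0" "q > 0" "p \<noteq> q" and \<delta>: "(\<delta>::real) > 0"
  obtains s \<kappa> where "0 \<le> s" "\<bar>expectation (\<lambda>\<omega>. (X \<omega> + Y \<omega>)\<^sup>2) - s\<bar> \<le> \<delta>"
    "\<bar>\<kappa> - (expectation (\<lambda>\<omega>. (X \<omega> + Y \<omega>) ^ 4) - 3 * s\<^sup>2
      - 4 * expectation (\<lambda>\<omega>. X \<omega> ^ 3 * Y \<omega>) - 4 * expectation (\<lambda>\<omega>. X \<omega> * Y \<omega> ^ 3))\<bar> \<le> 9 * \<delta>"
    "\<And>T. \<bar>expectation (\<lambda>\<omega>. cos (T * (X \<omega> + Y \<omega>))) - exp (- s * T\<^sup>2 / 2)\<bar> \<le>
        (\<bar>T\<bar> * (2 + real (p + q)) + T\<^sup>2 * (32 * real (p + q) + s)) * sqrt \<bar>\<kappa>\<bar> * \<bar>T\<bar> + \<bar>T\<bar> * \<delta>"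
    "\<And>T. \<bar>expectation (\<lambda>\<omega>. sin (T * (X \<omega> + Y \<omega>)))\<bar> \<le>
        (\<bar>T\<bar> * (2 + real (p + q)) + T\<^sup>2 * (32 * real (p + q) + s)) * sqrt \<bar>\<kappa>\<bar> * \<bar>T\<bar> + \<bar>T\<bar> * \<delta>"
proof -
  have Xm [measurable]: "X \<in> borel_measurable P" and Ym [measurable]: "Y \<in> borel_measurable P"
    using X Y unfolding has_multiple_poisson_integral_def square_integrable_def by auto
  obtain W s \<kappa> where W: "W \<in> borel_measurable P" "integrable P (\<lambda>\<omega>. (W \<omega>)\<^sup>2)" "0 \<le> s"
    "\<bar>expectation (\<lambda>\<omega>. (X \<omega> + Y \<omega>)\<^sup>2) - s\<bar> \<le> \<delta>"
    "\<bar>\<kappa> - (expectation (\<lambda>\<omega>. (X \<omega> + Y \<omega>) ^ 4) - 3 * s\<^sup>2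
      - 4 * expectation (\<lambda>\<omega>. X \<omega> ^ 3 * Y \<omega>) - 4 * expectation (\<lambda>\<omega>. X \<omega> * Y \<omega> ^ 3))\<bar> \<le> 9 * \<delta>"
    and D: "expectation (\<lambda>\<omega>. \<bar>X \<omega> + Y \<omega> - W \<omega>\<bar>) \<le> \<delta>" "integrable P (\<lambda>\<omega>. \<bar>X \<omega> + Y \<omega> - W \<omega>\<bar>)"
    and st: "\<And>t. \<bar>expectation (\<lambda>\<omega>. W \<omega> * sin (t * W \<omega>)) - s * expectation (\<lambda>\<omega>. t * cos (t * W \<omega>))\<bar> \<le>
        (\<bar>t\<bar> * (2 + real (p + q)) + t\<^sup>2 * (32 * real (p + q) + s)) * sqrt \<kappa>"
    "\<And>t. \<bar>expectation (\<lambda>\<omega>. W \<omega> * cos (t * W \<omega>)) - s * expectation (\<lambda>\<omega>. - t * sin (t * W \<omega>))\<bar> \<le>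
        (\<bar>t\<bar> * (2 + real (p + q)) + t\<^sup>2 * (32 * real (p + q) + s)) * sqrt \<kappa>"
    by (rule sum_of_multiple_integrals_approximation [OF X Y X4 Y4 pq \<delta>]) (rule that, assumption+)
  note [measurable] = W(1)
  have trig: "\<bar>expectation (\<lambda>\<omega>. F (T * (X \<omega> + Y \<omega>))) - expectation (\<lambda>\<omega>. F (T * W \<omega>))\<bar> \<le> \<bar>T\<bar> * \<delta>"
    if F [measurable]: "F \<in> borel_measurable borel" and b: "\<And>x. \<bar>F x\<bar> \<le> 1" and l: "\<And>x y. \<bar>F x - F y\<bar> \<le> 1 * \<bar>x - y\<bar>"
    for F :: "real \<Rightarrow> real" and T
  proof -
    have i: "integrable P (\<lambda>\<omega>. F (T * (X \<omega> + Y \<omega>)))" "integrable P (\<lambda>\<omega>. F (T * W \<omega>))"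
      by (rule integrable_const_bound [of _ 1]; simp add: b)+
    have "\<bar>expectation (\<lambda>\<omega>. F (T * (X \<omega> + Y \<omega>))) - expectation (\<lambda>\<omega>. F (T * W \<omega>))\<bar> =
      \<bar>expectation (\<lambda>\<omega>. F (T * (X \<omega> + Y \<omega>)) - F (T * W \<omega>))\<bar>" using i by simp
    also have "\<dots> \<le> expectation (\<lambda>\<omega>. \<bar>F (T * (X \<omega> + Y \<omega>)) - F (T * W \<omega>)\<bar>)" by (rule integral_abs_bound)
    also have "\<dots> \<le> expectation (\<lambda>\<omega>. \<bar>T\<bar> * \<bar>X \<omega> + Y \<omega> - W \<omega>\<bar>)"
    proof (rule integral_mono)
      show "\<bar>F (T * (X \<omega> + Y \<omega>)) - F (T * W \<omega>)\<bar> \<le> \<bar>T\<bar> * \<bar>X \<omega> + Y \<omega> - W \<omega>\<bar>" for \<omega>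
        using l [of "T * (X \<omega> + Y \<omega>)" "T * W \<omega>"] by (simp only: abs_mult [symmetric] right_diff_distrib mult_1)
    qed (use i D in auto)
    also have "\<dots> \<le> \<bar>T\<bar> * \<delta>" using D by (simp add: mult_left_mono)
    finally show ?thesis .
  qed
  have lip: "\<bar>cos x - cos y\<bar> \<le> 1 * \<bar>x - y\<bar>" "\<bar>sin x - sin y\<bar> \<le> 1 * \<bar>x - y\<bar>" for x y :: real
    by (rule lipschitz_of_derivative_bound [of _ "\<lambda>x. - sin x"] lipschitz_of_derivative_bound [of _ cos];
        auto intro!: derivative_eq_intros)+
  have mc: "(cos :: real \<Rightarrow> real) \<in> borel_measurable borel" "(sin :: real \<Rightarrow> real) \<in> borel_measurable borel"
    by (auto intro!: borel_measurable_continuous_onI continuous_intros)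
  let ?B = "\<lambda>t. (\<bar>t\<bar> * (2 + real (p + q)) + t\<^sup>2 * (32 * real (p + q) + s)) * sqrt \<bar>\<kappa>\<bar>"
  have mono: "(\<bar>t\<bar> * (2 + real (p + q)) + t\<^sup>2 * (32 * real (p + q) + s)) * sqrt \<kappa> \<le> ?B T" if "\<bar>t\<bar> \<le> \<bar>T\<bar>" for t T
  proof -
    have "t\<^sup>2 \<le> T\<^sup>2" using that by (simp add: abs_le_square_iff)
    then have "\<bar>t\<bar> * (2 + real (p + q)) + t\<^sup>2 * (32 * real (p + q) + s) \<le> \<bar>T\<bar> * (2 + real (p + q)) + T\<^sup>2 * (32 * real (p + q) + s)"
      using that W(3) by (intro add_mono mult_right_mono) auto
    moreover have "0 \<le> \<bar>t\<bar> * (2 + real (p + q)) + t\<^sup>2 * (32 * real (p + q) + s)" using W(3) by simp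
    moreover have "sqrt \<kappa> \<le> sqrt \<bar>\<kappa>\<bar>" by simp
    ultimately show ?thesis
      by (meson abs_ge_zero mult_left_mono mult_right_mono order_trans real_sqrt_ge_zero)
  qed
  have g: "\<bar>expectation (\<lambda>\<omega>. cos (T * W \<omega>)) - exp (- s * T\<^sup>2 / 2)\<bar> \<le> ?B T * \<bar>T\<bar>"
    "\<bar>expectation (\<lambda>\<omega>. sin (T * W \<omega>))\<bar> \<le> ?B T * \<bar>T\<bar>" for T
    by (rule trig_moments_near_gaussian [OF W(1-3)]; (rule order_trans [OF st(1) mono] order_trans [OF st(2) mono], assumption))+
  show ?thesis
  proof (rule that [OF W(3-5)])
    fix T
    show "\<bar>expectation (\<lambda>\<omega>. cos (T * (X \<omega> + Y \<omega>))) - exp (- s * T\<^sup>2 / 2)\<bar> \<le> ?B T * \<bar>T\<bar> + \<bar>T\<bar> * \<delta>"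
      using g(1) [of T] trig [of cos T, OF mc(1) abs_cos_le_one lip(1)] by linarith
    show "\<bar>expectation (\<lambda>\<omega>. sin (T * (X \<omega> + Y \<omega>)))\<bar> \<le> ?B T * \<bar>T\<bar> + \<bar>T\<bar> * \<delta>"
      using g(2) [of T] trig [of sin T, OF mc(2) abs_sin_le_one lip(2)] by linarith
  qed
qed

end

theorem theorem3p1:
  fixes P :: "'w measure" and \<mu> :: "'e measure" and \<eta> :: "'w \<Rightarrow> 'e measure"
    and p q :: nat
    and f g :: "nat \<Rightarrow> (nat \<Rightarrow> 'e) \<Rightarrow> real"
    and X Y Z :: "nat \<Rightarrow> 'w \<Rightarrow> real"
  assumes "poisson_random_measure P \<mu> \<eta>"
    and "p > 0" and "q > 0" and "p \<noteq> q"
    and "\<And>n. f n \<in> L2_sym \<mu> p" and "\<And>n. g n \<in> L2_sym \<mu> q"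
    and "\<And>n. has_multiple_poisson_integral P \<mu> \<eta> p (f n) (X n)"
    and "\<And>n. has_multiple_poisson_integral P \<mu> \<eta> q (g n) (Y n)"
    and "\<And>n \<omega>. Z n \<omega> = X n \<omega> + Y n \<omega>"
    and "\<And>n. (\<integral>\<omega>. (Z n \<omega>)\<^sup>2 \<partial>P) = 1"
    and "\<And>n. integrable P (\<lambda>\<omega>. (X n \<omega>) ^ 3 * Y n \<omega>)"
    and "\<And>n. integrable P (\<lambda>\<omega>. X n \<omega> * (Y n \<omega>) ^ 3)"
    and "(\<lambda>n. \<integral>\<omega>. (X n \<omega>) ^ 3 * Y n \<omega> \<partial>P) \<longlonglongrightarrow> 0"
    and "(\<lambda>n. \<integral>\<omega>. X n \<omega> * (Y n \<omega>) ^ 3 \<partial>P) \<longlonglongrightarrow> 0"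
    and "(\<lambda>n. \<integral>\<^sup>+ \<omega>. ennreal ((Z n \<omega>) ^ 4) \<partial>P) \<longlonglongrightarrow> 3"
  shows "weak_conv_m (\<lambda>n. distr P borel (Z n)) std_normal_distribution"
proof -
  interpret poisson_random_measure P \<mu> \<eta> by fact
  note XI = assms(7) and YI = assms(8) and Z = assms(9) and Z2 = assms(10)
  have Xm [measurable]: "X n \<in> borel_measurable P" and Ym [measurable]: "Y n \<in> borel_measurable P" for n
    using XI [of n] YI [of n] unfolding has_multiple_poisson_integral_def square_integrable_def by auto
  have Zm [measurable]: "Z n \<in> borel_measurable P" for n
    unfolding Z [abs_def] by measurable
  \<comment> \<open>Convergence of the extended fourth moments permits finitely many infinite
    values, so integrability is available only from some \<open>N\<close> on.\<close>
  have "eventually (\<lambda>n. (\<integral>\<^sup>+ \<omega>. ennreal ((Z n \<omega>) ^ 4) \<partial>P) < \<infinity>) sequentially"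
    using assms(15) by (rule order_tendstoD) auto
  then obtain N where N: "(\<integral>\<^sup>+ \<omega>. ennreal ((Z n \<omega>) ^ 4) \<partial>P) < \<infinity>" if "n \<ge> N" for n
    by (auto simp: eventually_sequentially)
  have Z4: "integrable P (\<lambda>\<omega>. Z n \<omega> ^ 4)" if "n \<ge> N" for n
    using N [OF that] by (intro integrableI_nonneg) auto
  have XY4: "integrable P (\<lambda>\<omega>. X n \<omega> ^ 4)" "integrable P (\<lambda>\<omega>. Y n \<omega> ^ 4)" if n: "n \<ge> N" for n
  proof -
    \<comment> \<open>Removing the two mixed terms from the fourth power of \<open>Z n\<close>
      leaves a sum of nonnegative terms that dominates the fourth power of each summand. This is how
      the separate fourth moments become finite.\<close>
    have i: "integrable P (\<lambda>\<omega>. Z n \<omega> ^ 4 - 4 * (X n \<omega> ^ 3 * Y n \<omega>) - 4 * (X n \<omega> * Y n \<omega> ^ 3))"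
      using Z4 [OF n] assms(11,12) by auto
    have e: "Z n \<omega> ^ 4 - 4 * (X n \<omega> ^ 3 * Y n \<omega>) - 4 * (X n \<omega> * Y n \<omega> ^ 3) =
        X n \<omega> ^ 4 + 6 * (X n \<omega> * Y n \<omega>)\<^sup>2 + Y n \<omega> ^ 4" for \<omega>
      unfolding Z by algebra
    show "integrable P (\<lambda>\<omega>. X n \<omega> ^ 4)"
      by (rule Bochner_Integration.integrable_bound [OF i]) (auto simp: e intro!: AE_I2)
    show "integrable P (\<lambda>\<omega>. Y n \<omega> ^ 4)"
      by (rule Bochner_Integration.integrable_bound [OF i]) (auto simp: e intro!: AE_I2)
  qed
  define m4 where "m4 n = expectation (\<lambda>\<omega>. Z n \<omega> ^ 4)" for n
  have "m4 \<longlonglongrightarrow> 3"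
  proof -
    have "(\<lambda>n. enn2real (\<integral>\<^sup>+ \<omega>. ennreal ((Z n \<omega>) ^ 4) \<partial>P)) \<longlonglongrightarrow> enn2real 3"
      using assms(15) by (intro tendsto_enn2real) auto
    \<comment> \<open>Valid for every \<open>n\<close>: where the fourth moment is infinite, the
      Bochner integral and \<open>enn2real\<close> both return 0.\<close>
    moreover have "m4 = (\<lambda>n. enn2real (\<integral>\<^sup>+ \<omega>. ennreal ((Z n \<omega>) ^ 4) \<partial>P))"
      unfolding m4_def by (intro ext integral_eq_nn_integral) auto
    ultimately show ?thesis by simp
  qed
  define c31 where "c31 n = expectation (\<lambda>\<omega>. X n \<omega> ^ 3 * Y n \<omega>)" for n
  define c13 where "c13 n = expectation (\<lambda>\<omega>. X n \<omega> * Y n \<omega> ^ 3)" for n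
  \<comment> \<open>The accuracy of the approximation at index \<open>n\<close>; any positive null
    sequence serves.\<close>
  define \<delta> where "\<delta> n = inverse (real (Suc n))" for n
  have \<delta>0: "\<delta> \<longlonglongrightarrow> 0" unfolding \<delta>_def by (rule LIMSEQ_inverse_real_of_nat)
  let ?B = "\<lambda>T s \<kappa> n. (\<bar>T\<bar> * (2 + real (p + q)) + T\<^sup>2 * (32 * real (p + q) + s)) * sqrt \<bar>\<kappa>\<bar> * \<bar>T\<bar> + \<bar>T\<bar> * \<delta> n"
  let ?R = "\<lambda>n s \<kappa>. \<bar>1 - s\<bar> \<le> \<delta> n \<and> \<bar>\<kappa> - (m4 n - 3 * s\<^sup>2 - 4 * c31 n - 4 * c13 n)\<bar> \<le> 9 * \<delta> n \<and>
    (\<forall>T. \<bar>expectation (\<lambda>\<omega>. cos (T * Z n \<omega>)) - exp (- s * T\<^sup>2 / 2)\<bar> \<le> ?B T s \<kappa> n \<and>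
         \<bar>expectation (\<lambda>\<omega>. sin (T * Z n \<omega>))\<bar> \<le> ?B T s \<kappa> n)"
  have ex: "\<exists>s \<kappa>. n \<ge> N \<longrightarrow> ?R n s \<kappa>" for n
  proof (cases "n \<ge> N")
    case True
    have "\<delta> n > 0" by (simp add: \<delta>_def)
    show ?thesis
    proof (rule trig_moments_of_sum [OF XI YI XY4 [OF True] assms(2-4) \<open>\<delta> n > 0\<close>])
      fix s \<kappa>
      assume "\<bar>expectation (\<lambda>\<omega>. (X n \<omega> + Y n \<omega>)\<^sup>2) - s\<bar> \<le> \<delta> n"
        "\<bar>\<kappa> - (expectation (\<lambda>\<omega>. (X n \<omega> + Y n \<omega>) ^ 4) - 3 * s\<^sup>2
          - 4 * expectation (\<lambda>\<omega>. X n \<omega> ^ 3 * Y n \<omega>) - 4 * expectation (\<lambda>\<omega>. X n \<omega> * Y n \<omega> ^ 3))\<bar> \<le> 9 * \<delta> n"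
        "\<And>T. \<bar>expectation (\<lambda>\<omega>. cos (T * (X n \<omega> + Y n \<omega>))) - exp (- s * T\<^sup>2 / 2)\<bar> \<le> ?B T s \<kappa> n"
        "\<And>T. \<bar>expectation (\<lambda>\<omega>. sin (T * (X n \<omega> + Y n \<omega>)))\<bar> \<le> ?B T s \<kappa> n"
      then have "?R n s \<kappa>"
        unfolding Z [symmetric] Z2 m4_def c31_def c13_def by blast
      then show "\<exists>s \<kappa>. n \<ge> N \<longrightarrow> ?R n s \<kappa>" by blast
    qed
  qed auto
  obtain s where "\<forall>n. \<exists>\<kappa>. n \<ge> N \<longrightarrow> ?R n (s n) \<kappa>"
    using choice [of "\<lambda>n s. \<exists>\<kappa>. n \<ge> N \<longrightarrow> ?R n s \<kappa>"] ex by blast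
  then obtain \<kappa> where "\<forall>n. n \<ge> N \<longrightarrow> ?R n (s n) (\<kappa> n)"
    using choice [of "\<lambda>n \<kappa>. n \<ge> N \<longrightarrow> ?R n (s n) \<kappa>"] by blast
  then have s\<kappa>: "\<forall>\<^sub>F n in sequentially. ?R n (s n) (\<kappa> n)"
    by (intro eventually_sequentiallyI [of N]) blast
  have s1: "s \<longlonglongrightarrow> 1"
  proof -
    have "(\<lambda>n. s n - 1) \<longlonglongrightarrow> 0"
      by (rule Lim_null_comparison [OF _ \<delta>0]) (use s\<kappa> in eventually_elim, simp add: abs_minus_commute)
    then show ?thesis by (simp add: LIM_zero_iff)
  qed
  have \<kappa>0: "\<kappa> \<longlonglongrightarrow> 0"
  proof -
    \<comment> \<open>The variances of the approximations tend to 1, so the limit is the Gaussian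
      balance \<open>3 - 3 = 0\<close>.\<close>
    have a: "(\<lambda>n. m4 n - 3 * (s n)\<^sup>2 - 4 * c31 n - 4 * c13 n) \<longlonglongrightarrow> 3 - 3 * 1\<^sup>2 - 4 * 0 - 4 * 0"
      using assms(13,14) unfolding c31_def c13_def by (intro tendsto_intros \<open>m4 \<longlonglongrightarrow> 3\<close> s1)
    have "(\<lambda>n. 9 * \<delta> n) \<longlonglongrightarrow> 9 * 0" by (intro tendsto_intros \<delta>0)
    then have "(\<lambda>n. 9 * \<delta> n) \<longlonglongrightarrow> 0" by simp
    then have "(\<lambda>n. \<kappa> n - (m4 n - 3 * (s n)\<^sup>2 - 4 * c31 n - 4 * c13 n)) \<longlonglongrightarrow> 0"
      by (rule Lim_null_comparison [rotated]) (use s\<kappa> in eventually_elim, simp)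
    from tendsto_add [OF this a] show ?thesis by simp
  qed
  have B0: "(\<lambda>n. ?B T (s n) (\<kappa> n) n) \<longlonglongrightarrow> 0" for T
  proof -
    have "(\<lambda>n. ?B T (s n) (\<kappa> n) n) \<longlonglongrightarrow>
      (\<bar>T\<bar> * (2 + real (p + q)) + T\<^sup>2 * (32 * real (p + q) + 1)) * sqrt \<bar>0\<bar> * \<bar>T\<bar> + \<bar>T\<bar> * 0"
      by (intro tendsto_intros s1 \<kappa>0 \<delta>0)
    then show ?thesis by simp
  qed
  have cos_lim: "(\<lambda>n. expectation (\<lambda>\<omega>. cos (T * Z n \<omega>))) \<longlonglongrightarrow> exp (- (T\<^sup>2) / 2)" for T
  proof -
    have "(\<lambda>n. expectation (\<lambda>\<omega>. cos (T * Z n \<omega>)) - exp (- s n * T\<^sup>2 / 2)) \<longlonglongrightarrow> 0"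
      by (rule Lim_null_comparison [OF _ B0 [of T]]) (use s\<kappa> in eventually_elim, simp)
    moreover have "(\<lambda>n. exp (- s n * T\<^sup>2 / 2)) \<longlonglongrightarrow> exp (- 1 * T\<^sup>2 / 2)"
      by (intro tendsto_intros s1) auto
    ultimately show ?thesis using tendsto_add by fastforce
  qed
  have sin_lim: "(\<lambda>n. expectation (\<lambda>\<omega>. sin (T * Z n \<omega>))) \<longlonglongrightarrow> 0" for T
    by (rule Lim_null_comparison [OF _ B0 [of T]]) (use s\<kappa> in eventually_elim, simp)
  show ?thesis
  proof (rule levy_continuity)
    show "real_distribution (distr P borel (Z n))" for n
      by (rule real_distribution_distr) simp
    show "real_distribution std_normal_distribution" by (rule real_dist_normal_dist)
    fix T
    have "char (distr P borel (Z n)) T =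
      complex_of_real (expectation (\<lambda>\<omega>. cos (T * Z n \<omega>))) + \<i> * complex_of_real (expectation (\<lambda>\<omega>. sin (T * Z n \<omega>)))" for n
    proof -
      have ic: "integrable P (\<lambda>\<omega>. cos (T * Z n \<omega>))" and isn: "integrable P (\<lambda>\<omega>. sin (T * Z n \<omega>))"
        by (rule integrable_const_bound [of _ 1]; simp)+
      have "char (distr P borel (Z n)) T = (CLINT \<omega>|P. iexp (T * Z n \<omega>))"
        unfolding char_def by (subst integral_distr) auto
      also have "\<dots> = (CLINT \<omega>|P. complex_of_real (cos (T * Z n \<omega>)) + \<i> * complex_of_real (sin (T * Z n \<omega>)))"
      proof -
        have "iexp x = complex_of_real (cos x) + \<i> * complex_of_real (sin x)" for x
          by (simp add: complex_eq_iff Re_exp Im_exp)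
        then show ?thesis by (simp only:)
      qed
      also have "\<dots> = (CLINT \<omega>|P. complex_of_real (cos (T * Z n \<omega>))) + (CLINT \<omega>|P. \<i> * complex_of_real (sin (T * Z n \<omega>)))"
        using ic isn by (intro Bochner_Integration.integral_add) auto
      finally show ?thesis by simp
    qed
    moreover have "(\<lambda>n. complex_of_real (expectation (\<lambda>\<omega>. cos (T * Z n \<omega>))) + \<i> * complex_of_real (expectation (\<lambda>\<omega>. sin (T * Z n \<omega>))))
      \<longlonglongrightarrow> complex_of_real (exp (- (T\<^sup>2) / 2)) + \<i> * complex_of_real 0"
      by (intro tendsto_intros cos_lim sin_lim)
    ultimately show "(\<lambda>n. char (distr P borel (Z n)) T) \<longlonglongrightarrow> char std_normal_distribution T"
      by (simp add: char_std_normal_distribution)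
  qed
qed

end
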